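(* Let $N\ge2$, let $\Omega\subset\mathbb{R}^N$, $\mathcal D$ and $g$ be as in the context, and let $p\in(1,p_N)$ be the exponent in the growth assumption on $g$. Then the positivity threshold $\lambda_+(\Omega,p)$ defined in the context satisfies $$\lambda_+(\Omega,p)>\frac{A}{p}\,\Lambda(\Omega,2p).$$
   Context: Setting. $\Omega\subset\mathbb{R}^N$, $N\ge2$, is a smooth bounded domain with $|\Omega|=1$, and $r\in(0,1)$ is fixed. $\mathcal D\psi=-\sum_{i,j=1}^N \partial_{x_i}\big(a_{ij}(x)\,\partial_{x_j}\psi\big)$ with $a_{ij}=a_{ji}\in C^2(\overline\Omega)$ and $\sum_{i,j}a_{ij}(x)\xi_i\xi_j\ge A|\xi|^2$ for all $x\in\overline\Omega$, $\xi\in\mathbb{R}^N$, for some constant $A>0$. The function $g=g(x,z):\overline\Omega\times\mathbb{R}\to[0,+\infty)$ is continuous, $C^1$ in $z$, $g(\cdot,z)=0$ for $z\le 0$, $g_z(\cdot,z)>0$ for $z>0$, and for all $z>0$: $$\frac{g_z(\cdot,z)}{g(\cdot,z)}>\frac1z,\qquad \frac{g_z(\cdot,z)}{g(\cdot,z)}\le\frac pz,\qquad g(\cdot,z)\le z^p,$$ for some $p\in(1,p_N)$, where $p_2=+\infty$ and $p_N=\frac{N}{N-2}$ for $N\ge3$. For $\lambda\ge0$, a solution of $(P_\lambda)$ is a pair $(\alpha,\psi)\in\mathbb{R}\times C^{2,r}(\overline\Omega)$ with $$\mathcal D\psi=g(x,\alpha+\lambda\psi)\ \text{in }\Omega,\qquad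 \int_\Omega g(x,\alpha+\lambda\psi)\,dx=1,\qquad \psi=0\ \text{on }\partial\Omega .$$ Notation. $\Lambda(\Omega,t)=\inf_{w\in H^1_0(\Omega)\setminus\{0\}}\dfrac{\int_\Omega|\nabla w|^2}{(\int_\Omega|w|^t)^{2/t}}$ for $t\ge1$. $$\lambda_+(\Omega,p)=\sup\{\lambda>0:\ \alpha_\mu>0\text{ for every solution }(\alpha_\mu,\psi_\mu)\text{ of }(P_\mu),\ \text{for all }0\le\mu<\lambda\}.$$ *)

theory Defs
  imports "HOL-Analysis.Analysis" "HOL-Library.Extended_Real"
begin

section \<open>Partial derivatives and spaces of differentiable functions\<close>

definition pd :: "'n::finite \<Rightarrow> (real^'n \<Rightarrow> real) \<Rightarrow> real^'n \<Rightarrow> real" where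
  "pd i f x = frechet_derivative f (at x) (axis i 1)"

definition grad :: "(real^'n::finite \<Rightarrow> real) \<Rightarrow> real^'n \<Rightarrow> real^'n" where
  "grad f x = (\<chi> i. pd i f x)"

text \<open>The list \<open>is\<close> is a sequence of coordinate directions; its length is the order
  of the partial derivative.\<close>

definition pds :: "'n::finite list \<Rightarrow> (real^'n \<Rightarrow> real) \<Rightarrow> real^'n \<Rightarrow> real" where
  "pds is f = foldr pd is f"

text \<open>Only used for open \<open>U\<close>.\<close>

definition Ck_on :: "nat \<Rightarrow> (real^'n::finite) set \<Rightarrow> (real^'n \<Rightarrow> real) \<Rightarrow> bool" where
  "Ck_on k U f \<longleftrightarrow>
     (\<forall>is. length is < k \<longrightarrow> (\<forall>x\<in>U. pds is f differentiable (at x))) \<and>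
     (\<forall>is. length is \<le> k \<longrightarrow> continuous_on U (pds is f))"

definition Cinf_on :: "(real^'n::finite) set \<Rightarrow> (real^'n \<Rightarrow> real) \<Rightarrow> bool" where
  "Cinf_on U f \<longleftrightarrow> (\<forall>k. Ck_on k U f)"

text \<open>\<open>C\<^sup>k\<close> up to the boundary: the derivatives live on the open set \<open>U\<close> and extend
  continuously to its closure. Values of \<open>f\<close> outside the closure are irrelevant.\<close>

definition Ck_closure :: "nat \<Rightarrow> (real^'n::finite) set \<Rightarrow> (real^'n \<Rightarrow> real) \<Rightarrow> bool" where
  "Ck_closure k U f \<longleftrightarrow>
     Ck_on k U f \<and> continuous_on (closure U) f \<and>
     (\<forall>is. length is \<le> k \<longrightarrow>
        (\<exists>h. continuous_on (closure U) h \<and> (\<forall>x\<in>U. h x = pds is f x)))"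

text \<open>\<open>C\<^sup>k\<^sup>,\<^sup>r\<close> on the closure. Hoelder continuity of the top-order derivatives on \<open>U\<close> is
  the same as that of their continuous extensions; lower orders are unconstrained beyond
  \<open>C\<^sup>k\<close>.\<close>

definition Ckr_closure :: "nat \<Rightarrow> real \<Rightarrow> (real^'n::finite) set \<Rightarrow> (real^'n \<Rightarrow> real) \<Rightarrow> bool" where
  "Ckr_closure k r U f \<longleftrightarrow>
     Ck_closure k U f \<and>
     (\<forall>is. length is = k \<longrightarrow>
        (\<exists>C. \<forall>x\<in>U. \<forall>y\<in>U. \<bar>pds is f x - pds is f y\<bar> \<le> C * dist x y powr r))"

section \<open>Smooth bounded domains\<close>

text \<open>Near each boundary point, after relabelling and reorienting the coordinate axes
  (the choice of \<open>i\<close> and of the sign \<open>s\<close>), the set is the region above the graph of a smooth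
  function \<open>\<gamma>\<close> of the remaining \<open>N - 1\<close> coordinates. A function of those coordinates is
  encoded as a function on the whole space that does not depend on the \<open>i\<close>-th one.\<close>

definition smooth_boundary :: "(real^'n::finite) set \<Rightarrow> bool" where
  "smooth_boundary \<Omega> \<longleftrightarrow>
     (\<forall>x0\<in>frontier \<Omega>. \<exists>e>0. \<exists>i. \<exists>s\<in>{1, -1::real}. \<exists>\<gamma>.
        Cinf_on UNIV \<gamma> \<and>
        (\<forall>x y. (\<forall>j. j \<noteq> i \<longrightarrow> x $ j = y $ j) \<longrightarrow> \<gamma> x = \<gamma> y) \<and>
        \<Omega> \<inter> ball x0 e = {x \<in> ball x0 e. s * x $ i > \<gamma> x})"

definition smooth_bounded_domain :: "(real^'n::finite) set \<Rightarrow> bool" where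
  "smooth_bounded_domain \<Omega> \<longleftrightarrow>
     open \<Omega> \<and> connected \<Omega> \<and> \<Omega> \<noteq> {} \<and> bounded \<Omega> \<and> smooth_boundary \<Omega>"

section \<open>The Sobolev space and the constant \<open>\<Lambda>(\<Omega>,t)\<close>\<close>

definition L2_on :: "(real^'n::finite) set \<Rightarrow> (real^'n \<Rightarrow> 'b::euclidean_space) \<Rightarrow> bool" where
  "L2_on \<Omega> f \<longleftrightarrow>
     f \<in> borel_measurable (lebesgue_on \<Omega>) \<and> integrable (lebesgue_on \<Omega>) (\<lambda>x. (norm (f x))\<^sup>2)"

definition test_functions :: "(real^'n::finite) set \<Rightarrow> (real^'n \<Rightarrow> real) set" where
  "test_functions \<Omega> =
     {\<phi>. Cinf_on UNIV \<phi> \<and> compact (closure {x. \<phi> x \<noteq> 0}) \<and> closure {x. \<phi> x \<noteq> 0} \<subseteq> \<Omega>}"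

text \<open>\<open>w\<close> belongs to \<open>H\<^sup>1(\<Omega>)\<close> with weak gradient \<open>G\<close>. Functions stand for
  their almost-everywhere classes.\<close>

definition has_weak_gradient ::
    "(real^'n::finite) set \<Rightarrow> (real^'n \<Rightarrow> real) \<Rightarrow> (real^'n \<Rightarrow> real^'n) \<Rightarrow> bool" where
  "has_weak_gradient \<Omega> w G \<longleftrightarrow>
     L2_on \<Omega> w \<and> L2_on \<Omega> G \<and>
     (\<forall>\<phi>\<in>test_functions \<Omega>. \<forall>i.
        (LINT x|lebesgue_on \<Omega>. w x * pd i \<phi> x) = - (LINT x|lebesgue_on \<Omega>. G x $ i * \<phi> x))"

text \<open>The closure of the test functions in the \<open>H\<^sup>1\<close> norm.\<close>

definition H10 :: "(real^'n::finite) set \<Rightarrow> (real^'n \<Rightarrow> real) set" where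
  "H10 \<Omega> =
     {w. \<exists>G. has_weak_gradient \<Omega> w G \<and>
        (\<exists>\<phi>. (\<forall>k::nat. \<phi> k \<in> test_functions \<Omega>) \<and>
          (\<lambda>k. LINT x|lebesgue_on \<Omega>. (\<phi> k x - w x)\<^sup>2 + (norm (grad (\<phi> k) x - G x))\<^sup>2)
            \<longlonglongrightarrow> 0)}"

text \<open>The weak gradient \<open>G\<close> is determined by \<open>w\<close> up to null sets. Should \<open>\<bar>w\<bar>\<^sup>t\<close> not be
  integrable, its Bochner integral is \<open>0\<close> and the quotient is \<open>0\<close>, in agreement with
  the convention that a number divided by infinity is \<open>0\<close>.\<close>

definition Lambda :: "(real^'n::finite) set \<Rightarrow> real \<Rightarrow> real" where
  "Lambda \<Omega> t =
     Inf {(LINT x|lebesgue_on \<Omega>. (norm (G x))\<^sup>2) /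
          (LINT x|lebesgue_on \<Omega>. \<bar>w x\<bar> powr t) powr (2 / t) | w G.
          w \<in> H10 \<Omega> \<and> \<not> (AE x in lebesgue_on \<Omega>. w x = 0) \<and> has_weak_gradient \<Omega> w G}"

section \<open>The operator, the nonlinearity and the problem \<open>(P\<^sub>\<lambda>)\<close>\<close>

definition elliptic_coeffs ::
    "(real^'n::finite) set \<Rightarrow> real \<Rightarrow> ('n \<Rightarrow> 'n \<Rightarrow> real^'n \<Rightarrow> real) \<Rightarrow> bool" where
  "elliptic_coeffs \<Omega> A a \<longleftrightarrow>
     A > 0 \<and>
     (\<forall>i j. Ck_closure 2 \<Omega> (a i j)) \<and>
     (\<forall>i j. \<forall>x\<in>closure \<Omega>. a i j x = a j i x) \<and>
     (\<forall>x\<in>closure \<Omega>. \<forall>\<xi>. (\<Sum>i\<in>UNIV. \<Sum>j\<in>UNIV. a i j x * \<xi> $ i * \<xi> $ j) \<ge> A * (norm \<xi>)\<^sup>2)"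

definition div_op ::
    "('n::finite \<Rightarrow> 'n \<Rightarrow> real^'n \<Rightarrow> real) \<Rightarrow> (real^'n \<Rightarrow> real) \<Rightarrow> real^'n \<Rightarrow> real" where
  "div_op a \<psi> x = - (\<Sum>i\<in>UNIV. \<Sum>j\<in>UNIV. pd i (\<lambda>y. a i j y * pd j \<psi> y) x)"

definition crit_exponent :: "nat \<Rightarrow> ereal" where
  "crit_exponent N = (if N = 2 then \<infinity> else ereal (real N / (real N - 2)))"

text \<open>Being \<open>C\<^sup>1\<close> in \<open>z\<close> is required of \<open>g(x,\<cdot>)\<close> for each fixed \<open>x\<close>;
  no joint continuity of \<open>g\<^sub>z\<close> is assumed.\<close>

definition admissible_nonlinearity ::
    "(real^'n::finite) set \<Rightarrow> real \<Rightarrow> (real^'n \<Rightarrow> real \<Rightarrow> real) \<Rightarrow> bool" where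
  "admissible_nonlinearity \<Omega> p g \<longleftrightarrow>
     continuous_on (closure \<Omega> \<times> UNIV) (\<lambda>(x, z). g x z) \<and>
     (\<forall>x\<in>closure \<Omega>.
        (\<forall>z. g x z \<ge> 0) \<and>
        (g x) C1_differentiable_on UNIV \<and>
        (\<forall>z\<le>0. g x z = 0) \<and>
        (\<forall>z>0. deriv (g x) z > 0 \<and>
               deriv (g x) z / g x z > 1 / z \<and>
               deriv (g x) z / g x z \<le> p / z \<and>
               g x z \<le> z powr p))"

definition is_solution ::
    "real \<Rightarrow> (real^'n::finite) set \<Rightarrow> ('n \<Rightarrow> 'n \<Rightarrow> real^'n \<Rightarrow> real) \<Rightarrow>
     (real^'n \<Rightarrow> real \<Rightarrow> real) \<Rightarrow> real \<Rightarrow> real \<Rightarrow> (real^'n \<Rightarrow> real) \<Rightarrow> bool" where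
  "is_solution r \<Omega> a g l \<alpha> \<psi> \<longleftrightarrow>
     Ckr_closure 2 r \<Omega> \<psi> \<and>
     (\<forall>x\<in>\<Omega>. div_op a \<psi> x = g x (\<alpha> + l * \<psi> x)) \<and>
     (LINT x|lebesgue_on \<Omega>. g x (\<alpha> + l * \<psi> x)) = 1 \<and>
     (\<forall>x\<in>frontier \<Omega>. \<psi> x = 0)"

text \<open>The exponent \<open>p\<close> of \<open>\<lambda>\<^sub>+(\<Omega>,p)\<close> enters through \<open>g\<close>. The supremum is taken in the
  extended reals because the set need not be bounded a priori.\<close>

definition lambda_plus ::
    "real \<Rightarrow> (real^'n::finite) set \<Rightarrow> ('n \<Rightarrow> 'n \<Rightarrow> real^'n \<Rightarrow> real) \<Rightarrow>
     (real^'n \<Rightarrow> real \<Rightarrow> real) \<Rightarrow> ereal" where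
  "lambda_plus r \<Omega> a g =
     Sup (ereal ` {l. l > 0 \<and>
       (\<forall>\<mu>. 0 \<le> \<mu> \<and> \<mu> < l \<longrightarrow> (\<forall>\<alpha> \<psi>. is_solution r \<Omega> a g \<mu> \<alpha> \<psi> \<longrightarrow> \<alpha> > 0))})"

end

theory Submission
  imports Defs
begin

text \<open>If a solution for some \<open>\<mu> > 0\<close> has \<open>\<alpha> \<le> 0\<close>, then the positive part of \<open>u = \<alpha> + \<mu> \<psi>\<close> vanishes on the
  boundary, and testing the equation with it gives \<open>A \<integral>\<bar>\<nabla>u\<^sub>+\<bar>\<^sup>2 \<le> \<mu> \<integral> g u\<^sub>+\<close>. As \<open>g \<le> u\<^sub>+\<^sup>p\<close> and
  \<open>\<integral> g = 1\<close>, Hoelder's inequality bounds \<open>\<integral> g u\<^sub>+ \<le> \<integral> g\<^bsup>1 - 1/p\<^esup> u\<^sub>+\<^sup>2\<close> by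
  \<open>(\<integral> u\<^sub>+\<^bsup>2p\<^esup>)\<^bsup>1/p\<^esup>\<close>, hence \<open>A \<Lambda>(\<Omega>,2p) \<le> \<mu>\<close>. So the threshold is at least \<open>A \<Lambda>(\<Omega>,2p)\<close>, and the
  inequality is strict because \<open>p > 1\<close> and \<open>\<Lambda>(\<Omega>,2p) > 0\<close>. The latter is the subcritical Sobolev
  inequality, obtained from the pointwise bound of a test function by the Riesz potential
  \<open>\<integral> \<bar>\<nabla>\<phi>(y)\<bar> \<bar>x - y\<bar>\<^bsup>1 - N\<^esup> dy\<close> of its gradient.\<close>

section \<open>Partial derivatives and integration\<close>

text \<open>The exponent 2p is dictated by the mass constraint. Only the integral of g is known, so
  Hoelder's inequality spends exactly g^(1 - 1/p) on it, and g^(1/p) \<le> u_+ turns what is left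
  into u_+^2. Both ends of the final inequality then carry the same power of the integral of
  u_+^(2p), which cancels. Two obstacles shape the testing step: u_+ is not C^1, and integrating by
  parts on \<Omega> would bring in the boundary. A C^1 truncation of u_+ that vanishes where u \<le>
  e removes both. Extended by zero it has compact support inside \<Omega>, and every integration by
  parts reduces to one fact on the whole space: a partial derivative of a C^1 function of bounded
  support has integral zero. The limit e to 0 is taken only in the resulting inequality.
  \<open>Lambda\<close> is an infimum over \<open>H10\<close>. Bounding it from above needs only C^1
  functions of compact support, which mollification reaches. Its positivity concerns every element
  of \<open>H10\<close> and includes the integrability of \<bar>w\<bar>^(2p), without which the
  quotient would be 0 by convention.\<close>

lemma pd_eq: "(f has_derivative f') (at x) \<Longrightarrow> pd i f x = f' (axis i 1)"
  unfolding pd_def using frechet_derivative_at by fastforce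

lemma has_derivative_grad:
  fixes f :: "real^'n \<Rightarrow> real"
  assumes "f differentiable (at x)"
  shows "(f has_derivative (\<lambda>h. grad f x \<bullet> h)) (at x)"
proof -
  have d: "(f has_derivative frechet_derivative f (at x)) (at x)"
    using assms frechet_derivative_works by blast
  then interpret bounded_linear "frechet_derivative f (at x)"
    by (rule has_derivative_bounded_linear)
  have "frechet_derivative f (at x) h = grad f x \<bullet> h" for h
  proof -
    have "frechet_derivative f (at x) h = frechet_derivative f (at x) (\<Sum>i\<in>UNIV. (h $ i) *\<^sub>R axis i 1)"
      by (simp add: basis_expansion flip: scalar_mult_eq_scaleR)
    also have "\<dots> = (\<Sum>i\<in>UNIV. h $ i * pd i f x)"
      by (simp add: sum scale pd_def)
    also have "\<dots> = grad f x \<bullet> h"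
      by (simp add: grad_def inner_vec_def mult.commute)
    finally show ?thesis .
  qed
  then have "frechet_derivative f (at x) = (\<lambda>h. grad f x \<bullet> h)" by blast
  then show ?thesis using d by simp
qed

lemma pd_add:
  assumes "f differentiable (at x)" "g differentiable (at x)"
  shows "pd i (\<lambda>x. f x + g x) x = pd i f x + pd i g x"
  by (subst pd_eq[OF has_derivative_add[OF has_derivative_grad[OF assms(1)] has_derivative_grad[OF assms(2)]]])
    (auto simp: grad_def inner_axis)

lemma pd_mult:
  assumes "f differentiable (at x)" "g differentiable (at x)"
  shows "pd i (\<lambda>x. f x * g x) x = pd i f x * g x + f x * pd i g x"
  by (subst pd_eq[OF has_derivative_mult[OF has_derivative_grad[OF assms(1)] has_derivative_grad[OF assms(2)]]])
    (auto simp: grad_def inner_axis)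

lemma pd_chain:
  assumes "f differentiable (at x)" "(h has_real_derivative d) (at (f x))"
  shows "pd i (\<lambda>x. h (f x)) x = d * pd i f x" and "(\<lambda>x. h (f x)) differentiable (at x)"
proof -
  have "((\<lambda>x. h (f x)) has_derivative (\<lambda>v. (grad f x \<bullet> v) * d)) (at x)"
    using has_derivative_compose[OF has_derivative_grad[OF assms(1)]
      assms(2)[unfolded has_field_derivative_def]] by (simp add: mult.commute)
  then show "pd i (\<lambda>x. h (f x)) x = d * pd i f x" "(\<lambda>x. h (f x)) differentiable (at x)"
    by (auto simp: pd_eq grad_def inner_axis mult.commute differentiable_def)
qed

lemma pd_const: "pd i (\<lambda>x. c) x = 0"
  using pd_eq[OF has_derivative_const] by blast

lemma pd_coord: "pd i (\<lambda>x. x $ j) x = (if i = j then 1 else 0)"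
  by (subst pd_eq[OF bounded_linear_imp_has_derivative[OF bounded_linear_vec_nth]]) (auto simp: axis_def)

lemma pd_shift:
  assumes "f differentiable (at (x + c))"
  shows "pd i (\<lambda>x. f (x + c)) x = pd i f (x + c)" and "(\<lambda>x. f (x + c)) differentiable (at x)"
proof -
  have "((\<lambda>x. x + c) has_derivative (\<lambda>v. v)) (at x)" by (auto intro!: derivative_eq_intros)
  from has_derivative_compose[OF this has_derivative_grad[OF assms]]
  have "((\<lambda>x. f (x + c)) has_derivative (\<lambda>v. grad f (x + c) \<bullet> v)) (at x)" .
  then show "pd i (\<lambda>x. f (x + c)) x = pd i f (x + c)" "(\<lambda>x. f (x + c)) differentiable (at x)"
    by (auto simp: pd_eq grad_def inner_axis differentiable_def)
qed

lemma pd_cong_open: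
  assumes "open U" "x \<in> U" "\<And>y. y \<in> U \<Longrightarrow> f y = g y"
  shows "pd i f x = pd i g x" "f differentiable (at x) \<longleftrightarrow> g differentiable (at x)"
proof -
  have "(f has_derivative D) (at x) \<longleftrightarrow> (g has_derivative D) (at x)" for D
    using has_derivative_transform_within_open[OF _ assms(1,2)] assms(3) by metis
  then show "pd i f x = pd i g x" "f differentiable (at x) \<longleftrightarrow> g differentiable (at x)"
    by (auto simp: pd_def frechet_derivative_def differentiable_def)
qed

lemma Ck_on_1_iff:
  fixes U :: "(real^'n) set"
  shows "Ck_on 1 U f \<longleftrightarrow> (\<forall>x\<in>U. f differentiable (at x)) \<and> (\<forall>i. continuous_on U (pd i f))"
    (is "_ \<longleftrightarrow> ?R")
proof
  assume "Ck_on 1 U f"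
  then have "pds [] f differentiable (at x)" "continuous_on U (pds [i] f)" if "x \<in> U" for x and i :: 'n
    using that by (auto simp: Ck_on_def)
  moreover have "continuous_on U (pds [i] f)" for i
    using \<open>Ck_on 1 U f\<close> by (auto simp: Ck_on_def)
  ultimately show ?R by (auto simp: pds_def)
next
  assume R: ?R
  then have c: "continuous_on U f"
    by (auto intro!: continuous_at_imp_continuous_on differentiable_imp_continuous_within)
  have "continuous_on U (pds is f)" if "length is \<le> 1" for "is"
    using that R c by (cases "is") (auto simp: pds_def)
  with R show "Ck_on 1 U f" unfolding Ck_on_def by (auto simp: pds_def)
qed

lemma Ck_on_1D:
  assumes "Ck_on 1 U f"
  shows "x \<in> U \<Longrightarrow> f differentiable (at x)" "continuous_on U (pd i f)" "continuous_on U f"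
    "continuous_on U (grad f)"
proof -
  show "x \<in> U \<Longrightarrow> f differentiable (at x)" "continuous_on U (pd i f)" for i
    using assms unfolding Ck_on_1_iff by auto
  then show "continuous_on U (grad f)" unfolding grad_def by (intro continuous_intros)
  show "continuous_on U f" using assms
    unfolding Ck_on_1_iff by (auto intro!: continuous_at_imp_continuous_on differentiable_imp_continuous_within)
qed

lemma Ck_on_pd:
  fixes f :: "real^'n \<Rightarrow> real"
  assumes "Ck_on (Suc k) U f"
  shows "Ck_on k U (pd i f)"
proof -
  have "pds is (pd i f) = pds (is @ [i]) f" for "is" by (simp add: pds_def)
  then show ?thesis using assms
    unfolding Ck_on_def by (metis Suc_less_eq Suc_le_mono length_append_singleton)
qed

lemma Ck_on_mono: "Ck_on k U f \<Longrightarrow> l \<le> k \<Longrightarrow> Ck_on l U f"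
  by (auto simp: Ck_on_def)

lemma pd_support: "closure {x. pd i f x \<noteq> 0} \<subseteq> closure {x. f x \<noteq> 0}"
proof -
  have "x \<in> closure {x. f x \<noteq> 0}" if "pd i f x \<noteq> 0" for x
  proof (rule ccontr)
    assume "x \<notin> closure {x. f x \<noteq> 0}"
    then have "pd i f x = pd i (\<lambda>x. 0) x"
      by (intro pd_cong_open(1)[where U="- closure {x. f x \<noteq> 0}"])
        (use closure_subset[of "{x. f x \<noteq> 0}"] in auto)
    then show False using that pd_const by metis
  qed
  then have "{x. pd i f x \<noteq> 0} \<subseteq> closure {x. f x \<noteq> 0}" by blast
  then show ?thesis by (intro closure_minimal closed_closure)
qed

lemma bounded_pd_support: "bounded {x. f x \<noteq> 0} \<Longrightarrow> bounded {x. pd i f x \<noteq> 0}"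
  by (rule bounded_subset[OF bounded_closure order_trans[OF closure_subset pd_support]])

lemma bounded_grad_support:
  fixes f :: "real^'n \<Rightarrow> real"
  assumes "bounded {x. f x \<noteq> 0}" shows "bounded {x. grad f x \<noteq> 0}"
proof (rule bounded_subset)
  show "bounded (\<Union>i. {x. pd i f x \<noteq> 0})" using bounded_pd_support[OF assms] by (intro bounded_UN) auto
  show "{x. grad f x \<noteq> 0} \<subseteq> (\<Union>i. {x. pd i f x \<noteq> 0})" by (auto simp: grad_def vec_eq_iff)
qed

section \<open>Integrals of functions of bounded support\<close>

lemma continuous_bounded_support:
  fixes f :: "'a::euclidean_space \<Rightarrow> 'b::euclidean_space"
  assumes c: "continuous_on UNIV f" and b: "bounded {x. f x \<noteq> 0}"
  shows "integrable lborel f" and "\<exists>B>0. \<forall>x. norm (f x) \<le> B" and "uniformly_continuous_on UNIV f"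
proof -
  define K where "K = closure {x. f x \<noteq> 0}"
  have K: "compact K" using b by (simp add: K_def)
  have z: "f x = 0" if "x \<notin> K" for x using that closure_subset[of "{x. f x \<noteq> 0}"] by (auto simp: K_def)
  have "integrable lborel (\<lambda>x. indicator K x *\<^sub>R f x)"
    by (rule borel_integrable_compact[OF K continuous_on_subset[OF c]]) auto
  moreover have "(\<lambda>x. indicator K x *\<^sub>R f x) = f" using z by (auto simp: indicator_def)
  ultimately show "integrable lborel f" by metis
  have "bounded (f ` K)" using K c by (intro compact_imp_bounded compact_continuous_image) (auto intro: continuous_on_subset)
  then obtain B where B: "B > 0" "\<And>y. y \<in> f ` K \<Longrightarrow> norm y \<le> B" by (meson bounded_pos)
  have "norm (f x) \<le> B" for x using B z by (cases "x \<in> K") auto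
  then show "\<exists>B>0. \<forall>x. norm (f x) \<le> B" using B by blast
  show "uniformly_continuous_on UNIV f"
  proof -
    \<comment> \<open>The unit margin around the support handles all cases: if two points at
      distance below 1 are not both in \<open>cball 0 (R+1)\<close>, then both have norm above
      \<open>R\<close>, where \<open>f\<close> vanishes.\<close>
    obtain R where R: "K \<subseteq> ball 0 R" using K compact_imp_bounded bounded_subset_ballD by blast
    have u: "uniformly_continuous_on (cball 0 (R+1)) f"
      by (intro compact_uniformly_continuous continuous_on_subset[OF c]) auto
    show ?thesis unfolding uniformly_continuous_on_def
    proof (intro allI impI)
      fix e :: real assume "e > 0"
      then obtain d where d: "d > 0" "\<And>x x'. x \<in> cball 0 (R+1) \<Longrightarrow> x' \<in> cball 0 (R+1) \<Longrightarrow> dist x' x < d \<Longrightarrow> dist (f x') (f x) < e"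
        using u unfolding uniformly_continuous_on_def by meson
      have "dist (f x') (f x) < e" if "dist x' x < min d 1" for x x'
      proof (cases "x \<in> cball 0 (R+1) \<and> x' \<in> cball 0 (R+1)")
        case True then show ?thesis using d that by auto
      next
        case False
        have "\<bar>norm x - norm x'\<bar> < 1" using that norm_triangle_ineq3[of x x'] by (auto simp: dist_norm norm_minus_commute)
        then have "norm x > R" "norm x' > R" using False by auto
        then have "f x = 0" "f x' = 0" using R z by (meson mem_ball_0 not_less_iff_gr_or_eq subset_iff)+
        then show ?thesis using \<open>e > 0\<close> by simp
      qed
      then show "\<exists>d>0. \<forall>x\<in>UNIV. \<forall>x'\<in>UNIV. dist x' x < d \<longrightarrow> dist (f x') (f x) < e"
        using d by (intro exI[of _ "min d 1"]) auto
    qed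
  qed
qed

lemma lborel_integral_translate:
  fixes f :: "'a::euclidean_space \<Rightarrow> 'b::{banach, second_countable_topology}"
  assumes [measurable]: "f \<in> borel_measurable borel"
  shows "(LINT x|lborel. f (c + x)) = (LINT x|lborel. f x)"
  by (subst (2) lborel_distr_plus[of c, symmetric], subst integral_distr) auto

lemma lborel_integral_reflect:
  fixes f :: "'a::euclidean_space \<Rightarrow> 'b::{banach, second_countable_topology}"
  assumes [measurable]: "f \<in> borel_measurable borel"
  shows "(LINT x|lborel. f (c - x)) = (LINT x|lborel. f x)"
proof -
  have "(LINT x|lborel. f (c + x)) = (LINT x|distr lborel borel uminus. f (c + x))"
    using lborel_affine[of "-1" "0::'a"]
    by (simp add: density_1)
  also have "\<dots> = (LINT x|lborel. f (c - x))" by (subst integral_distr) auto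
  finally show ?thesis using lborel_integral_translate[OF assms, of c] by simp
qed

lemma pd_line:
  fixes f :: "real^'n \<Rightarrow> real"
  assumes "f differentiable (at (x + t *\<^sub>R axis i 1))"
  shows "((\<lambda>t. f (x + t *\<^sub>R axis i 1)) has_real_derivative pd i f (x + t *\<^sub>R axis i 1)) (at t)"
proof -
  have "((\<lambda>t. x + t *\<^sub>R axis i 1) has_derivative (\<lambda>t. t *\<^sub>R axis i 1)) (at t)"
    by (auto intro!: derivative_eq_intros)
  from has_derivative_compose[OF this has_derivative_grad[OF assms]]
  have "((\<lambda>t. f (x + t *\<^sub>R axis i 1)) has_derivative (\<lambda>s. s * pd i f (x + t *\<^sub>R axis i 1))) (at t)"
    by (simp add: grad_def inner_axis)
  moreover have "(\<lambda>s. s * pd i f (x + t *\<^sub>R axis i 1)) = (*) (pd i f (x + t *\<^sub>R axis i 1))"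
    by (simp add: fun_eq_iff mult.commute)
  ultimately show ?thesis unfolding has_field_derivative_def by simp
qed

text \<open>Translation invariance makes the integral of every difference quotient vanish.\<close>

lemma integral_pd_eq_0:
  fixes f :: "real^'n \<Rightarrow> real"
  assumes C: "Ck_on 1 UNIV f" and b: "bounded {x. f x \<noteq> 0}"
  shows "(LINT x|lborel. pd i f x) = 0"
proof -
  let ?e = "axis i 1 :: real^'n"
  define D where "D n x = (f (inverse (Suc n) *\<^sub>R ?e + x) - f x) * real (Suc n)" for n x
  have cf: "continuous_on UNIV f" and cp: "continuous_on UNIV (pd i f)"
    and df: "\<And>x. f differentiable (at x)" using Ck_on_1D[OF C] by auto
  have [measurable]: "f \<in> borel_measurable borel" "pd i f \<in> borel_measurable borel"
    using cf cp by (auto intro: borel_measurable_continuous_onI)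
  obtain B where B: "B > 0" "\<And>x. \<bar>pd i f x\<bar> \<le> B"
    using continuous_bounded_support(2)[OF cp bounded_pd_support[OF b]] by auto
  obtain R where R: "\<And>x. f x \<noteq> 0 \<Longrightarrow> norm x \<le> R" using b unfolding bounded_iff by blast
  have fi: "integrable lborel f" using continuous_bounded_support(1)[OF cf b] .
  have fti: "integrable lborel (\<lambda>x. f (c + x))" for c
  proof (rule continuous_bounded_support(1))
    show "continuous_on UNIV (\<lambda>x. f (c + x))"
      by (intro continuous_on_compose2[OF cf] continuous_intros) auto
    have "{x. f (c + x) \<noteq> 0} = (\<lambda>x. x - c) ` {x. f x \<noteq> 0}"
      by (auto simp: image_iff) (metis add.commute add_diff_cancel_right')
    then show "bounded {x. f (c + x) \<noteq> 0}" using b bounded_translation_minus by metis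
  qed
  have D0: "(LINT x|lborel. D n x) = 0" for n
    unfolding D_def using fi fti by (simp add: lborel_integral_translate)
  \<comment> \<open>The shifts have length at most 1, so every quotient vanishes outside
    \<open>cball 0 (R+1)\<close>; the mean value theorem bounds it there by the supremum
    \<open>B\<close> of the derivative.\<close>
  have "(\<lambda>n. LINT x|lborel. D n x) \<longlonglongrightarrow> (LINT x|lborel. pd i f x)"
  proof (rule integral_dominated_convergence[where w="\<lambda>x. B * indicator (cball 0 (R+1)) x"])
    show "integrable lborel (\<lambda>x. B * indicator (cball 0 (R+1)) x :: real)"
      by (intro integrable_mult_right) (auto intro!: integrable_real_indicator emeasure_bounded_finite)
    show "AE x in lborel. (\<lambda>n. D n x) \<longlonglongrightarrow> pd i f x"
    proof (intro AE_I2)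
      fix x
      have "((\<lambda>t. f (x + t *\<^sub>R ?e)) has_real_derivative pd i f x) (at 0)"
        using pd_line[OF df, where x=x and t=0 and i=i] by simp
      then have "(\<lambda>h. (f (x + h *\<^sub>R ?e) - f x) / h) \<midarrow>0\<rightarrow> pd i f x"
        by (simp add: DERIV_def)
      from filterlim_compose[OF this filterlim_atI[OF LIMSEQ_inverse_real_of_nat]]
      show "(\<lambda>n. D n x) \<longlonglongrightarrow> pd i f x"
        unfolding D_def by (simp add: add.commute[of x] divide_inverse)
    qed
    show "AE x in lborel. norm (D n x) \<le> B * indicator (cball 0 (R+1)) x" for n
    proof (intro AE_I2)
      fix x
      define h where "h = inverse (real (Suc n))"
      have h: "0 < h" "h \<le> 1" by (auto simp: h_def field_simps)
      obtain z where z: "f (x + h *\<^sub>R ?e) - f (x + 0 *\<^sub>R ?e) = (h - 0) * pd i f (x + z *\<^sub>R ?e)"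
        using MVT2[of 0 h "\<lambda>t. f (x + t *\<^sub>R ?e)" "\<lambda>t. pd i f (x + t *\<^sub>R ?e)"] pd_line[OF df] h by blast
      then have "D n x = pd i f (x + z *\<^sub>R ?e)" using h
        by (simp add: D_def add.commute h_def[symmetric]) (simp add: h_def)
      then have 1: "\<bar>D n x\<bar> \<le> B" using B by simp
      show "norm (D n x) \<le> B * indicator (cball 0 (R+1)) x"
      proof (cases "x \<in> cball 0 (R+1)")
        case True then show ?thesis using 1 by simp
      next
        case False
        have "norm x \<le> norm (h *\<^sub>R ?e + x) + norm (h *\<^sub>R ?e)" using norm_triangle_ineq4[of "h *\<^sub>R ?e + x" "h *\<^sub>R ?e"] by simp
        then have "norm x > R" "norm (h *\<^sub>R ?e + x) > R" using False h by auto
        then have "f x = 0" "f (h *\<^sub>R ?e + x) = 0" using R by force+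
        then show ?thesis using B by (simp add: D_def h_def)
      qed
    qed
  qed (auto simp: D_def)
  then show ?thesis by (simp add: D0 LIMSEQ_const_iff)
qed

section \<open>Mollification\<close>

text \<open>An invariant replaces the bookkeeping of iterated partial derivatives: they all stay in
  \<open>P\<close>, and each is continuous because it is itself differentiable. It is used with
  \<open>bump_algebra\<close>, its translates and its convolutions with a fixed function.\<close>

lemma Cinf_on_coinduct:
  fixes f :: "real^'n \<Rightarrow> real"
  assumes P: "P f" and step: "\<And>f x. P f \<Longrightarrow> f differentiable (at x)" "\<And>f i. P f \<Longrightarrow> P (pd i f)"
  shows "Cinf_on UNIV f"
proof -
  have Pp: "P (pds is f)" for "is" by (induction "is") (auto simp: pds_def P step)
  have "continuous_on UNIV f" if "P f" for f
    using step(1)[OF that] by (auto intro!: continuous_at_imp_continuous_on differentiable_imp_continuous_within)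
  then show ?thesis using Pp step(1) by (auto simp: Cinf_on_def Ck_on_def)
qed

lemma Cinf_onD:
  fixes f :: "real^'n \<Rightarrow> real"
  assumes "Cinf_on UNIV f"
  shows "Cinf_on UNIV (pd i f)" "Ck_on 1 UNIV f"
  using assms Ck_on_pd unfolding Cinf_on_def by blast+

text \<open>The classical flat function exp(-1/t), divided by powers of t so that the family is
  closed under differentiation up to linear combinations.\<close>

definition eta :: "nat \<Rightarrow> real \<Rightarrow> real" where
  "eta k t = (if t > 0 then exp (- 1 / t) / t ^ k else 0)"

lemma DERIV_eta: "(eta k has_real_derivative eta (k + 2) t - real k * eta (k + 1) t) (at t)"
proof (cases t "0::real" rule: linorder_cases)
  case less
  have "((\<lambda>_. 0) has_real_derivative 0) (at t)" by simp
  then have "(eta k has_real_derivative 0) (at t)"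
    by (rule has_field_derivative_transform_within_open[where S="{..<0}"]) (use less in \<open>auto simp: eta_def\<close>)
  with less show ?thesis by (simp add: eta_def)
next
  case equal
  \<comment> \<open>From the right the difference quotient of \<open>eta k\<close> at 0 is
    \<open>eta (k + 1)\<close>, which tends to 0 because the exponential of 1/t outgrows every power
    of 1/t.\<close>
  have r: "(eta (k + 1) \<longlongrightarrow> 0) (at_right 0)"
  proof -
    have "((\<lambda>t. inverse t ^ (k + 1) / exp (inverse t)) \<longlongrightarrow> 0) (at_right (0::real))"
      by (rule filterlim_compose[OF tendsto_power_div_exp_0 filterlim_inverse_at_top_right])
    then show ?thesis
      by (rule Lim_transform_eventually)
        (auto simp: eta_def eventually_at_filter exp_minus field_simps)
  qed
  have "((\<lambda>h. eta k h / h) \<longlongrightarrow> 0) (at_right 0)"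
    by (rule Lim_transform_eventually[OF r]) (auto simp: eta_def eventually_at_filter)
  moreover have "((\<lambda>h. eta k h / h) \<longlongrightarrow> 0) (at_left 0)"
    by (rule Lim_transform_eventually[OF tendsto_const]) (auto simp: eta_def eventually_at_filter)
  ultimately have "((\<lambda>h. eta k h / h) \<longlongrightarrow> 0) (at 0)" by (rule filterlim_split_at[rotated])
  then have "(eta k has_real_derivative 0) (at 0)"
    by (simp add: DERIV_def eta_def)
  with equal show ?thesis by (simp add: eta_def)
next
  case greater
  have "((\<lambda>t. exp (- 1 / t) / t ^ k) has_real_derivative eta (k + 2) t - real k * eta (k + 1) t) (at t)"
  proof (cases k)
    case 0
    then show ?thesis using greater by (auto intro!: derivative_eq_intros simp: eta_def power2_eq_square)
  next
    case (Suc m)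
    \<comment> \<open>Truncated subtraction is harmless here: for \<open>m = 0\<close> both sides
      vanish because of the factor \<open>real m\<close>.\<close>
    have "real m * t ^ (m - Suc 0) * t = real m * t ^ m" by (cases m) auto
    with Suc show ?thesis using greater
      by (auto intro!: derivative_eq_intros simp: eta_def field_simps power2_eq_square)
  qed
  then show ?thesis
    by (rule has_field_derivative_transform_within_open[where S="{0<..}"]) (use greater in \<open>auto simp: eta_def\<close>)
qed

lemma eta_nonneg: "0 \<le> eta k t" and eta_pos: "0 < t \<Longrightarrow> 0 < eta k t" and eta_eq_0: "t \<le> 0 \<Longrightarrow> eta k t = 0"
  by (auto simp: eta_def)

text \<open>An algebra of functions closed under partial derivatives that contains the bump function
  \<open>eta 0 (d\<^sup>2 - \<bar>x\<bar>\<^sup>2)\<close>.\<close>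

inductive bump_algebra :: "real \<Rightarrow> (real^'n \<Rightarrow> real) \<Rightarrow> bool" for d where
  const: "bump_algebra d (\<lambda>x. c)"
| coord: "bump_algebra d (\<lambda>x. x $ i)"
| eta: "bump_algebra d (\<lambda>x. eta k (d\<^sup>2 - (norm x)\<^sup>2))"
| add: "bump_algebra d f \<Longrightarrow> bump_algebra d g \<Longrightarrow> bump_algebra d (\<lambda>x. f x + g x)"
| mult: "bump_algebra d f \<Longrightarrow> bump_algebra d g \<Longrightarrow> bump_algebra d (\<lambda>x. f x * g x)"

lemma pd_norm2: "pd i (\<lambda>x::real^'n. (norm x)\<^sup>2) x = 2 * x $ i" "Ck_on 1 UNIV (\<lambda>x::real^'n. (norm x)\<^sup>2)"
proof -
  have "((\<lambda>x::real^'n. x \<bullet> x) has_derivative (\<lambda>h. x \<bullet> h + h \<bullet> x)) (at x)" for x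
    by (intro has_derivative_inner has_derivative_ident)
  then have d: "((\<lambda>x::real^'n. (norm x)\<^sup>2) has_derivative (\<lambda>h. x \<bullet> h + h \<bullet> x)) (at x)" for x
    by (simp add: power2_norm_eq_inner)
  have p: "pd i (\<lambda>x::real^'n. (norm x)\<^sup>2) x = 2 * x $ i" for i x
    by (subst pd_eq[OF d]) (simp add: inner_axis inner_axis')
  then show "pd i (\<lambda>x::real^'n. (norm x)\<^sup>2) x = 2 * x $ i" .
  have "continuous_on UNIV (\<lambda>x::real^'n. 2 * x $ i)" for i by (intro continuous_intros)
  then show "Ck_on 1 UNIV (\<lambda>x::real^'n. (norm x)\<^sup>2)"
    unfolding Ck_on_1_iff using d by (auto simp: differentiable_def p[abs_def])
qed

lemma pd_norm_sq: "pd i (\<lambda>x::real^'n. d\<^sup>2 - (norm x)\<^sup>2) x = - 2 * x $ i"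
  "(\<lambda>x::real^'n. d\<^sup>2 - (norm x)\<^sup>2) differentiable (at x)"
proof -
  have d: "((\<lambda>t. d\<^sup>2 - t) has_real_derivative - 1) (at t)" for t :: real by (auto intro!: derivative_eq_intros)
  note n = Ck_on_1D(1)[OF pd_norm2(2) UNIV_I]
  show "pd i (\<lambda>x::real^'n. d\<^sup>2 - (norm x)\<^sup>2) x = - 2 * x $ i" unfolding pd_chain(1)[OF n d] by (simp add: pd_norm2)
  show "(\<lambda>x::real^'n. d\<^sup>2 - (norm x)\<^sup>2) differentiable (at x)" by (rule pd_chain(2)[OF n d])
qed

lemma bump_algebra_pd:
  fixes f :: "real^'n \<Rightarrow> real"
  assumes "bump_algebra d f"
  shows "f differentiable (at x)" "bump_algebra d (pd i f)"
proof -
  have "(\<forall>x. f differentiable (at x)) \<and> bump_algebra d (pd i f)" using assms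
  proof induction
    case (const c)
    then show ?case by (auto simp: pd_const intro: bump_algebra.intros)
  next
    case (coord j)
    have "(\<lambda>x::real^'n. x $ j) differentiable (at x)" for x
      by (rule bounded_linear_imp_differentiable[OF bounded_linear_vec_nth])
    then show ?case by (auto simp: pd_coord intro: bump_algebra.intros)
  next
    case (eta k)
    have "pd i (\<lambda>x::real^'n. eta k (d\<^sup>2 - (norm x)\<^sup>2)) =
       (\<lambda>x. (eta (k + 2) (d\<^sup>2 - (norm x)\<^sup>2) + - real k * eta (k + 1) (d\<^sup>2 - (norm x)\<^sup>2)) * (- 2 * x $ i))"
      unfolding pd_chain(1)[OF pd_norm_sq(2) DERIV_eta] pd_norm_sq(1) by simp
    moreover have "bump_algebra d \<dots>" by (intro bump_algebra.intros)
    moreover have "(\<lambda>x::real^'n. eta k (d\<^sup>2 - (norm x)\<^sup>2)) differentiable (at x)" for x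
      by (rule pd_chain(2)[OF pd_norm_sq(2) DERIV_eta])
    ultimately show ?case by simp
  next
    case (add f g)
    then have "pd i (\<lambda>x. f x + g x) = (\<lambda>x. pd i f x + pd i g x)" by (intro ext pd_add) auto
    then show ?case using add by (auto intro: bump_algebra.intros)
  next
    case (mult f g)
    then have "pd i (\<lambda>x. f x * g x) = (\<lambda>x. pd i f x * g x + f x * pd i g x)" by (intro ext pd_mult) auto
    then show ?case using mult by (auto intro: bump_algebra.intros)
  qed
  then show "f differentiable (at x)" "bump_algebra d (pd i f)" by auto
qed

lemma bump_algebra_Cinf: "bump_algebra d f \<Longrightarrow> Cinf_on UNIV f"
  by (rule Cinf_on_coinduct[where P="bump_algebra d"]) (auto intro: bump_algebra_pd)

lemma continuous_integral_pos:
  fixes f :: "'a::euclidean_space \<Rightarrow> real"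
  assumes c: "continuous_on UNIV f" and i: "integrable lborel f" and n: "\<And>x. 0 \<le> f x" and p: "0 < f x0"
  shows "0 < (LINT x|lborel. f x)"
proof -
  have "\<forall>e>0. \<exists>d>0. \<forall>x. dist x x0 < d \<longrightarrow> dist (f x) (f x0) < e"
    using c unfolding continuous_on_iff by auto
  then obtain d where d: "d > 0" "\<And>x. dist x x0 < d \<Longrightarrow> dist (f x) (f x0) < f x0 / 2"
    using p by (meson half_gt_zero)
  have "0 < f x0 / 2 * measure lborel (ball x0 d)"
    using p d content_ball_pos[of d x0] by (simp add: measure_completion)
  also have "\<dots> = (LINT x|lborel. f x0 / 2 * indicator (ball x0 d) x)" by simp
  also have "\<dots> \<le> (LINT x|lborel. f x)"
  proof (rule integral_mono[OF _ i])
    show "integrable lborel (\<lambda>x. f x0 / 2 * indicat_real (ball x0 d) x)"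
      by (intro integrable_mult_right integrable_real_indicator emeasure_bounded_finite) auto
    fix x show "f x0 / 2 * indicat_real (ball x0 d) x \<le> f x"
      using n[of x] d(2)[of x] by (auto simp: indicator_def dist_commute dist_real_def abs_real_def split: if_splits)
  qed
  finally show ?thesis .
qed

section \<open>Convolution and approximation by test functions\<close>

definition conv :: "('a::euclidean_space \<Rightarrow> real) \<Rightarrow> ('a \<Rightarrow> real) \<Rightarrow> 'a \<Rightarrow> real" where
  "conv f w x = (LINT y|lborel. f (x - y) * w y)"

lemma conv_integrable:
  fixes f w :: "'a::euclidean_space \<Rightarrow> real"
  assumes f: "continuous_on UNIV f" and w: "continuous_on UNIV w" "bounded {x. w x \<noteq> 0}"
  shows "integrable lborel (\<lambda>y. f (x - y) * w y)"
proof (rule continuous_bounded_support(1))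
  show "continuous_on UNIV (\<lambda>y. f (x - y) * w y)"
    by (intro continuous_intros continuous_on_compose2[OF f] w) auto
  show "bounded {y. f (x - y) * w y \<noteq> 0}" by (rule bounded_subset[OF w(2)]) auto
qed

lemma conv_commute:
  fixes f w :: "'a::euclidean_space \<Rightarrow> real"
  assumes "continuous_on UNIV f" "continuous_on UNIV w"
  shows "conv f w x = conv w f x"
proof -
  have [measurable]: "f \<in> borel_measurable borel" "w \<in> borel_measurable borel"
    using assms by (auto intro: borel_measurable_continuous_onI)
  have "(LINT y|lborel. (\<lambda>y. f (x - y) * w y) (x - y)) = (LINT y|lborel. f (x - y) * w y)"
    by (rule lborel_integral_reflect) measurable
  then show ?thesis by (simp add: conv_def mult.commute)
qed

text \<open>Differentiation under the integral sign. Since \<open>w\<close> vanishes outside a box,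
  the integral runs over a compact set, where the Leibniz rule asks only for joint continuity of the
  derivative, viewed as a bounded linear map. All derivatives fall on \<open>f\<close>, so
  \<open>w\<close> may be merely continuous.\<close>

lemma conv_pd:
  fixes f w :: "real^'n \<Rightarrow> real"
  assumes f: "Ck_on 1 UNIV f" and w: "continuous_on UNIV w" "bounded {x. w x \<noteq> 0}"
  shows "conv f w differentiable (at x)" "pd i (conv f w) x = conv (pd i f) w x"
proof -
  obtain a where a: "{x. w x \<noteq> 0} \<subseteq> cbox (-a) a" using bounded_subset_cbox_symmetric[OF w(2)] by blast
  note cf = Ck_on_1D[OF f]
  have HK: "conv h w x = integral (cbox (-a) a) (\<lambda>y. h (x - y) * w y)"
    if h: "continuous_on UNIV h" for h x
  proof -
    have "((\<lambda>y. h (x - y) * w y) has_integral conv h w x) UNIV"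
      unfolding conv_def by (rule has_integral_integral_lborel[OF conv_integrable[OF h w]])
    moreover have e: "(\<lambda>y. h (x - y) * w y) = (\<lambda>y. if y \<in> cbox (-a) a then h (x - y) * w y else 0)"
      by (rule ext) (use a in auto)
    ultimately have "((\<lambda>y. if y \<in> cbox (-a) a then h (x - y) * w y else 0) has_integral conv h w x) UNIV"
      by (simp only:)
    then show ?thesis unfolding has_integral_restrict_UNIV by (rule integral_unique[symmetric])
  qed
  let ?D = "\<lambda>x t. w t *\<^sub>R blinfun_inner_right (grad f (x - t))"
  have cD: "continuous_on (UNIV \<times> cbox (-a) a) (\<lambda>(x, t). ?D x t)"
    unfolding split_beta
    by (intro continuous_intros continuous_on_compose2[OF w(1)] continuous_on_compose2[OF cf(4)]
         bounded_linear.continuous_on[OF bounded_linear_blinfun_inner_right]) auto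
  have "((\<lambda>x. integral (cbox (-a) a) (\<lambda>t. f (x - t) * w t)) has_derivative integral (cbox (-a) a) (?D x)) (at x within UNIV)"
  proof (rule leibniz_rule[OF _ _ cD])
    fix x t :: "real^'n"
    have "((\<lambda>x. x - t) has_derivative (\<lambda>h. h)) (at x)" by (auto intro!: derivative_eq_intros)
    from has_derivative_compose[OF this has_derivative_grad[OF cf(1)[OF UNIV_I]]]
    have "((\<lambda>x. f (x - t) * w t) has_derivative (\<lambda>h. (grad f (x - t) \<bullet> h) * w t)) (at x)"
      by (rule has_derivative_mult_left)
    then show "((\<lambda>x. f (x - t) * w t) has_derivative blinfun_apply (?D x t)) (at x within UNIV)"
      by (simp add: scaleR_blinfun.rep_eq mult.commute)
  next
    fix x show "(\<lambda>t. f (x - t) * w t) integrable_on cbox (-a) a"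
      by (intro integrable_continuous continuous_intros continuous_on_compose2[OF cf(3)] continuous_on_compose2[OF w(1)]) auto
  qed auto
  moreover have "conv f w = (\<lambda>x. integral (cbox (-a) a) (\<lambda>t. f (x - t) * w t))"
    using HK[OF cf(3)] by auto
  ultimately have d: "(conv f w has_derivative integral (cbox (-a) a) (?D x)) (at x)"
    by simp
  then show "conv f w differentiable (at x)" by (auto simp: differentiable_def)
  have "pd i (conv f w) x = integral (cbox (-a) a) (?D x) (axis i 1)" by (rule pd_eq[OF d])
  also have "\<dots> = integral (cbox (-a) a) ((\<lambda>L. blinfun_apply L (axis i 1)) \<circ> ?D x)"
  proof (rule integral_linear[symmetric])
    have "continuous_on (cbox (-a) a) (\<lambda>t. (\<lambda>(x, t). ?D x t) (x, t))"
      by (rule continuous_on_compose2[OF cD]) (auto intro!: continuous_intros)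
    then show "?D x integrable_on cbox (-a) a" by (intro integrable_continuous) simp
    show "bounded_linear (\<lambda>L. blinfun_apply L (axis i 1 :: real^'n))" by (rule bounded_linear_apply_blinfun)
  qed
  also have "\<dots> = integral (cbox (-a) a) (\<lambda>t. pd i f (x - t) * w t)"
    by (simp add: o_def scaleR_blinfun.rep_eq grad_def inner_axis mult.commute)
  finally show "pd i (conv f w) x = conv (pd i f) w x" using HK[OF cf(2)] by simp
qed

lemma conv_approx:
  fixes f q :: "'a::euclidean_space \<Rightarrow> real"
  assumes f: "continuous_on UNIV f" and q: "continuous_on UNIV q" "\<And>y. 0 \<le> q y" "(LINT y|lborel. q y) = 1"
    and s: "\<And>y. q y \<noteq> 0 \<Longrightarrow> norm y < d" and e: "\<And>y. norm y < d \<Longrightarrow> \<bar>f (x - y) - f x\<bar> \<le> e"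
  shows "\<bar>conv f q x - f x\<bar> \<le> e"
proof -
  have b: "bounded {x. q x \<noteq> 0}" by (rule bounded_subset[OF bounded_ball[of 0 d]]) (auto simp: s)
  note fq = conv_integrable[OF f q(1) b] and qi = continuous_bounded_support(1)[OF q(1) b]
  have "conv f q x - f x = (LINT y|lborel. f (x - y) * q y) - (LINT y|lborel. f x * q y)"
    using q(3) by (simp add: conv_def)
  also have "\<dots> = (LINT y|lborel. f (x - y) * q y - f x * q y)"
    using fq qi by (subst Bochner_Integration.integral_diff) auto
  also have "\<bar>\<dots>\<bar> \<le> (LINT y|lborel. e * q y)"
  proof (rule order_trans[OF integral_abs_bound], rule integral_mono)
    show "integrable lborel (\<lambda>y. \<bar>f (x - y) * q y - f x * q y\<bar>)" using fq qi by auto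
    show "integrable lborel (\<lambda>y. e * q y)" using qi by auto
    fix y
    have "\<bar>f (x - y) * q y - f x * q y\<bar> = \<bar>f (x - y) - f x\<bar> * q y"
      using q(2)[of y] by (simp add: left_diff_distrib[symmetric] abs_mult)
    also have "\<dots> \<le> e * q y" using e[of y] s[of y] q(2)[of y] by (cases "q y = 0") (auto intro: mult_right_mono)
    finally show "\<bar>f (x - y) * q y - f x * q y\<bar> \<le> e * q y" .
  qed
  also have "\<dots> = e" using q(3) by simp
  finally show ?thesis .
qed

lemma exists_mollifier:
  assumes "d > 0"
  obtains q :: "real^'n \<Rightarrow> real" where "bump_algebra d q" "\<And>y. 0 \<le> q y" "q 0 > 0" "(LINT y|lborel. q y) = 1"
    "\<And>y. q y \<noteq> 0 \<Longrightarrow> norm y < d"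
proof -
  define r where "r x = eta 0 (d\<^sup>2 - (norm x)\<^sup>2)" for x :: "real^'n"
  have ba: "bump_algebra d r" unfolding r_def by (rule bump_algebra.eta)
  have c: "continuous_on UNIV r" using Ck_on_1D(3)[OF Cinf_onD(2)[OF bump_algebra_Cinf[OF ba]]] .
  have s: "norm y < d" if "r y \<noteq> 0" for y
  proof -
    have "d\<^sup>2 - (norm y)\<^sup>2 > 0" using that eta_eq_0[of "d\<^sup>2 - (norm y)\<^sup>2" 0] unfolding r_def by linarith
    then show ?thesis using assms by (intro power2_less_imp_less[of "norm y" d]) auto
  qed
  have b: "bounded {x. r x \<noteq> 0}" by (rule bounded_subset[OF bounded_ball[of 0 d]]) (auto simp: s)
  have n: "0 \<le> r y" for y by (simp add: r_def eta_nonneg)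
  have r0: "0 < r 0" using assms by (simp add: r_def eta_pos)
  have p: "0 < (LINT y|lborel. r y)"
    by (rule continuous_integral_pos[OF c continuous_bounded_support(1)[OF c b] n r0])
  show ?thesis
  proof (rule that[of "\<lambda>y. 1 / (LINT y|lborel. r y) * r y"])
    show "bump_algebra d (\<lambda>y. 1 / integral\<^sup>L lborel r * r y)" by (intro bump_algebra.intros ba)
    show "(LINT y|lborel. 1 / integral\<^sup>L lborel r * r y) = 1" using p by simp
  qed (use n p r0 s in auto)
qed

text \<open>Convolution commutes, and both readings are used. In \<open>conv q w\<close> the
  derivatives fall on the bump \<open>q\<close>, which yields smoothness. In \<open>conv w q\<close>
  they fall on \<open>w\<close>, so the gradient is an average of nearby values of
  \<open>grad w\<close>, and uniform continuity gives the error bound.\<close>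

lemma mollification:
  fixes w :: "real^'n \<Rightarrow> real"
  assumes w: "Ck_on 1 UNIV w" and K: "compact (closure {x. w x \<noteq> 0})" "closure {x. w x \<noteq> 0} \<subseteq> \<Omega>" "open \<Omega>"
    and e: "e > 0"
  obtains \<phi> where "\<phi> \<in> test_functions \<Omega>" "\<And>x. \<bar>\<phi> x - w x\<bar> \<le> e" "\<And>x. norm (grad \<phi> x - grad w x) \<le> e"
proof -
  let ?N = "real CARD('n)"
  have N: "?N \<ge> 1" using finite_UNIV_card_ge_0[where 'a='n] by (simp add: Suc_leI)
  note cw = Ck_on_1D[OF w]
  have b: "bounded {x. w x \<noteq> 0}" using K(1) bounded_subset closure_subset compact_imp_bounded by metis
  obtain d0 where d0: "d0 > 0" "(\<Union>x\<in>closure {x. w x \<noteq> 0}. ball x d0) \<subseteq> \<Omega>"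
    using compact_subset_open_imp_ball_epsilon_subset[OF K(1) K(3) K(2)] by metis
  \<comment> \<open>Each partial derivative gets the accuracy \<open>e / ?N\<close>, because the
    norm of the gradient error is estimated by the sum of its N components.\<close>
  have "e / ?N > 0" using e N by simp
  obtain d1 where d1: "d1 > 0" "\<And>x x'. dist x' x < d1 \<Longrightarrow> dist (w x') (w x) < e"
    using uniformly_continuous_onE[OF continuous_bounded_support(3)[OF cw(3) b] e] by (metis UNIV_I)
  obtain d2 where d2: "d2 > 0" "\<And>x x'. dist x' x < d2 \<Longrightarrow> dist (grad w x') (grad w x) < e / ?N"
    using uniformly_continuous_onE[OF continuous_bounded_support(3)[OF cw(4) bounded_grad_support[OF b]] \<open>e / ?N > 0\<close>]
    by (metis UNIV_I)
  \<comment> \<open>Mollifying enlarges the support by a closed ball of radius \<open>d\<close>,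
    which has to fit in the open \<open>d0\<close>-neighbourhood contained in \<Omega>; hence
    \<open>d0 / 2\<close>. The other two numbers are moduli of uniform continuity of
    \<open>w\<close> and \<open>grad w\<close>.\<close>
  define d where "d = Min {d0 / 2, d1, d2}"
  have d: "d > 0" "d < d0" "d \<le> d1" "d \<le> d2" using d0 d1 d2 by (auto simp: d_def)
  obtain q :: "real^'n \<Rightarrow> real" where q: "bump_algebra d q" "\<And>y. 0 \<le> q y" "(LINT y|lborel. q y) = 1"
    "\<And>y. q y \<noteq> 0 \<Longrightarrow> norm y < d" using exists_mollifier[OF d(1)] by metis
  have q1: "Ck_on 1 UNIV f" if "bump_algebra d f" for f :: "real^'n \<Rightarrow> real"
    by (rule Cinf_onD(2)[OF bump_algebra_Cinf[OF that]])
  have bq: "bounded {x. q x \<noteq> 0}" by (rule bounded_subset[OF bounded_ball[of 0 d]]) (auto simp: q)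
  note cq = Ck_on_1D(3)[OF q1[OF q(1)]]
  define \<phi> where "\<phi> = conv w q"
  have \<phi>': "\<phi> = conv q w" using conv_commute[OF cw(3) cq] by (auto simp: \<phi>_def)
  have pd\<phi>: "pd i \<phi> x = conv (pd i w) q x" for i x
    using conv_pd(2)[OF w cq bq] by (simp add: \<phi>_def)
  have sm: "Cinf_on UNIV \<phi>"
  proof (rule Cinf_on_coinduct[where P="\<lambda>f. \<exists>g. bump_algebra d g \<and> f = conv g w"])
    show "\<exists>g. bump_algebra d g \<and> \<phi> = conv g w" using q(1) \<phi>' by blast
    show "f differentiable (at x)" if "\<exists>g. bump_algebra d g \<and> f = conv g w" for f x
      using that conv_pd(1)[OF q1 cw(3) b] by blast
    show "\<exists>g. bump_algebra d g \<and> pd i f = conv g w" if "\<exists>g. bump_algebra d g \<and> f = conv g w" for f i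
      using that conv_pd(2)[OF q1 cw(3) b] bump_algebra_pd(2) by blast
  qed
  let ?S = "{x + y | x y. x \<in> closure {x. w x \<noteq> 0} \<and> y \<in> cball 0 d}"
  have S: "compact ?S" by (intro compact_sums K(1) compact_cball)
  have "x \<in> ?S" if "\<phi> x \<noteq> 0" for x
  proof -
    have "\<exists>y. w (x - y) * q y \<noteq> 0"
    proof (rule ccontr)
      assume "\<nexists>y. w (x - y) * q y \<noteq> 0"
      then have "(\<lambda>y. w (x - y) * q y) = (\<lambda>y. 0)" by blast
      then have "\<phi> x = 0" by (simp only: \<phi>_def conv_def integral_zero)
      then show False using that by simp
    qed
    then obtain y where y: "w (x - y) \<noteq> 0" "q y \<noteq> 0" by auto
    then have "x - y \<in> closure {x. w x \<noteq> 0}" "y \<in> cball 0 d"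
      using closure_subset[of "{x. w x \<noteq> 0}"] q(4)[of y] by auto
    moreover have "x = (x - y) + y" by simp
    ultimately show ?thesis by blast
  qed
  then have cS: "closure {x. \<phi> x \<noteq> 0} \<subseteq> ?S"
    by (intro closure_minimal compact_imp_closed[OF S]) blast
  have "?S \<subseteq> \<Omega>"
  proof
    fix z assume "z \<in> ?S"
    then obtain x y where xy: "z = x + y" "x \<in> closure {x. w x \<noteq> 0}" "norm y \<le> d" by auto
    then have "z \<in> ball x d0" using d by (simp add: dist_norm)
    with xy d0 show "z \<in> \<Omega>" by blast
  qed
  with cS have "closure {x. \<phi> x \<noteq> 0} \<subseteq> \<Omega>" by blast
  moreover have "compact (closure {x. \<phi> x \<noteq> 0})"
    using compact_Int_closed[OF S closed_closure[of "{x. \<phi> x \<noteq> 0}"]] cS by (simp add: inf_absorb2)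
  ultimately have t: "\<phi> \<in> test_functions \<Omega>" using sm by (simp add: test_functions_def)
  have 1: "\<bar>\<phi> x - w x\<bar> \<le> e" for x unfolding \<phi>_def
  proof (rule conv_approx[OF cw(3) cq q(2,3,4)])
    show "\<bar>w (x - y) - w x\<bar> \<le> e" if "norm y < d" for y
      using d1(2)[of "x - y" x] that d by (simp add: dist_norm)
  qed
  have 2: "\<bar>pd i \<phi> x - pd i w x\<bar> \<le> e / ?N" for i x unfolding pd\<phi>
  proof (rule conv_approx[OF cw(2) cq q(2,3,4)])
    show "\<bar>pd i w (x - y) - pd i w x\<bar> \<le> e / ?N" if "norm y < d" for y
      using d2(2)[of "x - y" x] that d component_le_norm_cart[of "grad w (x - y) - grad w x" i]
      by (simp add: dist_norm grad_def)
  qed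
  have "norm (grad \<phi> x - grad w x) \<le> e" for x
  proof -
    have "norm (grad \<phi> x - grad w x) \<le> (\<Sum>i\<in>UNIV. \<bar>(grad \<phi> x - grad w x) $ i\<bar>)" by (rule norm_le_l1_cart)
    also have "\<dots> \<le> (\<Sum>i\<in>(UNIV::'n set). e / ?N)" using 2 by (intro sum_mono) (simp add: grad_def)
    also have "\<dots> = e" using N by simp
    finally show ?thesis .
  qed
  with t 1 show ?thesis by (rule that)
qed

section \<open>The subcritical Sobolev inequality\<close>

text \<open>Weighted Young inequality for the normalized functions f / \<integral>f and g /
  \<integral>g. If one of the integrals is zero, that function vanishes almost everywhere, and so
  does the product. Writing the exponents as \<theta> and 1 - \<theta> lets the inequality be
  chained without conjugate exponents.\<close>

lemma Holder_integral:
  fixes f g :: "'a \<Rightarrow> real"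
  assumes \<theta>: "0 < \<theta>" "\<theta> < 1" and f: "integrable M f" "\<And>x. 0 \<le> f x" and g: "integrable M g" "\<And>x. 0 \<le> g x"
  shows "integrable M (\<lambda>x. f x powr \<theta> * g x powr (1 - \<theta>))"
    and "(LINT x|M. f x powr \<theta> * g x powr (1 - \<theta>)) \<le> (LINT x|M. f x) powr \<theta> * (LINT x|M. g x) powr (1 - \<theta>)"
proof -
  have [measurable]: "f \<in> borel_measurable M" "g \<in> borel_measurable M" using f g by auto
  have Y: "a powr \<theta> * b powr (1 - \<theta>) \<le> \<theta> * a + (1 - \<theta>) * b" if "0 \<le> a" "0 \<le> b" for a b
    using that \<theta> Youngs_inequality_0[of \<theta> "1 - \<theta>" a b] by (cases "a = 0 \<or> b = 0") auto
  show i: "integrable M (\<lambda>x. f x powr \<theta> * g x powr (1 - \<theta>))"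
    by (rule Bochner_Integration.integrable_bound[where f="\<lambda>x. \<theta> * f x + (1 - \<theta>) * g x"])
      (use f g Y \<theta> in \<open>auto intro!: AE_I2 simp: abs_mult\<close>)
  let ?F = "LINT x|M. f x" and ?G = "LINT x|M. g x"
  have nn: "0 \<le> ?F" "0 \<le> ?G" using f g by (auto intro: integral_nonneg_AE)
  show "(LINT x|M. f x powr \<theta> * g x powr (1 - \<theta>)) \<le> ?F powr \<theta> * ?G powr (1 - \<theta>)"
  proof (cases "?F = 0 \<or> ?G = 0")
    case True
    then have "(AE x in M. f x = 0) \<or> (AE x in M. g x = 0)"
      using integral_nonneg_eq_0_iff_AE[OF f(1)] integral_nonneg_eq_0_iff_AE[OF g(1)] f(2) g(2) by auto
    then have "AE x in M. f x powr \<theta> * g x powr (1 - \<theta>) = 0" by auto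
    then have "(LINT x|M. f x powr \<theta> * g x powr (1 - \<theta>)) = 0" by (subst integral_cong_AE[where g="\<lambda>x. 0"]) auto
    then show ?thesis by simp
  next
    case False
    then have p: "?F > 0" "?G > 0" using nn by auto
    have "f x powr \<theta> * g x powr (1 - \<theta>) \<le> (\<theta> * (f x / ?F) + (1 - \<theta>) * (g x / ?G)) * (?F powr \<theta> * ?G powr (1 - \<theta>))" for x
    proof -
      have "f x powr \<theta> * g x powr (1 - \<theta>) = ((f x / ?F) powr \<theta> * (g x / ?G) powr (1 - \<theta>)) * (?F powr \<theta> * ?G powr (1 - \<theta>))"
        using p f(2)[of x] g(2)[of x] by (simp add: powr_divide)
      also have "\<dots> \<le> (\<theta> * (f x / ?F) + (1 - \<theta>) * (g x / ?G)) * (?F powr \<theta> * ?G powr (1 - \<theta>))"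
        using p f(2)[of x] g(2)[of x] by (intro mult_right_mono Y) auto
      finally show ?thesis .
    qed
    then have "(LINT x|M. f x powr \<theta> * g x powr (1 - \<theta>)) \<le>
        (LINT x|M. (\<theta> * (f x / ?F) + (1 - \<theta>) * (g x / ?G)) * (?F powr \<theta> * ?G powr (1 - \<theta>)))"
      using f(1) g(1) by (intro integral_mono i) auto
    also have "\<dots> = ?F powr \<theta> * ?G powr (1 - \<theta>)" using p f(1) g(1) by simp
    finally show ?thesis .
  qed
qed

text \<open>Dyadic decomposition. For R / 2^(k+1) < norm y \<le> R / 2^k the kernel is at most
  \<open>c k\<close>, its value at the inner radius. Weighting \<open>c k\<close> with the volume of
  the ball of radius R / 2^k gives a geometric series of ratio 2^(m - n), n the dimension, which is
  below 1 exactly when m < n.\<close>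

lemma norm_powr_kernel_integrable:
  fixes m R :: real
  assumes m: "0 \<le> m" "m < DIM('a::euclidean_space)" and R: "R > 0"
  shows "integrable lborel (\<lambda>y::'a. indicator (cball 0 R) y * norm y powr (- m))"
proof (rule integrableI_bounded)
  let ?n = "DIM('a)" and ?v = "unit_ball_vol DIM('a)"
  have v: "0 \<le> ?v" by simp
  define c where "c k = (R / 2 ^ (k + 1)) powr (- m)" for k :: nat
  have pw: "indicator (cball 0 R) y * norm y powr (- m) \<le> (\<Sum>k. ennreal (c k) * indicator (cball 0 (R / 2 ^ k)) y)" for y :: 'a
  \<comment> \<open>The origin lies in no shell, but there \<open>0 powr (- m)\<close> is 0.\<close>
  proof (cases "y = 0 \<or> norm y > R")
    case True then show ?thesis by (auto simp: indicator_def)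
  next
    case False
    then have y: "0 < norm y" "norm y \<le> R" by auto
    obtain k where k: "R / 2 ^ (k + 1) < norm y" "norm y \<le> R / 2 ^ k"
    proof -
      have "\<exists>k. R / 2 ^ (k + 1) < norm y"
      proof -
        obtain k where "(1 / 2) ^ k < norm y / R" using real_arch_pow_inv[of "norm y / R" "1/2"] y R by auto
        then have "R / 2 ^ k < norm y" using R by (simp add: field_simps power_one_over)
        moreover have "R / 2 ^ (k + 1) \<le> R / 2 ^ k" using R by (intro divide_left_mono) auto
        ultimately show ?thesis by (metis order_le_less_trans)
      qed
      then obtain k where k: "R / 2 ^ (k + 1) < norm y" "\<And>j. j < k \<Longrightarrow> \<not> R / 2 ^ (j + 1) < norm y"
        using exists_least_iff[of "\<lambda>k. R / 2 ^ (k + 1) < norm y"] by blast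
      have "norm y \<le> R / 2 ^ k" using k(2)[of "k - 1"] y by (cases k) auto
      with k(1) show ?thesis by (rule that)
    qed
    have "norm y powr (- m) \<le> c k" unfolding c_def using k R m by (intro powr_mono2') auto
    then have "indicator (cball 0 R) y * norm y powr (- m) \<le> ennreal (c k) * indicator (cball 0 (R / 2 ^ k)) y"
      using k y by (auto simp: indicator_def ennreal_leI)
    also have "\<dots> \<le> (\<Sum>k. ennreal (c k) * indicator (cball 0 (R / 2 ^ k)) y)"
      using sum_le_suminf[of "\<lambda>k. ennreal (c k) * indicator (cball 0 (R / 2 ^ k)) y" "{k}"]
      by (simp del: sum_mult_indicator)
    finally show ?thesis .
  qed
  have "(\<integral>\<^sup>+y. ennreal (norm (indicator (cball (0::'a) R) y * norm y powr (- m))) \<partial>lborel) \<le>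
      (\<integral>\<^sup>+y. (\<Sum>k. ennreal (c k) * indicator (cball (0::'a) (R / 2 ^ k)) y) \<partial>lborel)"
    by (rule nn_integral_mono) (use pw in \<open>simp add: abs_mult\<close>)
  also have "\<dots> = (\<Sum>k. \<integral>\<^sup>+y. ennreal (c k) * indicator (cball (0::'a) (R / 2 ^ k)) y \<partial>lborel)"
    by (rule nn_integral_suminf) (auto intro!: borel_measurable_times_ennreal borel_measurable_indicator)
  also have "\<dots> = (\<Sum>k. ennreal (c k * (?v * (R / 2 ^ k) ^ ?n)))"
  proof (rule suminf_cong)
    fix k
    have "(\<integral>\<^sup>+y. ennreal (c k) * indicator (cball (0::'a) (R / 2 ^ k)) y \<partial>lborel) = ennreal (c k) * emeasure lborel (cball (0::'a) (R / 2 ^ k))"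
      by (rule nn_integral_cmult_indicator) simp
    also have "\<dots> = ennreal (c k * (?v * (R / 2 ^ k) ^ ?n))"
      using R by (simp add: emeasure_cball ennreal_mult'[symmetric] c_def)
    finally show "(\<integral>\<^sup>+y. ennreal (c k) * indicator (cball (0::'a) (R / 2 ^ k)) y \<partial>lborel) = ennreal (c k * (?v * (R / 2 ^ k) ^ ?n))" .
  qed
  also have "\<dots> = (\<Sum>k. ennreal ((R / 2) powr (- m) * ?v * R ^ ?n * (2 powr (m - ?n)) ^ k))"
  proof (intro suminf_cong arg_cong[where f=ennreal])
    fix k
    have "c k = (R / 2) powr (- m) * (2 powr m) ^ k"
    proof -
      have "c k = (R / 2 / 2 ^ k) powr (- m)" by (simp add: c_def)
      also have "\<dots> = (R / 2) powr (- m) / (2 ^ k) powr (- m)" using R by (subst powr_divide) auto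
      also have "(2 ^ k) powr (- m) = inverse ((2 powr m) ^ k)"
        by (simp add: powr_minus powr_realpow[symmetric] powr_powr mult.commute)
      finally show ?thesis by (simp add: field_simps)
    qed
    moreover have "(2 powr (m - ?n)) ^ k = (2 powr m) ^ k / (2 ^ k) ^ ?n"
      by (simp add: powr_diff powr_realpow power_divide power_mult[symmetric] mult.commute)
    ultimately show "c k * (?v * (R / 2 ^ k) ^ ?n) = (R / 2) powr (- m) * ?v * R ^ ?n * (2 powr (m - ?n)) ^ k"
      by (simp add: power_divide)
  qed
  also have "\<dots> < \<infinity>"
  proof -
    have "2 powr (m - ?n) < 2 powr (0::real)" using m by (intro powr_less_mono) auto
    then have "summable (\<lambda>k. (R / 2) powr (- m) * ?v * R ^ ?n * (2 powr (m - ?n)) ^ k)"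
      by (intro summable_mult summable_geometric) auto
    then have "(\<Sum>k. ennreal ((R / 2) powr (- m) * ?v * R ^ ?n * (2 powr (m - ?n)) ^ k)) \<noteq> top"
      using R v by (intro ennreal_suminf_neq_top) auto
    then show ?thesis by (simp add: less_top)
  qed
  finally show "(\<integral>\<^sup>+y. ennreal (norm (indicator (cball (0::'a) R) y * norm y powr (- m))) \<partial>lborel) < \<infinity>" .
next
  have [measurable]: "cball (0::'a) R \<in> sets borel" by simp
  show "(\<lambda>y::'a. indicator (cball 0 R) y * norm y powr (- m)) \<in> borel_measurable lborel" by simp measurable
qed

section \<open>C^1 calculus and a C^1 regularization of negative powers\<close>

lemma Ck_on_1_mult:
  fixes f g :: "real^'n \<Rightarrow> real"
  assumes "Ck_on 1 U f" "Ck_on 1 U g"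
  shows "Ck_on 1 U (\<lambda>x. f x * g x)"
  unfolding Ck_on_1_iff
proof (intro conjI ballI allI)
  note f = Ck_on_1D[OF assms(1)] and g = Ck_on_1D[OF assms(2)]
  show "(\<lambda>x. f x * g x) differentiable at x" if "x \<in> U" for x using f g that by auto
  have "continuous_on U (\<lambda>x. pd i f x * g x + f x * pd i g x)" for i
    by (intro continuous_intros f g)
  then show "continuous_on U (pd i (\<lambda>x. f x * g x))" for i
    using f(1) g(1) by (subst continuous_on_cong[OF refl]) (auto simp: pd_mult)
qed

lemma Ck_on_1_shift:
  fixes f :: "real^'n \<Rightarrow> real"
  assumes "Ck_on 1 UNIV f"
  shows "Ck_on 1 UNIV (\<lambda>x. f (x + c))"
proof -
  note f = Ck_on_1D[OF assms]
  have "pd i (\<lambda>x. f (x + c)) = (\<lambda>x. pd i f (x + c))" for i using pd_shift(1)[OF f(1)] by auto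
  moreover have "continuous_on UNIV (\<lambda>x. pd i f (x + c))" for i
    by (intro continuous_on_compose2[OF f(2)] continuous_intros) auto
  ultimately show ?thesis unfolding Ck_on_1_iff using pd_shift(2)[OF f(1)] by auto
qed

lemma Ck_on_1_chain:
  fixes f :: "real^'n \<Rightarrow> real"
  assumes f: "Ck_on 1 U f" and h: "\<And>t. (h has_real_derivative h' t) (at t)" "continuous_on UNIV h'"
  shows "Ck_on 1 U (\<lambda>x. h (f x))"
  unfolding Ck_on_1_iff
proof (intro conjI ballI allI)
  note f' = Ck_on_1D[OF f]
  show "(\<lambda>x. h (f x)) differentiable at x" if "x \<in> U" for x by (rule pd_chain(2)[OF f'(1)[OF that] h(1)])
  have "continuous_on U (\<lambda>x. h' (f x) * pd i f x)" for i
    by (intro continuous_intros f' continuous_on_compose2[OF h(2)]) auto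
  then show "continuous_on U (pd i (\<lambda>x. h (f x)))" for i
    by (subst continuous_on_cong[OF refl]) (auto simp: pd_chain(1)[OF f'(1) h(1)])
qed

text \<open>Applied to t = \<bar>y\<bar>^2 rather than to \<bar>y\<bar>, since the square of the
  norm is smooth at the origin; this is why the exponent N appears halved later.\<close>

definition tpow :: "real \<Rightarrow> real \<Rightarrow> real \<Rightarrow> real" where
  "tpow q E t = (if t \<ge> E then t powr (- q) else E powr (- q) * (1 - q * (t / E - 1)))"

text \<open>The tangent line freezes the slope below \<open>E\<close>, so \<open>max t E\<close>
  merges the two branches into one formula that is visibly continuous in \<open>t\<close>.\<close>

lemma DERIV_tpow:
  assumes "E > 0"
  shows "(tpow q E has_real_derivative - q * (max t E) powr (- q - 1)) (at t)"
proof -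
  have d1: "((\<lambda>t. t powr (- q)) has_real_derivative - q * t powr (- q - 1)) (at t)" if "t > 0" for t
    using that by (auto intro!: derivative_eq_intros)
  have E: "E powr (- q) / E = E powr (- q - 1)" using assms by (simp add: powr_diff)
  have d2: "((\<lambda>t. E powr (- q) * (1 - q * (t / E - 1))) has_real_derivative - q * E powr (- q - 1)) (at t)" for t
    using assms by (auto intro!: derivative_eq_intros simp: E[symmetric])
  show ?thesis
  proof (cases t E rule: linorder_cases)
    case less
    show ?thesis
      using has_field_derivative_transform_within_open[OF d2 open_lessThan[of E], of t "tpow q E"] less
      by (auto simp: tpow_def max_def)
  next
    case greater
    then have "t > 0" using assms by simp
    from has_field_derivative_transform_within_open[OF d1[OF this] open_greaterThan[of E], of "tpow q E"] greater
    show ?thesis by (auto simp: tpow_def max_def)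
  next
    case equal
    have 1: "((\<lambda>h. ((E + h) powr (- q) - E powr (- q)) / h) \<longlongrightarrow> - q * E powr (- q - 1)) (at 0)"
      using d1[OF assms] by (simp add: DERIV_def)
    have 2: "((\<lambda>h. (E powr (- q) * (1 - q * ((E + h) / E - 1)) - E powr (- q) * (1 - q * (E / E - 1))) / h)
        \<longlongrightarrow> - q * E powr (- q - 1)) (at 0)"
      using d2[of E] by (simp only: DERIV_def)
    have "((\<lambda>h. (tpow q E (E + h) - tpow q E E) / h) \<longlongrightarrow> - q * E powr (- q - 1)) (at_right 0)"
      by (rule Lim_transform_eventually[OF filterlim_mono[OF 1 order_refl]])
        (auto simp: eventually_at_filter tpow_def at_le)
    moreover have "((\<lambda>h. (tpow q E (E + h) - tpow q E E) / h) \<longlongrightarrow> - q * E powr (- q - 1)) (at_left 0)"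
      by (rule Lim_transform_eventually[OF filterlim_mono[OF 2 order_refl]])
        (use assms in \<open>auto simp: eventually_at_filter tpow_def at_le\<close>)
    ultimately have "(tpow q E has_real_derivative - q * E powr (- q - 1)) (at E)"
      unfolding DERIV_def by (rule filterlim_split_at[rotated])
    then show ?thesis using equal by simp
  qed
qed

lemma tpow_nonneg: "E > 0 \<Longrightarrow> q \<ge> 0 \<Longrightarrow> 0 \<le> tpow q E t"
proof -
  assume a: "E > 0" "q \<ge> 0"
  have "q * (t / E - 1) \<le> 0" if "t < E" using a that by (intro mult_nonneg_nonpos) auto
  then show ?thesis by (auto simp: tpow_def intro!: mult_nonneg_nonneg)
qed

text \<open>A convex function lies above its tangents. With s = t / E this is the chain 1 - q (s -
  1) \<le> 1 - q ln s \<le> exp (- q ln s).\<close>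

lemma tpow_le:
  assumes "E > 0" "q \<ge> 0" "t > 0"
  shows "tpow q E t \<le> t powr (- q)"
proof (cases "t \<ge> E")
  case False
  have "1 - q * (t / E - 1) \<le> 1 + (- q * ln (t / E))"
    using mult_left_mono[OF ln_le_minus_one[of "t / E"], of q] assms by simp
  also have "\<dots> \<le> exp (- q * ln (t / E))" by (rule exp_ge_add_one_self)
  also have "\<dots> = (t / E) powr (- q)" using assms by (simp add: powr_def)
  finally have "E powr (- q) * (1 - q * (t / E - 1)) \<le> E powr (- q) * (t / E) powr (- q)"
    by (intro mult_left_mono) auto
  also have "\<dots> = t powr (- q)" using assms by (simp add: powr_mult[symmetric])
  finally show ?thesis using False by (simp add: tpow_def)
qed (simp add: tpow_def)

lemma integrable_mult_kernel:
  fixes f k :: "'a::euclidean_space \<Rightarrow> real"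
  assumes f: "continuous_on UNIV f" "bounded {x. f x \<noteq> 0}" and k: "integrable lborel k"
  shows "integrable lborel (\<lambda>y. f y * k y)"
proof -
  obtain B where B: "\<And>x. \<bar>f x\<bar> \<le> B" using continuous_bounded_support(2)[OF f] by auto
  have [measurable]: "f \<in> borel_measurable borel" using f by (auto intro: borel_measurable_continuous_onI)
  have [measurable]: "k \<in> borel_measurable lborel" using k by auto
  have "norm (f y * k y) \<le> norm (B * \<bar>k y\<bar>)" for y
    using mult_right_mono[OF order_trans[OF B abs_ge_self], of "\<bar>k y\<bar>" y] by (simp add: abs_mult)
  then have ae: "AE y in lborel. norm (f y * k y) \<le> norm (B * \<bar>k y\<bar>)" by (intro AE_I2)
  have i: "integrable lborel (\<lambda>y. B * \<bar>k y\<bar>)" using k by simp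
  have m: "(\<lambda>y. f y * k y) \<in> borel_measurable lborel" by measurable
  show ?thesis by (rule Bochner_Integration.integrable_bound[OF i m ae])
qed

lemma bounded_shift_support:
  fixes f :: "'a::euclidean_space \<Rightarrow> 'b::euclidean_space"
  assumes "bounded {x. f x \<noteq> 0}" shows "bounded {y. f (y + c) \<noteq> 0}"
proof -
  have "{y. f (y + c) \<noteq> 0} = (\<lambda>x. x - c) ` {x. f x \<noteq> 0}"
    by (auto simp: image_iff) (metis add_diff_cancel_right')
  then show ?thesis using bounded_translation_minus[OF assms, of c] by simp
qed

text \<open>Divergence theorem for the field \<open>V y = tpow (N/2) E (\<bar>y\<bar>\<^sup>2) y\<close>, a regularization of
  \<open>y / \<bar>y\<bar>\<^sup>N\<close>: its divergence \<open>\<kappa>\<close> is a nonnegative approximation of a Dirac mass, supported in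
  the ball of radius \<open>sqrt E\<close>. Continuing the power by its tangent line below \<open>E\<close> keeps \<open>V\<close>
  of class \<open>C\<^sup>1\<close>.\<close>

lemma divergence_tpow:
  fixes f :: "real^'n \<Rightarrow> real" and x :: "real^'n"
  defines "N \<equiv> real CARD('n)"
  assumes f: "Ck_on 1 UNIV f" "bounded {x. f x \<noteq> 0}" and E: "E > 0"
  defines "\<kappa> \<equiv> \<lambda>y::real^'n. if (norm y)\<^sup>2 \<ge> E then 0 else E powr (- (N / 2)) * (N * (1 + N / 2) * (1 - (norm y)\<^sup>2 / E))"
  shows "integrable lborel (\<lambda>y. f (y + x) * \<kappa> y)"
    "integrable lborel (\<lambda>y. tpow (N / 2) E ((norm y)\<^sup>2) * (grad f (y + x) \<bullet> y))"
    "(LINT y|lborel. f (y + x) * \<kappa> y) = - (LINT y|lborel. tpow (N / 2) E ((norm y)\<^sup>2) * (grad f (y + x) \<bullet> y))"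
proof -
  let ?q = "N / 2"
  let ?m = "\<lambda>y::real^'n. tpow ?q E ((norm y)\<^sup>2)"
  let ?d = "\<lambda>y::real^'n. - ?q * (max ((norm y)\<^sup>2) E) powr (- ?q - 1)"
  let ?f = "\<lambda>y. f (y + x)"
  have cd: "continuous_on UNIV (\<lambda>t. - ?q * (max t E) powr (- ?q - 1))"
    using E by (intro continuous_intros) auto
  have mC: "Ck_on 1 UNIV ?m" by (rule Ck_on_1_chain[OF pd_norm2(2) DERIV_tpow[OF E] cd])
  have pdm: "pd i ?m y = ?d y * (2 * y $ i)" for i y
    by (subst pd_chain(1)[OF Ck_on_1D(1)[OF pd_norm2(2)] DERIV_tpow[OF E]]) (auto simp: pd_norm2)
  have cC: "Ck_on 1 UNIV (\<lambda>y::real^'n. y $ i)" for i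
    using Cinf_onD(2)[OF bump_algebra_Cinf[OF bump_algebra.coord]] .
  have fC: "Ck_on 1 UNIV ?f" by (rule Ck_on_1_shift[OF f(1)])
  note vC = Ck_on_1_mult[OF cC mC] and dm = Ck_on_1D(1)[OF mC UNIV_I] and dc = Ck_on_1D(1)[OF cC UNIV_I]
    and df = Ck_on_1D(1)[OF fC UNIV_I]
  have pdf: "pd i ?f y = pd i f (y + x)" for i y using pd_shift(1) Ck_on_1D(1)[OF f(1)] by blast
  have pdv: "pd i (\<lambda>y. y $ i * ?m y) y = ?m y + ?d y * (2 * (y $ i)\<^sup>2)" for i y
    unfolding pd_mult[OF dc dm, of i i y] pdm by (simp add: pd_coord power2_eq_square)
  \<comment> \<open>Components of the vector field \<open>V\<close> multiplied by the translate of
    \<open>f\<close>. They are C^1 of bounded support, so the integral of the total divergence is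
    zero, and the product rule splits it into the two integrals to be compared.\<close>
  define F where "F i y = ?f y * (y $ i * ?m y)" for i y
  have FC: "Ck_on 1 UNIV (F i)" for i unfolding F_def by (rule Ck_on_1_mult[OF fC vC])
  have Fb: "bounded {y. F i y \<noteq> 0}" for i
    by (rule bounded_subset[OF bounded_shift_support[OF f(2), of x]]) (auto simp: F_def)
  have pdF: "pd i (F i) y = pd i f (y + x) * (y $ i * ?m y) + ?f y * (?m y + ?d y * (2 * (y $ i)\<^sup>2))" for i y
    unfolding F_def by (subst pd_mult[OF df Ck_on_1D(1)[OF vC UNIV_I]]) (simp only: pdf pdv)
  have ipd: "integrable lborel (pd i (F i))" for i
    by (rule continuous_bounded_support(1)[OF Ck_on_1D(2)[OF FC] bounded_pd_support[OF Fb]])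
  \<comment> \<open>With m = \<open>tpow (N / 2) E\<close> and t = \<bar>y\<bar>^2 the sum is N m +
    2 t m'. The exponent N / 2 is the one that makes it vanish for t \<ge> E. On the tangent piece,
    2 (N / 2) = N lets the terms collect into the factor N (1 + N / 2) (1 - t / E).\<close>
  have div: "(\<Sum>i\<in>UNIV. ?m y + ?d y * (2 * (y $ i)\<^sup>2)) = \<kappa> y" for y
  proof -
    have n2: "(norm y)\<^sup>2 = (\<Sum>i\<in>UNIV. (y $ i)\<^sup>2)"
      by (simp add: norm_vec_def L2_set_def sum_nonneg)
    have "(\<Sum>i\<in>UNIV. ?m y + ?d y * (2 * (y $ i)\<^sup>2)) = N * ?m y + ?d y * (2 * (norm y)\<^sup>2)"
    proof -
      have "(\<Sum>i\<in>(UNIV::'n set). M + D * (2 * (y $ i)\<^sup>2)) = N * M + D * (2 * (\<Sum>i\<in>UNIV. (y $ i)\<^sup>2))" for M D :: real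
        by (simp add: sum.distrib sum_distrib_left N_def)
      then show ?thesis by (simp only: n2[symmetric])
    qed
    also have "\<dots> = \<kappa> y"
    proof (cases "(norm y)\<^sup>2 \<ge> E")
      case True
      then have "(norm y)\<^sup>2 > 0" using E by linarith
      then have "((norm y)\<^sup>2) powr (- ?q - 1) * (norm y)\<^sup>2 = ((norm y)\<^sup>2) powr (- ?q)"
        by (simp add: powr_diff)
      then show ?thesis using True by (simp add: \<kappa>_def tpow_def max_absorb1 mult.assoc mult.left_commute)
    next
      case False
      have "E powr (- ?q - 1) = E powr (- ?q) / E" using E by (simp add: powr_diff)
      then show ?thesis using False E by (simp add: \<kappa>_def tpow_def max_absorb2 field_simps)
    qed
    finally show ?thesis .
  qed
  have cf: "continuous_on UNIV ?f" using Ck_on_1D(3)[OF fC] .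
  \<comment> \<open>Continuity of \<open>\<kappa>\<close> is read off the formula \<open>div\<close>
    instead of its definition by cases.\<close>
  have i1: "integrable lborel (\<lambda>y. ?f y * \<kappa> y)"
  proof (rule continuous_bounded_support(1))
    have "continuous_on UNIV (\<lambda>y. ?f y * (\<Sum>i\<in>(UNIV::'n set). ?m y + ?d y * (2 * (y $ i)\<^sup>2)))"
      using E by (intro continuous_intros cf Ck_on_1D(3)[OF mC] continuous_on_compose2[OF cd]) auto
    then show "continuous_on UNIV (\<lambda>y. ?f y * \<kappa> y)" unfolding div .
    show "bounded {y. ?f y * \<kappa> y \<noteq> 0}"
      by (rule bounded_subset[OF bounded_shift_support[OF f(2), of x]]) auto
  qed
  have i2: "integrable lborel (\<lambda>y. ?m y * (grad f (y + x) \<bullet> y))"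
  proof (rule continuous_bounded_support(1))
    show "continuous_on UNIV (\<lambda>y. ?m y * (grad f (y + x) \<bullet> y))"
      by (intro continuous_intros Ck_on_1D(3)[OF mC] continuous_on_compose2[OF Ck_on_1D(4)[OF f(1)]]) auto
    show "bounded {y. ?m y * (grad f (y + x) \<bullet> y) \<noteq> 0}"
      by (rule bounded_subset[OF bounded_shift_support[OF bounded_grad_support[OF f(2)], of x]]) auto
  qed
  show "integrable lborel (\<lambda>y. f (y + x) * \<kappa> y)"
    "integrable lborel (\<lambda>y. ?m y * (grad f (y + x) \<bullet> y))" by (fact i1, fact i2)
  have "0 = (\<Sum>i\<in>UNIV. LINT y|lborel. pd i (F i) y)" by (simp add: integral_pd_eq_0[OF FC Fb])
  also have "\<dots> = (LINT y|lborel. (\<Sum>i\<in>UNIV. pd i (F i) y))" by (subst Bochner_Integration.integral_sum) (auto intro: ipd)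
  also have "\<dots> = (LINT y|lborel. ?m y * (grad f (y + x) \<bullet> y) + ?f y * \<kappa> y)"
  proof (rule Bochner_Integration.integral_cong[OF refl])
    fix y
    have "(\<Sum>i\<in>UNIV. pd i (F i) y) = (\<Sum>i\<in>UNIV. pd i f (y + x) * (y $ i * ?m y)) + ?f y * (\<Sum>i\<in>UNIV. ?m y + ?d y * (2 * (y $ i)\<^sup>2))"
      unfolding pdF by (subst sum.distrib) (simp only: sum_distrib_left)
    also have "(\<Sum>i\<in>UNIV. pd i f (y + x) * (y $ i * ?m y)) = ?m y * (grad f (y + x) \<bullet> y)"
      unfolding inner_vec_def grad_def sum_distrib_left by (simp add: ac_simps)
    finally show "(\<Sum>i\<in>UNIV. pd i (F i) y) = ?m y * (grad f (y + x) \<bullet> y) + ?f y * \<kappa> y"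
      unfolding div .
  qed
  also have "\<dots> = (LINT y|lborel. ?m y * (grad f (y + x) \<bullet> y)) + (LINT y|lborel. ?f y * \<kappa> y)"
    by (rule Bochner_Integration.integral_add[OF i2 i1])
  finally have e: "0 = (LINT y|lborel. ?m y * (grad f (y + x) \<bullet> y)) + (LINT y|lborel. ?f y * \<kappa> y)" .
  have "b = - a" if "0 = a + b" for a b :: real using that by simp
  from this[OF e] show "(LINT y|lborel. f (y + x) * \<kappa> y) = - (LINT y|lborel. ?m y * (grad f (y + x) \<bullet> y))" .
qed

lemma riesz_potential_bound:
  fixes f :: "real^'n \<Rightarrow> real" and x :: "real^'n"
  assumes f: "Ck_on 1 UNIV f" "bounded {x. f x \<noteq> 0}"
    and R: "R > 0" "\<And>y. grad f (y + x) \<noteq> 0 \<Longrightarrow> norm y \<le> R"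
  shows "\<bar>f x\<bar> * (unit_ball_vol (real CARD('n)) / 2 ^ (CARD('n) + 1))
    \<le> (LINT y|lborel. norm (grad f (y + x)) * (indicator (cball 0 R) y * norm y powr (- (real CARD('n) - 1))))"
proof (cases "f x = 0")
  case True
  moreover have "0 \<le> (LINT y|lborel. norm (grad f (y + x)) * (indicator (cball 0 R) y * norm y powr (- (real CARD('n) - 1))))"
    by (intro integral_nonneg_AE AE_I2 mult_nonneg_nonneg) auto
  ultimately show ?thesis by simp
next
  case False
  let ?N = "real CARD('n)" and ?v = "unit_ball_vol (real CARD('n))"
  let ?k = "\<lambda>y::real^'n. indicator (cball 0 R) y * norm y powr (- (?N - 1))"
  have N: "?N \<ge> 1" using finite_UNIV_card_ge_0[where 'a='n] by (simp add: Suc_leI)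
  define s where "s = sgn (f x)"
  have s: "\<bar>s\<bar> = 1" "s * f x = \<bar>f x\<bar>" using False by (auto simp: s_def sgn_if)
  have cf: "continuous_on UNIV f" using Ck_on_1D(3)[OF f(1)] .
  have "\<forall>e>0. \<exists>d>0. \<forall>y. dist y x < d \<longrightarrow> dist (f y) (f x) < e"
    using cf unfolding continuous_on_iff by auto
  moreover have "\<bar>f x\<bar> / 2 > 0" using False by simp
  ultimately obtain d where d: "d > 0" "\<And>y. dist y x < d \<Longrightarrow> dist (f y) (f x) < \<bar>f x\<bar> / 2" by meson
  have lo: "s * f (y + x) \<ge> \<bar>f x\<bar> / 2" if "norm y < d" for y
  proof -
    have "\<bar>f (y + x) - f x\<bar> < \<bar>f x\<bar> / 2" using d(2)[of "y + x"] that by (simp add: dist_norm)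
    moreover have "\<bar>s * f (y + x) - s * f x\<bar> = \<bar>f (y + x) - f x\<bar>"
      using s(1) by (simp add: abs_mult right_diff_distrib[symmetric])
    ultimately show ?thesis using s(2) by linarith
  qed
  have E: "d\<^sup>2 > 0" using d by simp
  define \<kappa> where "\<kappa> y = (if (norm y)\<^sup>2 \<ge> d\<^sup>2 then 0 else (d\<^sup>2) powr (- (?N / 2)) * (?N * (1 + ?N / 2) * (1 - (norm y)\<^sup>2 / d\<^sup>2)))" for y :: "real^'n"
  note D = divergence_tpow[OF f E, where x=x, folded \<kappa>_def]
  have sq: "(norm y)\<^sup>2 < d\<^sup>2 \<longleftrightarrow> norm y < d" for y :: "real^'n"
    using d power_strict_mono[of "norm y" d 2] power2_less_imp_less[of "norm y" d] by auto
  have powE: "(d\<^sup>2) powr (- (?N / 2)) = inverse (d ^ CARD('n))"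
  proof -
    have "(d\<^sup>2) powr (- (?N / 2)) = (d powr 2) powr (- (?N / 2))" using d by simp
    also have "\<dots> = d powr (- ?N)" by (simp only: powr_powr) simp
    finally show ?thesis using d by (simp add: powr_minus powr_realpow)
  qed
  have \<kappa>0: "0 \<le> \<kappa> y" for y
    using N d by (auto simp: \<kappa>_def not_le intro!: mult_nonneg_nonneg)
  have \<kappa>1: "\<kappa> y \<ge> inverse (d ^ CARD('n))" if "norm y < d / 2" for y
  proof -
    have "(norm y)\<^sup>2 < (d / 2)\<^sup>2" using that by (intro power_strict_mono) auto
    then have y: "(norm y)\<^sup>2 / d\<^sup>2 \<le> 1 / 4" using d(1) by (simp add: power_divide field_simps)
    have yd: "(norm y)\<^sup>2 < d\<^sup>2" using sq that d(1) by simp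
    \<comment> \<open>N \<ge> 1 gives N (1 + N / 2) \<ge> 3 / 2, and the half ball gives 1 -
      \<bar>y\<bar>^2 / d^2 \<ge> 3 / 4.\<close>
    have "1 \<le> (3 / 2) * (3 / 4 :: real)" by simp
    also have "\<dots> \<le> (?N * (1 + ?N / 2)) * (1 - (norm y)\<^sup>2 / d\<^sup>2)"
    proof (rule mult_mono)
      have "1 * (3 / 2) \<le> ?N * (1 + ?N / 2)" using N by (intro mult_mono) auto
      then show "3 / 2 \<le> ?N * (1 + ?N / 2)" by simp
    qed (use y N in auto)
    finally have 1: "1 \<le> (?N * (1 + ?N / 2)) * (1 - (norm y)\<^sup>2 / d\<^sup>2)" .
    have "inverse (d ^ CARD('n)) * 1 \<le> inverse (d ^ CARD('n)) * (?N * (1 + ?N / 2) * (1 - (norm y)\<^sup>2 / d\<^sup>2))"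
      using d(1) by (intro mult_left_mono 1) simp
    then show ?thesis using yd by (simp add: \<kappa>_def powE)
  qed
  have "\<bar>f x\<bar> * (?v / 2 ^ (CARD('n) + 1)) = \<bar>f x\<bar> / 2 * inverse (d ^ CARD('n)) * measure lborel (ball (0::real^'n) (d / 2))"
    using d by (simp add: content_ball power_divide)
  also have "\<dots> = (LINT y|lborel. \<bar>f x\<bar> / 2 * inverse (d ^ CARD('n)) * indicator (ball (0::real^'n) (d / 2)) y)"
    by simp
  also have "\<dots> \<le> (LINT y|lborel. s * (f (y + x) * \<kappa> y))"
  proof (rule integral_mono)
    show "integrable lborel (\<lambda>y. \<bar>f x\<bar> / 2 * inverse (d ^ CARD('n)) * indicat_real (ball (0::real^'n) (d / 2)) y)"
      by (intro integrable_mult_right integrable_real_indicator emeasure_bounded_finite) auto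
    show "integrable lborel (\<lambda>y. s * (f (y + x) * \<kappa> y))" using D(1) by simp
    fix y :: "real^'n"
    have "\<bar>f x\<bar> / 2 * inverse (d ^ CARD('n)) * indicator (ball 0 (d / 2)) y \<le> s * f (y + x) * \<kappa> y"
    proof (cases "norm y < d")
      case True
      have "\<bar>f x\<bar> / 2 * (inverse (d ^ CARD('n)) * indicator (ball 0 (d / 2)) y) \<le> s * f (y + x) * \<kappa> y"
        using lo[OF True] \<kappa>0[of y] \<kappa>1[of y] d by (intro mult_mono) (auto simp: indicator_def)
      then show ?thesis by (simp only: mult.assoc)
    next
      case False
      have "\<kappa> y = 0" using False sq[of y] by (simp add: \<kappa>_def)
      moreover have "y \<notin> ball 0 (d / 2)" using False d(1) by simp
      ultimately show ?thesis by simp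
    qed
    then show "\<bar>f x\<bar> / 2 * inverse (d ^ CARD('n)) * indicator (ball 0 (d / 2)) y \<le> s * (f (y + x) * \<kappa> y)"
      by (simp only: mult.assoc)
  qed
  also have "\<dots> = s * - (LINT y|lborel. tpow (?N / 2) (d\<^sup>2) ((norm y)\<^sup>2) * (grad f (y + x) \<bullet> y))"
    using D(3) by simp
  also have "\<dots> \<le> \<bar>\<dots>\<bar>" by (rule abs_ge_self)
  also have "\<dots> = \<bar>LINT y|lborel. tpow (?N / 2) (d\<^sup>2) ((norm y)\<^sup>2) * (grad f (y + x) \<bullet> y)\<bar>"
    using s(1) by (simp add: abs_mult)
  also have "\<dots> \<le> (LINT y|lborel. norm (grad f (y + x)) * ?k y)"
  proof (rule order_trans[OF integral_abs_bound], rule integral_mono)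
    show "integrable lborel (\<lambda>y. \<bar>tpow (?N / 2) (d\<^sup>2) ((norm y)\<^sup>2) * (grad f (y + x) \<bullet> y)\<bar>)"
      using D(2) by simp
    show "integrable lborel (\<lambda>y. norm (grad f (y + x)) * ?k y)"
    proof (rule integrable_mult_kernel)
      show "continuous_on UNIV (\<lambda>y. norm (grad f (y + x)))"
        by (intro continuous_intros continuous_on_compose2[OF Ck_on_1D(4)[OF f(1)]]) auto
      show "bounded {y. norm (grad f (y + x)) \<noteq> 0}"
        using bounded_shift_support[OF bounded_grad_support[OF f(2)], of x] by simp
      show "integrable lborel ?k" using N R(1) by (intro norm_powr_kernel_integrable) auto
    qed
    fix y :: "real^'n"
    show "\<bar>tpow (?N / 2) (d\<^sup>2) ((norm y)\<^sup>2) * (grad f (y + x) \<bullet> y)\<bar> \<le> norm (grad f (y + x)) * ?k y"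
    proof (cases "y = 0 \<or> grad f (y + x) = 0")
      case True then show ?thesis by auto
    next
      case False
      then have y: "norm y > 0" "norm y \<le> R" using R(2) by auto
      have "\<bar>tpow (?N / 2) (d\<^sup>2) ((norm y)\<^sup>2) * (grad f (y + x) \<bullet> y)\<bar> \<le> ((norm y)\<^sup>2) powr (- (?N / 2)) * (norm (grad f (y + x)) * norm y)"
        unfolding abs_mult
      proof (rule mult_mono[OF _ Cauchy_Schwarz_ineq2])
        have "0 \<le> tpow (?N / 2) (d\<^sup>2) ((norm y)\<^sup>2)" by (rule tpow_nonneg[OF E]) simp
        moreover have "tpow (?N / 2) (d\<^sup>2) ((norm y)\<^sup>2) \<le> ((norm y)\<^sup>2) powr (- (?N / 2))"
          by (rule tpow_le[OF E]) (use y in auto)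
        ultimately show "\<bar>tpow (?N / 2) (d\<^sup>2) ((norm y)\<^sup>2)\<bar> \<le> ((norm y)\<^sup>2) powr (- (?N / 2))" by simp
      qed auto
      also have "((norm y)\<^sup>2) powr (- (?N / 2)) = norm y powr (- ?N)"
      proof -
        have "((norm y)\<^sup>2) powr (- (?N / 2)) = (norm y powr 2) powr (- (?N / 2))" using y by simp
        also have "\<dots> = norm y powr (- ?N)" by (simp only: powr_powr) simp
        finally show ?thesis .
      qed
      also have "norm y powr (- ?N) * (norm (grad f (y + x)) * norm y) = norm (grad f (y + x)) * (norm y powr (- ?N) * norm y powr 1)"
        using y by simp
      also have "norm y powr (- ?N) * norm y powr 1 = norm y powr (- (?N - 1))"
        by (subst powr_add[symmetric]) simp
      finally show ?thesis using y by simp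
    qed
  qed
  finally show ?thesis .
qed

text \<open>Subcritical Sobolev inequality. Three-factor Hoelder with the kernel \<open>K = \<bar>y\<bar>\<^bsup>(1 - N) \<sigma>\<^esup>\<close>,
  \<open>\<sigma> = 2 p / (p + 1)\<close>, which is locally integrable exactly when \<open>p (N - 2) < N\<close>.\<close>

lemma subcritical_Sobolev:
  fixes p R :: real
  assumes N: "CARD('n::finite) \<ge> 2" and p: "1 < p" "p * (real CARD('n) - 2) < real CARD('n)" and R: "R > 0"
  obtains C where "C > 0"
    "\<And>f :: real^'n \<Rightarrow> real. Ck_on 1 UNIV f \<Longrightarrow> closure {x. f x \<noteq> 0} \<subseteq> cball 0 R \<Longrightarrow>
      (LINT x|lborel. \<bar>f x\<bar> powr (2 * p)) \<le> C * (LINT x|lborel. (norm (grad f x))\<^sup>2) powr p"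
proof -
  let ?N = "real CARD('n)"
  \<comment> \<open>Determined by \<sigma> (1 / 2 + 1 / (2p)) = 1, so that the Riesz kernel is the
    product of the powers 1 / 2 and 1 / (2p) of \<open>K\<close>.\<close>
  define \<sigma> where "\<sigma> = 2 * p / (p + 1)"
  \<comment> \<open>The radius is doubled because \<open>x\<close> and \<open>y + x\<close> both
    range over \<open>cball 0 R\<close>.\<close>
  define K where "K y = indicator (cball 0 (2 * R)) y * norm y powr (- ((?N - 1) * \<sigma>))" for y :: "real^'n"
  define k where "k y = indicator (cball 0 (2 * R)) y * norm y powr (- (?N - 1))" for y :: "real^'n"
  define M where "M = (LINT y|lborel. K y)"
  define c where "c = unit_ball_vol ?N / 2 ^ (CARD('n) + 1)"
  have c: "c > 0" by (simp add: c_def)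
  have "1 / 2 + 1 / (2 * p) = (p + 1) / (2 * p)" using p(1) by (simp add: field_simps)
  then have \<sigma>: "0 < \<sigma>" "\<sigma> * (1 / 2 + 1 / (2 * p)) = 1" using p(1) by (simp_all add: \<sigma>_def)
  have "(?N - 1) * (2 * p) < ?N * (p + 1)" using p(2) by (simp add: algebra_simps)
  then have "(?N - 1) * \<sigma> < ?N" using p(1) by (simp add: \<sigma>_def pos_divide_less_eq)
  then have Ki: "integrable lborel K"
    unfolding K_def using N \<sigma> R by (intro norm_powr_kernel_integrable) auto
  have K0: "0 \<le> K y" for y by (simp add: K_def)
  have kK: "k y = K y powr (1 / 2) * K y powr (1 / (2 * p))" for y
  proof -
    have "K y powr (1 / 2) * K y powr (1 / (2 * p)) = K y powr (1 / 2 + 1 / (2 * p))" by (rule powr_add[symmetric])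
    also have "\<dots> = indicator (cball 0 (2 * R)) y * norm y powr (- ((?N - 1) * \<sigma>) * (1 / 2 + 1 / (2 * p)))"
      by (simp add: K_def indicator_def powr_powr)
    also have "- ((?N - 1) * \<sigma>) * (1 / 2 + 1 / (2 * p)) = - (?N - 1) * (\<sigma> * (1 / 2 + 1 / (2 * p)))" by (simp only: mult.assoc mult_minus_left)
    finally show ?thesis using \<sigma> by (simp add: k_def)
  qed
  have M0: "0 \<le> M" unfolding M_def using K0 by (intro integral_nonneg_AE AE_I2)
  have key: "c powr (2 * p) * (LINT x|lborel. \<bar>f x\<bar> powr (2 * p)) \<le> M powr (p + 1) * (LINT x|lborel. (norm (grad f x))\<^sup>2) powr p"
    if f: "Ck_on 1 UNIV f" and s: "closure {x. f x \<noteq> 0} \<subseteq> cball 0 R" for f :: "real^'n \<Rightarrow> real"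
  proof -
    have b: "bounded {x. f x \<noteq> 0}" by (rule bounded_subset[OF bounded_cball order_trans[OF closure_subset s]])
    define F where "F x = (norm (grad f x))\<^sup>2" for x
    define D where "D = (LINT x|lborel. F x)"
    define I where "I x = (LINT y|lborel. F (y + x) * K y)" for x
    have F0: "0 \<le> F x" for x by (simp add: F_def)
    have cF: "continuous_on UNIV F" unfolding F_def by (intro continuous_intros Ck_on_1D(4)[OF f])
    have bF: "bounded {x. F x \<noteq> 0}" using bounded_grad_support[OF b] by (simp add: F_def)
    have cFs: "continuous_on UNIV (\<lambda>y. F (y + x))" for x by (intro continuous_on_compose2[OF cF] continuous_intros) auto
    have Fi: "integrable lborel F" by (rule continuous_bounded_support(1)[OF cF bF])
    have Fsi: "integrable lborel (\<lambda>y. F (y + x))" for x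
      by (rule continuous_bounded_support(1)[OF cFs bounded_shift_support[OF bF]])
    have [measurable]: "F \<in> borel_measurable borel" using cF by (rule borel_measurable_continuous_onI)
    have [measurable]: "K \<in> borel_measurable borel" using Ki by auto
    have FsD: "(LINT y|lborel. F (y + x)) = D" for x
      unfolding D_def by (subst lborel_integral_translate[symmetric, of F x]) (auto simp: add.commute)
    have D0: "0 \<le> D" unfolding D_def using F0 by (intro integral_nonneg_AE AE_I2)
    have FKi: "integrable lborel (\<lambda>y. F (y + x) * K y)" for x
      by (rule integrable_mult_kernel[OF cFs bounded_shift_support[OF bF] Ki])
    have I0: "0 \<le> I x" for x unfolding I_def using F0 K0 by (intro integral_nonneg_AE AE_I2 mult_nonneg_nonneg)
    \<comment> \<open>Cauchy-Schwarz splits off K^(1/2) and leaves the integral of F K^(1/p).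
      Hoelder with weight 1/p applied to (F K)^(1/p) F^(1 - 1/p) bounds this by I^(1/p) D^(1 - 1/p).
      Raising to the power 2p makes \<open>I x\<close> appear linearly, so it can be integrated in
      \<open>x\<close>.\<close>
    have pw: "c powr (2 * p) * \<bar>f x\<bar> powr (2 * p) \<le> M powr p * D powr (p - 1) * I x" for x
    proof (cases "f x = 0")
      case True
      then show ?thesis using I0[of x] p by (auto intro!: mult_nonneg_nonneg)
    next
      case False
      have x: "norm x \<le> R" using False s closure_subset[of "{x. f x \<noteq> 0}"] by auto
      have R2: "norm y \<le> 2 * R" if "grad f (y + x) \<noteq> 0" for y
      proof -
        from that obtain i where "pd i f (y + x) \<noteq> 0" by (auto simp: grad_def vec_eq_iff)
        then have "y + x \<in> closure {x. f x \<noteq> 0}" using pd_support[of i f] closure_subset[of "{x. pd i f x \<noteq> 0}"] by auto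
        then have "norm (y + x) \<le> R" using s by auto
        then show ?thesis using x norm_triangle_ineq4[of "y + x" x] by simp
      qed
      have R': "2 * R > 0" using R by simp
      note B = riesz_potential_bound[OF f b R' R2, folded c_def k_def]
      have e1: "norm (grad f (y + x)) * k y = (F (y + x) * K y powr (1 / p)) powr (1 / 2) * K y powr (1 - 1 / 2)" for y
        using F0 K0 p by (simp add: kK F_def powr_mult powr_powr powr_half_sqrt ac_simps)
      have e2: "F (y + x) * K y powr (1 / p) = (F (y + x) * K y) powr (1 / p) * F (y + x) powr (1 - 1 / p)" for y
      proof -
        have "(F (y + x) * K y) powr (1 / p) * F (y + x) powr (1 - 1 / p) = (F (y + x) powr (1 / p) * F (y + x) powr (1 - 1 / p)) * K y powr (1 / p)"
          using F0 K0 by (simp add: powr_mult ac_simps)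
        also have "F (y + x) powr (1 / p) * F (y + x) powr (1 - 1 / p) = F (y + x)"
          using F0[of "y + x"] by (subst powr_add[symmetric]) simp
        finally show ?thesis by simp
      qed
      have p': "0 < 1 / p" "1 / p < 1" using p by auto
      have FK0: "0 \<le> F (y + x) * K y" for y using F0 K0 by (intro mult_nonneg_nonneg)
      note H2 = Holder_integral[OF p' FKi[of x] FK0 Fsi[of x] F0, folded e2 I_def, unfolded FsD]
      have FK0': "0 \<le> F (y + x) * K y powr (1 / p)" for y using F0 by (intro mult_nonneg_nonneg) auto
      have "c * \<bar>f x\<bar> \<le> (LINT y|lborel. norm (grad f (y + x)) * k y)" using B by (simp add: mult.commute)
      also have "\<dots> \<le> (LINT y|lborel. F (y + x) * K y powr (1 / p)) powr (1 / 2) * M powr (1 - 1 / 2)"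
        unfolding e1 M_def by (rule Holder_integral(2)[OF _ _ H2(1) FK0' Ki K0]) auto
      also have "\<dots> \<le> (I x powr (1 / p) * D powr (1 - 1 / p)) powr (1 / 2) * M powr (1 / 2)"
        using H2(2) FK0' by (intro mult_mono powr_mono2) (auto intro!: integral_nonneg_AE AE_I2)
      also have "\<dots> = I x powr (1 / (2 * p)) * D powr ((1 - 1 / p) / 2) * M powr (1 / 2)"
        using I0 D0 by (simp add: powr_mult powr_powr mult.commute)
      finally have "c * \<bar>f x\<bar> \<le> I x powr (1 / (2 * p)) * D powr ((1 - 1 / p) / 2) * M powr (1 / 2)" .
      then have "(c * \<bar>f x\<bar>) powr (2 * p) \<le> (I x powr (1 / (2 * p)) * D powr ((1 - 1 / p) / 2) * M powr (1 / 2)) powr (2 * p)"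
        using c p by (intro powr_mono2) auto
      also have "\<dots> = I x powr (1 / (2 * p) * (2 * p)) * D powr ((1 - 1 / p) / 2 * (2 * p)) * M powr (1 / 2 * (2 * p))"
        by (simp only: powr_mult powr_powr)
      also have "1 / (2 * p) * (2 * p) = 1" using p by simp
      also have "(1 - 1 / p) / 2 * (2 * p) = p - 1" using p by (simp add: field_simps)
      also have "1 / 2 * (2 * p) = p" by simp
      finally show ?thesis using I0[of x] c by (simp add: powr_mult ac_simps)
    qed
    \<comment> \<open>Tonelli for the nonnegative integrand. By translation invariance the integral
      in \<open>x\<close> no longer depends on \<open>y\<close>, so the double integral
      factors.\<close>
    have fubini: "(\<integral>\<^sup>+x. ennreal (I x) \<partial>lborel) = ennreal (D * M)"
    proof -
      have "(\<integral>\<^sup>+x. ennreal (I x) \<partial>lborel) = (\<integral>\<^sup>+x. \<integral>\<^sup>+y. ennreal (F (y + x) * K y) \<partial>lborel \<partial>lborel)"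
        unfolding I_def using F0 K0 FKi by (intro nn_integral_cong nn_integral_eq_integral[symmetric]) auto
      also have "\<dots> = (\<integral>\<^sup>+y. \<integral>\<^sup>+x. ennreal (F (y + x) * K y) \<partial>lborel \<partial>lborel)"
        by (rule lborel_pair.Fubini') measurable
      also have "\<dots> = (\<integral>\<^sup>+y. ennreal (D * K y) \<partial>lborel)"
      proof (rule nn_integral_cong)
        fix y :: "real^'n"
        have i: "integrable lborel (\<lambda>x. F (y + x) * K y)" using Fsi[of y] by (simp add: add.commute)
        then have "(\<integral>\<^sup>+x. ennreal (F (y + x) * K y) \<partial>lborel) = ennreal (LINT x|lborel. F (y + x) * K y)"
          using F0 K0 by (intro nn_integral_eq_integral) auto
        also have "(LINT x|lborel. F (y + x) * K y) = D * K y"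
          using FsD[of y] by (simp add: add.commute)
        finally show "(\<integral>\<^sup>+x. ennreal (F (y + x) * K y) \<partial>lborel) = ennreal (D * K y)" .
      qed
      also have "\<dots> = ennreal (LINT y|lborel. D * K y)" using Ki K0 D0 by (intro nn_integral_eq_integral) auto
      also have "\<dots> = ennreal (D * M)" by (simp add: M_def)
      finally show ?thesis .
    qed
    have cf: "continuous_on UNIV f" using Ck_on_1D(3)[OF f] .
    have fi: "integrable lborel (\<lambda>x. \<bar>f x\<bar> powr (2 * p))"
    proof (rule continuous_bounded_support(1))
      show "continuous_on UNIV (\<lambda>x. \<bar>f x\<bar> powr (2 * p))" using p by (intro continuous_on_powr' continuous_intros cf) auto
      show "bounded {x. \<bar>f x\<bar> powr (2 * p) \<noteq> 0}" using b by simp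
    qed
    have "ennreal (c powr (2 * p) * (LINT x|lborel. \<bar>f x\<bar> powr (2 * p))) = (\<integral>\<^sup>+x. ennreal (c powr (2 * p) * \<bar>f x\<bar> powr (2 * p)) \<partial>lborel)"
      using fi by (subst nn_integral_eq_integral) auto
    also have "\<dots> \<le> (\<integral>\<^sup>+x. ennreal (M powr p * D powr (p - 1)) * ennreal (I x) \<partial>lborel)"
      by (rule nn_integral_mono) (use pw I0 in \<open>auto simp: ennreal_mult'[symmetric] intro!: ennreal_leI\<close>)
    also have "\<dots> = ennreal (M powr p * D powr (p - 1)) * ennreal (D * M)"
    proof -
      have [measurable]: "I \<in> borel_measurable lborel"
        unfolding I_def by measurable
      show ?thesis by (subst nn_integral_cmult) (auto simp: fubini)
    qed
    also have "\<dots> = ennreal (M powr (p + 1) * D powr p)"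
    proof -
      have "M powr p * D powr (p - 1) * (D * M) = (M powr p * M powr 1) * (D powr (p - 1) * D powr 1)"
        using M0 D0 by simp
      also have "\<dots> = M powr (p + 1) * D powr p" unfolding powr_add[symmetric] by simp
      finally show ?thesis using M0 D0 by (simp add: ennreal_mult'[symmetric])
    qed
    finally show ?thesis by (subst (asm) ennreal_le_iff) (auto simp: D_def F_def)
  qed
  show ?thesis
  \<comment> \<open>The added 1 makes the constant positive without a lower bound on
    \<open>M\<close>.\<close>
  proof (rule that[of "(M powr (p + 1) + 1) / c powr (2 * p)"])
    show "0 < (M powr (p + 1) + 1) / c powr (2 * p)" using c by (auto intro!: divide_pos_pos add_nonneg_pos)
    fix f :: "real^'n \<Rightarrow> real" assume f: "Ck_on 1 UNIV f" "closure {x. f x \<noteq> 0} \<subseteq> cball 0 R"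
    have "c powr (2 * p) * (LINT x|lborel. \<bar>f x\<bar> powr (2 * p)) \<le> (M powr (p + 1) + 1) * (LINT x|lborel. (norm (grad f x))\<^sup>2) powr p"
      using key[OF f] by (rule order_trans) (auto intro!: mult_right_mono)
    then show "(LINT x|lborel. \<bar>f x\<bar> powr (2 * p)) \<le> (M powr (p + 1) + 1) / c powr (2 * p) * (LINT x|lborel. (norm (grad f x))\<^sup>2) powr p"
      using c by (simp add: field_simps)
  qed
qed

section \<open>Positivity of \<open>\<Lambda>\<close>\<close>

text \<open>Bridge between two settings: the problem is stated with Lebesgue measure on \<Omega>,
  whereas translations, convolutions and integration by parts are carried out with Borel functions
  on the whole space.\<close>

lemma lebesgue_on_lborel:
  fixes f :: "'a::euclidean_space \<Rightarrow> 'b::{banach, second_countable_topology}"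
  assumes U: "open U" and f: "f \<in> borel_measurable borel" and z: "\<And>x. x \<notin> U \<Longrightarrow> f x = 0"
  shows "(LINT x|lebesgue_on U. f x) = (LINT x|lborel. f x)"
    "integrable (lebesgue_on U) f \<longleftrightarrow> integrable lborel f"
    "f \<in> borel_measurable (lebesgue_on U)"
proof -
  have s: "U \<inter> space lebesgue \<in> sets lebesgue" using U by auto
  have i: "(\<lambda>x. indicator U x *\<^sub>R f x) = f" using z by (auto simp: indicator_def)
  have m: "f \<in> borel_measurable lborel" using f by simp
  show "(LINT x|lebesgue_on U. f x) = (LINT x|lborel. f x)"
    by (simp only: integral_restrict_space[OF s] i integral_completion[OF m])
  show "integrable (lebesgue_on U) f \<longleftrightarrow> integrable lborel f"
    by (simp only: integrable_restrict_space[OF s] i integrable_completion[OF m])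
  show "f \<in> borel_measurable (lebesgue_on U)"
    by (rule measurable_restrict_space1) (use m measurable_completion in blast)
qed

lemma test_functionsD:
  fixes \<phi> :: "real^'n \<Rightarrow> real"
  assumes "\<phi> \<in> test_functions \<Omega>"
  shows "Ck_on 1 UNIV \<phi>" "bounded {x. \<phi> x \<noteq> 0}" "x \<notin> \<Omega> \<Longrightarrow> \<phi> x = 0" "x \<notin> \<Omega> \<Longrightarrow> grad \<phi> x = 0"
    "pd i \<phi> \<in> test_functions \<Omega>"
proof -
  have a: "Cinf_on UNIV \<phi>" "compact (closure {x. \<phi> x \<noteq> 0})" "closure {x. \<phi> x \<noteq> 0} \<subseteq> \<Omega>"
    using assms by (auto simp: test_functions_def)
  show "Ck_on 1 UNIV \<phi>" using Cinf_onD(2)[OF a(1)] .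
  show "bounded {x. \<phi> x \<noteq> 0}" by (rule bounded_subset[OF compact_imp_bounded[OF a(2)] closure_subset])
  show "x \<notin> \<Omega> \<Longrightarrow> \<phi> x = 0" using order_trans[OF closure_subset a(3)] by auto
  have s: "closure {x. pd i \<phi> x \<noteq> 0} \<subseteq> \<Omega>" for i using pd_support a(3) by (rule order_trans)
  show "x \<notin> \<Omega> \<Longrightarrow> grad \<phi> x = 0" using order_trans[OF closure_subset s] by (auto simp: grad_def vec_eq_iff)
  have "compact (closure {x. pd i \<phi> x \<noteq> 0})"
    using compact_Int_closed[OF a(2) closed_closure[of "{x. pd i \<phi> x \<noteq> 0}"]] pd_support[of i \<phi>] by (simp add: inf_absorb2)
  then show "pd i \<phi> \<in> test_functions \<Omega>" using s Cinf_onD(1)[OF a(1)] by (simp add: test_functions_def)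
qed

lemma continuous_support_L2_on:
  fixes f :: "real^'n \<Rightarrow> 'b::euclidean_space"
  assumes U: "open U" and c: "continuous_on UNIV f" and b: "bounded {x. f x \<noteq> 0}" and z: "\<And>x. x \<notin> U \<Longrightarrow> f x = 0"
  shows "L2_on U f"
proof -
  have m: "f \<in> borel_measurable borel" using c by (rule borel_measurable_continuous_onI)
  have c2: "continuous_on UNIV (\<lambda>x. (norm (f x))\<^sup>2)" by (intro continuous_intros c)
  have "integrable lborel (\<lambda>x. (norm (f x))\<^sup>2)"
    by (rule continuous_bounded_support(1)[OF c2]) (use b in simp)
  then have "integrable (lebesgue_on U) (\<lambda>x. (norm (f x))\<^sup>2)"
    by (subst lebesgue_on_lborel(2)[OF U borel_measurable_continuous_onI[OF c2]]) (use z in simp_all)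
  then show ?thesis using lebesgue_on_lborel(3)[OF U m z] by (simp add: L2_on_def)
qed

lemma test_has_weak_gradient:
  fixes \<phi> :: "real^'n \<Rightarrow> real"
  assumes U: "open \<Omega>" and t: "\<phi> \<in> test_functions \<Omega>"
  shows "has_weak_gradient \<Omega> \<phi> (grad \<phi>)"
proof -
  note T = test_functionsD[OF t]
  have "(LINT x|lebesgue_on \<Omega>. \<phi> x * pd i \<psi> x) = - (LINT x|lebesgue_on \<Omega>. grad \<phi> x $ i * \<psi> x)"
    if p: "\<psi> \<in> test_functions \<Omega>" for \<psi> i
  proof -
    note P = test_functionsD[OF p]
    have c1: "continuous_on UNIV (\<lambda>x. \<phi> x * pd i \<psi> x)" and c2: "continuous_on UNIV (\<lambda>x. pd i \<phi> x * \<psi> x)"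
      by (intro continuous_intros Ck_on_1D[OF T(1)] Ck_on_1D[OF P(1)])+
    have b1: "bounded {x. \<phi> x * pd i \<psi> x \<noteq> 0}" and b2: "bounded {x. pd i \<phi> x * \<psi> x \<noteq> 0}"
      by (rule bounded_subset[OF T(2)]; auto) (rule bounded_subset[OF P(2)]; auto)
    have b3: "bounded {x. \<phi> x * \<psi> x \<noteq> 0}" by (rule bounded_subset[OF T(2)]) auto
    note i1 = continuous_bounded_support(1)[OF c1 b1] and i2 = continuous_bounded_support(1)[OF c2 b2]
    have "0 = (LINT x|lborel. pd i (\<lambda>x. \<phi> x * \<psi> x) x)"
      by (rule integral_pd_eq_0[OF Ck_on_1_mult[OF T(1) P(1)] b3, symmetric])
    also have "\<dots> = (LINT x|lborel. pd i \<phi> x * \<psi> x + \<phi> x * pd i \<psi> x)"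
      by (subst pd_mult) (use Ck_on_1D(1)[OF T(1)] Ck_on_1D(1)[OF P(1)] in auto)
    also have "\<dots> = (LINT x|lborel. pd i \<phi> x * \<psi> x) + (LINT x|lborel. \<phi> x * pd i \<psi> x)"
      by (rule Bochner_Integration.integral_add[OF i2 i1])
    finally have e: "(LINT x|lborel. \<phi> x * pd i \<psi> x) = - (LINT x|lborel. pd i \<phi> x * \<psi> x)" by simp
    have "(LINT x|lebesgue_on \<Omega>. \<phi> x * pd i \<psi> x) = (LINT x|lborel. \<phi> x * pd i \<psi> x)"
      by (rule lebesgue_on_lborel(1)[OF U borel_measurable_continuous_onI[OF c1]]) (simp add: T(3))
    moreover have "(LINT x|lebesgue_on \<Omega>. pd i \<phi> x * \<psi> x) = (LINT x|lborel. pd i \<phi> x * \<psi> x)"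
      by (rule lebesgue_on_lborel(1)[OF U borel_measurable_continuous_onI[OF c2]]) (simp add: P(3))
    ultimately show ?thesis using e by (simp add: grad_def)
  qed
  moreover have "L2_on \<Omega> \<phi>" by (rule continuous_support_L2_on[OF U Ck_on_1D(3)[OF T(1)] T(2,3)])
  moreover have "L2_on \<Omega> (grad \<phi>)"
    by (rule continuous_support_L2_on[OF U Ck_on_1D(4)[OF T(1)] bounded_grad_support[OF T(2)] T(4)])
  ultimately show ?thesis by (simp add: has_weak_gradient_def)
qed

lemma test_in_H10:
  assumes U: "open \<Omega>" and t: "\<phi> \<in> test_functions \<Omega>"
  shows "\<phi> \<in> H10 \<Omega>"
proof -
  have "(\<lambda>k::nat. LINT x|lebesgue_on \<Omega>. (\<phi> x - \<phi> x)\<^sup>2 + (norm (grad \<phi> x - grad \<phi> x))\<^sup>2) \<longlonglongrightarrow> 0" by simp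
  then show ?thesis unfolding H10_def mem_Collect_eq using test_has_weak_gradient[OF U t] t
    by (intro exI[of _ "grad \<phi>"] conjI exI[of _ "\<lambda>_. \<phi>"]) auto
qed

lemma Lambda_le_test:
  fixes \<phi> :: "real^'n \<Rightarrow> real"
  assumes U: "open \<Omega>" and t: "\<phi> \<in> test_functions \<Omega>" and s: "0 < s"
  shows "Lambda \<Omega> s * (LINT x|lborel. \<bar>\<phi> x\<bar> powr s) powr (2 / s) \<le> (LINT x|lborel. (norm (grad \<phi> x))\<^sup>2)"
proof -
  note T = test_functionsD[OF t]
  have cg: "continuous_on UNIV (\<lambda>x. (norm (grad \<phi> x))\<^sup>2)" by (intro continuous_intros Ck_on_1D(4)[OF T(1)])
  have cp: "continuous_on UNIV (\<lambda>x. \<bar>\<phi> x\<bar> powr s)"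
    using s by (intro continuous_on_powr' continuous_intros Ck_on_1D(3)[OF T(1)]) auto
  have eg: "(LINT x|lebesgue_on \<Omega>. (norm (grad \<phi> x))\<^sup>2) = (LINT x|lborel. (norm (grad \<phi> x))\<^sup>2)"
    by (rule lebesgue_on_lborel(1)[OF U borel_measurable_continuous_onI[OF cg]]) (simp add: T(4))
  have ep: "(LINT x|lebesgue_on \<Omega>. \<bar>\<phi> x\<bar> powr s) = (LINT x|lborel. \<bar>\<phi> x\<bar> powr s)"
    by (rule lebesgue_on_lborel(1)[OF U borel_measurable_continuous_onI[OF cp]]) (simp add: T(3))
  have ip: "integrable (lebesgue_on \<Omega>) (\<lambda>x. \<bar>\<phi> x\<bar> powr s)"
    by (subst lebesgue_on_lborel(2)[OF U borel_measurable_continuous_onI[OF cp]])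
      (use T in \<open>auto intro!: continuous_bounded_support(1)[OF cp]\<close>)
  let ?P = "LINT x|lborel. \<bar>\<phi> x\<bar> powr s"
  show ?thesis
  \<comment> \<open>If the power integral is zero, the left side vanishes because
    \<open>0 powr (2 / s) = 0\<close>. Otherwise \<phi> is a competitor in the infimum.\<close>
  proof (cases "?P = 0")
    case True
    then show ?thesis by simp
  next
    case False
    moreover have "0 \<le> ?P" by (intro integral_nonneg_AE AE_I2) simp
    ultimately have P: "?P > 0" by (simp add: less_le)
    have nz: "\<not> (AE x in lebesgue_on \<Omega>. \<phi> x = 0)"
    proof
      assume "AE x in lebesgue_on \<Omega>. \<phi> x = 0"
      then have "AE x in lebesgue_on \<Omega>. \<bar>\<phi> x\<bar> powr s = 0" by auto
      then have "(LINT x|lebesgue_on \<Omega>. \<bar>\<phi> x\<bar> powr s) = 0"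
        using integral_nonneg_eq_0_iff_AE[OF ip] by auto
      then show False using ep False by simp
    qed
    have "Lambda \<Omega> s \<le> (LINT x|lborel. (norm (grad \<phi> x))\<^sup>2) / ?P powr (2 / s)"
      unfolding Lambda_def
    proof (rule cInf_lower)
      show "(LINT x|lborel. (norm (grad \<phi> x))\<^sup>2) / ?P powr (2 / s) \<in> {(LINT x|lebesgue_on \<Omega>. (norm (G x))\<^sup>2) /
          (LINT x|lebesgue_on \<Omega>. \<bar>w x\<bar> powr s) powr (2 / s) | w G.
          w \<in> H10 \<Omega> \<and> \<not> (AE x in lebesgue_on \<Omega>. w x = 0) \<and> has_weak_gradient \<Omega> w G}"
        unfolding eg[symmetric] ep[symmetric] using test_in_H10[OF U t] nz test_has_weak_gradient[OF U t] by blast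
      show "bdd_below {(LINT x|lebesgue_on \<Omega>. (norm (G x))\<^sup>2) /
          (LINT x|lebesgue_on \<Omega>. \<bar>w x\<bar> powr s) powr (2 / s) | w G.
          w \<in> H10 \<Omega> \<and> \<not> (AE x in lebesgue_on \<Omega>. w x = 0) \<and> has_weak_gradient \<Omega> w G}"
        by (rule bdd_belowI[of _ 0]) (auto intro!: divide_nonneg_nonneg integral_nonneg_AE)
    qed
    then show ?thesis using P by (simp add: pos_le_divide_eq)
  qed
qed

text \<open>Provides a member of the set whose infimum is \<open>Lambda\<close>; the infimum of an
  empty set would carry no information.\<close>

lemma exists_test_function:
  fixes \<Omega> :: "(real^'n) set"
  assumes U: "open \<Omega>" "x0 \<in> \<Omega>"
  obtains \<phi> where "\<phi> \<in> test_functions \<Omega>" "\<phi> x0 > 0" "\<And>x. 0 \<le> \<phi> x"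
proof -
  obtain d where d: "d > 0" "cball x0 d \<subseteq> \<Omega>" using U open_contains_cball by blast
  obtain q :: "real^'n \<Rightarrow> real" where q: "bump_algebra d q" "\<And>y. 0 \<le> q y" "q 0 > 0"
    "\<And>y. q y \<noteq> 0 \<Longrightarrow> norm y < d" using exists_mollifier[OF d(1)] by metis
  define \<phi> where "\<phi> x = q (x + - x0)" for x
  have "Cinf_on UNIV \<phi>"
  proof (rule Cinf_on_coinduct[where P="\<lambda>f. \<exists>g. bump_algebra d g \<and> f = (\<lambda>x. g (x + - x0))"])
    show "\<exists>g. bump_algebra d g \<and> \<phi> = (\<lambda>x. g (x + - x0))" using q(1) by (auto simp: \<phi>_def[abs_def])
    show "f differentiable (at x)" if "\<exists>g. bump_algebra d g \<and> f = (\<lambda>x. g (x + - x0))" for f x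
      using that pd_shift(2)[OF bump_algebra_pd(1)] by blast
    show "\<exists>g. bump_algebra d g \<and> pd i f = (\<lambda>x. g (x + - x0))" if f: "\<exists>g. bump_algebra d g \<and> f = (\<lambda>x. g (x + - x0))" for f i
    proof -
      obtain g where g: "bump_algebra d g" "f = (\<lambda>x. g (x + - x0))" using f by blast
      have "pd i f = (\<lambda>x. pd i g (x + - x0))" unfolding g(2) by (rule ext) (rule pd_shift(1)[OF bump_algebra_pd(1)[OF g(1)]])
      then show ?thesis using bump_algebra_pd(2)[OF g(1)] by blast
    qed
  qed
  moreover have cs: "closure {x. \<phi> x \<noteq> 0} \<subseteq> cball x0 d"
  proof (rule closure_minimal)
    show "{x. \<phi> x \<noteq> 0} \<subseteq> cball x0 d"
    proof
      fix x assume "x \<in> {x. \<phi> x \<noteq> 0}"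
      then have "norm (x + - x0) < d" using q(4)[of "x + - x0"] by (simp add: \<phi>_def)
      then show "x \<in> cball x0 d" by (simp add: dist_norm norm_minus_commute)
    qed
  qed simp
  moreover have "compact (closure {x. \<phi> x \<noteq> 0})"
    using compact_Int_closed[OF compact_cball[of x0 d] closed_closure[of "{x. \<phi> x \<noteq> 0}"]] cs by (simp add: inf_absorb2)
  ultimately have "\<phi> \<in> test_functions \<Omega>" using d(2) unfolding test_functions_def by blast
  then show ?thesis using that q by (auto simp: \<phi>_def)
qed

section \<open>From test functions to all of \<open>H10\<close>\<close>

lemma L2_on_diff:
  fixes f g :: "real^'n \<Rightarrow> 'b::euclidean_space"
  assumes f: "L2_on U f" and g: "L2_on U g"
  shows "integrable (lebesgue_on U) (\<lambda>x. (norm (f x - g x))\<^sup>2)" "integrable (lebesgue_on U) (\<lambda>x. f x \<bullet> g x)"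
proof -
  let ?M = "lebesgue_on U"
  have [measurable]: "f \<in> borel_measurable ?M" "g \<in> borel_measurable ?M"
    and i: "integrable ?M (\<lambda>x. (norm (f x))\<^sup>2)" "integrable ?M (\<lambda>x. (norm (g x))\<^sup>2)"
    using f g by (auto simp: L2_on_def)
  have d: "integrable ?M (\<lambda>x. 2 * (norm (f x))\<^sup>2 + 2 * (norm (g x))\<^sup>2)" using i by simp
  have 1: "norm (a - b) ^ 2 \<le> 2 * (norm a)\<^sup>2 + 2 * (norm b)\<^sup>2" "\<bar>a \<bullet> b\<bar> \<le> 2 * (norm a)\<^sup>2 + 2 * (norm b)\<^sup>2" for a b :: 'b
  proof -
    have "(norm (a - b))\<^sup>2 \<le> (norm a + norm b)\<^sup>2" by (intro power_mono norm_triangle_ineq4) auto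
    also have "\<dots> \<le> 2 * (norm a)\<^sup>2 + 2 * (norm b)\<^sup>2"
      using zero_le_power2[of "norm a - norm b"] unfolding power2_diff power2_sum by linarith
    finally show "norm (a - b) ^ 2 \<le> 2 * (norm a)\<^sup>2 + 2 * (norm b)\<^sup>2" .
    have "\<bar>a \<bullet> b\<bar> \<le> norm a * norm b" by (rule Cauchy_Schwarz_ineq2)
    also have "\<dots> \<le> 2 * (norm a)\<^sup>2 + 2 * (norm b)\<^sup>2"
      using zero_le_power2[of "norm a - norm b"] zero_le_power2[of "norm a"] zero_le_power2[of "norm b"] unfolding power2_diff by linarith
    finally show "\<bar>a \<bullet> b\<bar> \<le> 2 * (norm a)\<^sup>2 + 2 * (norm b)\<^sup>2" .
  qed
  show "integrable ?M (\<lambda>x. (norm (f x - g x))\<^sup>2)"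
    by (rule Bochner_Integration.integrable_bound[OF d]) (use 1(1) in \<open>auto intro!: AE_I2\<close>)
  show "integrable ?M (\<lambda>x. f x \<bullet> g x)"
    by (rule Bochner_Integration.integrable_bound[OF d]) (use 1(2) in \<open>auto intro!: AE_I2\<close>)
qed

lemma L2_on_component:
  fixes G :: "real^'n \<Rightarrow> real^'m"
  shows "L2_on U G \<Longrightarrow> L2_on U (\<lambda>x. G x $ i)"
  unfolding L2_on_def
proof (elim conjE, intro conjI)
  assume m: "G \<in> borel_measurable (lebesgue_on U)" and i: "integrable (lebesgue_on U) (\<lambda>x. (norm (G x))\<^sup>2)"
  have "(\<lambda>x. G x \<bullet> axis i 1) \<in> borel_measurable (lebesgue_on U)" using m by measurable
  then show m': "(\<lambda>x. G x $ i) \<in> borel_measurable (lebesgue_on U)" by (simp add: inner_axis)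
  show "integrable (lebesgue_on U) (\<lambda>x. (norm (G x $ i))\<^sup>2)"
    by (rule Bochner_Integration.integrable_bound[OF i])
      (use m' power_mono[OF component_le_norm_cart abs_ge_zero, where n=2] in \<open>auto intro!: AE_I2\<close>)
qed

text \<open>The Sobolev inequality for test functions survives the limit defining
  \<open>H10\<close>: a subsequence converges almost everywhere, and Fatou's lemma transfers the
  bound on the integral of \<bar>w\<bar>^(2p). Lower semicontinuity is the right direction here,
  since that integral stands in the denominator.\<close>

lemma Lambda_pos:
  fixes \<Omega> :: "(real^'n) set"
  assumes N: "CARD('n) \<ge> 2" and U: "open \<Omega>" "bounded \<Omega>" "\<Omega> \<noteq> {}"
    and p: "1 < p" "p * (real CARD('n) - 2) < real CARD('n)"
  shows "Lambda \<Omega> (2 * p) > 0"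
proof -
  let ?M = "lebesgue_on \<Omega>"
  obtain R where R: "R > 0" "\<Omega> \<subseteq> cball 0 R"
    using U(2) bounded_subset_ballD[of \<Omega> 0] ball_subset_cball by (metis order_trans)
  obtain C where C: "C > 0" and Sob: "\<And>f :: real^'n \<Rightarrow> real. Ck_on 1 UNIV f \<Longrightarrow> closure {x. f x \<noteq> 0} \<subseteq> cball 0 R \<Longrightarrow>
      (LINT x|lborel. \<bar>f x\<bar> powr (2 * p)) \<le> C * (LINT x|lborel. (norm (grad f x))\<^sup>2) powr p"
    using subcritical_Sobolev[OF N p R(1)] by metis
  have p0: "0 < p" "0 < 2 * p" using p by auto
  \<comment> \<open>The factor 2 pays for \<open>X k \<le> 4 * e k + 2 * Y\<close> below; any
    positive constant serves.\<close>
  define c where "c = 1 / (2 * C powr (1 / p))"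
  have c: "c > 0" using C by (simp add: c_def)
  have lower: "c \<le> (LINT x|?M. (norm (G x))\<^sup>2) / (LINT x|?M. \<bar>w x\<bar> powr (2 * p)) powr (2 / (2 * p))"
    if w: "w \<in> H10 \<Omega>" and nz: "\<not> (AE x in ?M. w x = 0)" and G: "has_weak_gradient \<Omega> w G" for w G
  proof -
    obtain G0 \<phi> where G0: "has_weak_gradient \<Omega> w G0" and \<phi>: "\<And>k::nat. \<phi> k \<in> test_functions \<Omega>"
      and lim: "(\<lambda>k. LINT x|?M. (\<phi> k x - w x)\<^sup>2 + (norm (grad (\<phi> k) x - G0 x))\<^sup>2) \<longlonglongrightarrow> 0"
      using w unfolding H10_def by blast
    define u where "u k x = (\<phi> k x - w x)\<^sup>2 + (norm (grad (\<phi> k) x - G0 x))\<^sup>2" for k x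
    have L: "L2_on \<Omega> w" "L2_on \<Omega> G" "L2_on \<Omega> G0" using G G0 by (auto simp: has_weak_gradient_def)
    have L\<phi>: "L2_on \<Omega> (\<phi> k)" "L2_on \<Omega> (grad (\<phi> k))" for k
      using test_has_weak_gradient[OF U(1) \<phi>] by (auto simp: has_weak_gradient_def)
    have ui: "integrable ?M (u k)" for k
      unfolding u_def using L2_on_diff(1)[OF L\<phi>(1) L(1)] L2_on_diff(1)[OF L\<phi>(2) L(3)] by simp
    have un: "0 \<le> u k x" for k x by (simp add: u_def)
    define e where "e k = (LINT x|?M. u k x)" for k
    have "e = (\<lambda>k. LINT x|?M. (\<phi> k x - w x)\<^sup>2 + (norm (grad (\<phi> k) x - G0 x))\<^sup>2)"
      by (rule ext) (simp add: e_def u_def)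
    with lim have e: "e \<longlonglongrightarrow> 0" by simp
    then have "(\<lambda>k. LINT x|?M. norm (u k x)) \<longlonglongrightarrow> 0" using un by (simp add: e_def[abs_def])
    from tendsto_L1_AE_subseq[OF ui this] obtain r :: "nat \<Rightarrow> nat"
      where r: "strict_mono r" "AE x in ?M. (\<lambda>k. u (r k) x) \<longlonglongrightarrow> 0" by blast
    have ae: "AE x in ?M. (\<lambda>k. \<phi> (r k) x) \<longlonglongrightarrow> w x"
      using r(2)
    proof (rule AE_mp[OF _ AE_I2], intro impI)
      fix x assume "(\<lambda>k. u (r k) x) \<longlonglongrightarrow> 0"
      then have "(\<lambda>k. (\<phi> (r k) x - w x)\<^sup>2) \<longlonglongrightarrow> 0"
        by (rule tendsto_sandwich[OF _ _ tendsto_const, rotated 2]) (auto simp: u_def)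
      then have "(\<lambda>k. sqrt ((\<phi> (r k) x - w x)\<^sup>2)) \<longlonglongrightarrow> sqrt 0" by (rule tendsto_real_sqrt)
      then show "(\<lambda>k. \<phi> (r k) x) \<longlonglongrightarrow> w x" by (simp add: tendsto_rabs_zero_iff LIM_zero_iff)
    qed
    define Y where "Y = (LINT x|?M. (norm (G x))\<^sup>2)"
    define X where "X k = (LINT x|?M. (norm (grad (\<phi> k) x))\<^sup>2)" for k
    have Y0: "0 \<le> Y" unfolding Y_def by (intro integral_nonneg_AE AE_I2) simp
    have X: "0 \<le> X k" "X k \<le> 4 * e k + 2 * Y" for k
    proof -
      show "0 \<le> X k" unfolding X_def by (intro integral_nonneg_AE AE_I2) simp
      have Li: "integrable ?M (\<lambda>x. (norm (G x))\<^sup>2)" using L(2) by (simp add: L2_on_def)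
      have Lp: "integrable ?M (\<lambda>x. (norm (grad (\<phi> k) x))\<^sup>2)" using L\<phi>(2) by (simp add: L2_on_def)
      \<comment> \<open>Testing both weak gradients of \<open>w\<close> against \<open>\<partial>\<^sub>i \<phi>\<close> makes their a.e. uniqueness unnecessary.\<close>
      have same: "(LINT x|?M. G x \<bullet> grad (\<phi> k) x) = (LINT x|?M. G0 x \<bullet> grad (\<phi> k) x)"
      proof -
        have "(LINT x|?M. H x \<bullet> grad (\<phi> k) x) = - (\<Sum>i\<in>UNIV. LINT x|?M. w x * pd i (pd i (\<phi> k)) x)"
          if H: "has_weak_gradient \<Omega> w H" for H
        proof -
          have "integrable ?M (\<lambda>x. H x $ i * pd i (\<phi> k) x)" for i
            using L2_on_diff(2)[OF L2_on_component[of \<Omega> H i] L2_on_component[OF L\<phi>(2), of k i]] H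
            by (simp add: has_weak_gradient_def grad_def)
          then have "(LINT x|?M. H x \<bullet> grad (\<phi> k) x) = (\<Sum>i\<in>UNIV. LINT x|?M. H x $ i * pd i (\<phi> k) x)"
            by (simp add: inner_vec_def grad_def)
          also have "\<dots> = (\<Sum>i\<in>UNIV. - (LINT x|?M. w x * pd i (pd i (\<phi> k)) x))"
            using H test_functionsD(5)[OF \<phi>[of k]] by (intro sum.cong) (auto simp: has_weak_gradient_def)
          finally show ?thesis by (simp add: sum_negf)
        qed
        then show ?thesis using G G0 by simp
      qed
      have i1: "integrable ?M (\<lambda>x. G x \<bullet> grad (\<phi> k) x)" "integrable ?M (\<lambda>x. G0 x \<bullet> grad (\<phi> k) x)"
        using L2_on_diff(2)[OF _ L\<phi>(2)] L by auto
      \<comment> \<open>Used with a = grad \<phi>, b = \<open>G0\<close>, d = \<open>G\<close>.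
        Write a \<bullet> a = (a - b) \<bullet> a + d \<bullet> a + (b \<bullet> a - d \<bullet> a)
        and absorb \<bar>a\<bar>^2 / 4 from each of the first two terms; the last bracket integrates
        to zero by \<open>same\<close>.\<close>
      have pw: "(norm a)\<^sup>2 \<le> 4 * (norm (a - b))\<^sup>2 + 2 * (norm d)\<^sup>2 + 2 * (b \<bullet> a - d \<bullet> a)" for a b d :: "real^'n"
      proof -
        have "0 \<le> (norm ((a - b) - (1/2) *\<^sub>R a))\<^sup>2" "0 \<le> (norm (d - (1/2) *\<^sub>R a))\<^sup>2" "0 \<le> (norm (a - b))\<^sup>2"
          by simp_all
        then show ?thesis
          unfolding power2_norm_eq_inner by (simp add: inner_diff_left inner_diff_right inner_commute algebra_simps)
      qed
      have "X k \<le> (LINT x|?M. 4 * (norm (grad (\<phi> k) x - G0 x))\<^sup>2 + 2 * (norm (G x))\<^sup>2 + 2 * (G0 x \<bullet> grad (\<phi> k) x - G x \<bullet> grad (\<phi> k) x))"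
        unfolding X_def using pw Lp Li i1 L2_on_diff(1)[OF L\<phi>(2) L(3)] by (intro integral_mono) auto
      also have "\<dots> = 4 * (LINT x|?M. (norm (grad (\<phi> k) x - G0 x))\<^sup>2) + 2 * Y"
        using Li i1 L2_on_diff(1)[OF L\<phi>(2) L(3)] same by (simp add: Y_def)
      also have "(LINT x|?M. (norm (grad (\<phi> k) x - G0 x))\<^sup>2) \<le> e k"
        unfolding e_def using ui L2_on_diff(1)[OF L\<phi>(2) L(3)] by (intro integral_mono) (auto simp: u_def)
      finally show "X k \<le> 4 * e k + 2 * Y" by simp
    qed
    have [measurable]: "w \<in> borel_measurable ?M" "\<phi> k \<in> borel_measurable ?M" for k
      using L L\<phi> by (auto simp: L2_on_def)
    have fin: "(\<integral>\<^sup>+x. ennreal (\<bar>\<phi> k x\<bar> powr (2 * p)) \<partial>?M) \<le> ennreal (C * (4 * e k + 2 * Y) powr p)" for k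
    proof -
      note T = test_functionsD[OF \<phi>[of k]]
      have cp: "continuous_on UNIV (\<lambda>x. \<bar>\<phi> k x\<bar> powr (2 * p))"
        using p0 by (intro continuous_on_powr' continuous_intros Ck_on_1D(3)[OF T(1)]) auto
      have cg: "continuous_on UNIV (\<lambda>x. (norm (grad (\<phi> k) x))\<^sup>2)" by (intro continuous_intros Ck_on_1D(4)[OF T(1)])
      have ep: "(LINT x|?M. \<bar>\<phi> k x\<bar> powr (2 * p)) = (LINT x|lborel. \<bar>\<phi> k x\<bar> powr (2 * p))"
        by (rule lebesgue_on_lborel(1)[OF U(1) borel_measurable_continuous_onI[OF cp]]) (simp add: T(3))
      have eg: "X k = (LINT x|lborel. (norm (grad (\<phi> k) x))\<^sup>2)"
        unfolding X_def by (rule lebesgue_on_lborel(1)[OF U(1) borel_measurable_continuous_onI[OF cg]]) (simp add: T(4))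
      have ip: "integrable ?M (\<lambda>x. \<bar>\<phi> k x\<bar> powr (2 * p))"
        by (subst lebesgue_on_lborel(2)[OF U(1) borel_measurable_continuous_onI[OF cp]])
          (use T in \<open>auto intro!: continuous_bounded_support(1)[OF cp]\<close>)
      have "closure {x. \<phi> k x \<noteq> 0} \<subseteq> cball 0 R" using \<phi>[of k] R(2) by (auto simp: test_functions_def)
      from Sob[OF T(1) this] have "(LINT x|?M. \<bar>\<phi> k x\<bar> powr (2 * p)) \<le> C * X k powr p" by (simp add: ep eg)
      also have "\<dots> \<le> C * (4 * e k + 2 * Y) powr p"
        using C X[of k] p0 by (intro mult_left_mono powr_mono2) auto
      finally show ?thesis using ip by (subst nn_integral_eq_integral) (auto intro: ennreal_leI)
    qed
    have "(\<integral>\<^sup>+x. ennreal (\<bar>w x\<bar> powr (2 * p)) \<partial>?M) = (\<integral>\<^sup>+x. liminf (\<lambda>k. ennreal (\<bar>\<phi> (r k) x\<bar> powr (2 * p))) \<partial>?M)"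
    proof (rule nn_integral_cong_AE, rule AE_mp[OF ae AE_I2], intro impI)
      fix x assume "(\<lambda>k. \<phi> (r k) x) \<longlonglongrightarrow> w x"
      then have "(\<lambda>k. \<bar>\<phi> (r k) x\<bar> powr (2 * p)) \<longlonglongrightarrow> \<bar>w x\<bar> powr (2 * p)"
        using p0 by (intro tendsto_powr' tendsto_intros) auto
      then have "(\<lambda>k. ennreal (\<bar>\<phi> (r k) x\<bar> powr (2 * p))) \<longlonglongrightarrow> ennreal (\<bar>w x\<bar> powr (2 * p))" by simp
      then show "ennreal (\<bar>w x\<bar> powr (2 * p)) = liminf (\<lambda>k. ennreal (\<bar>\<phi> (r k) x\<bar> powr (2 * p)))"
        by (intro lim_imp_Liminf[symmetric]) auto
    qed
    also have "\<dots> \<le> liminf (\<lambda>k. \<integral>\<^sup>+x. ennreal (\<bar>\<phi> (r k) x\<bar> powr (2 * p)) \<partial>?M)"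
      by (rule nn_integral_liminf) measurable
    also have "\<dots> \<le> liminf (\<lambda>k. ennreal (C * (4 * e (r k) + 2 * Y) powr p))"
      by (rule Liminf_mono) (use fin in auto)
    also have "\<dots> = ennreal (C * (4 * 0 + 2 * Y) powr p)"
    proof (rule lim_imp_Liminf)
      have nn: "0 \<le> 4 * e k + 2 * Y" for k using X[of k] by linarith
      have "(\<lambda>k. e (r k)) \<longlonglongrightarrow> 0" using LIMSEQ_subseq_LIMSEQ[OF e r(1)] by (simp add: o_def)
      then show "(\<lambda>k. ennreal (C * (4 * e (r k) + 2 * Y) powr p)) \<longlonglongrightarrow> ennreal (C * (4 * 0 + 2 * Y) powr p)"
        using p0 nn by (intro tendsto_ennrealI tendsto_mult tendsto_powr' tendsto_intros) auto
    qed simp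
    finally have bound: "(\<integral>\<^sup>+x. ennreal (\<bar>w x\<bar> powr (2 * p)) \<partial>?M) \<le> ennreal (C * (2 * Y) powr p)"
      by (simp only: mult_zero_right add_0_left)
    \<comment> \<open>Without integrability the Bochner integral would be 0 and the quotient 0,
      which would defeat the lower bound.\<close>
    have wi: "integrable ?M (\<lambda>x. \<bar>w x\<bar> powr (2 * p))"
    proof (rule integrableI_bounded)
      show "(\<integral>\<^sup>+x. ennreal (norm (\<bar>w x\<bar> powr (2 * p))) \<partial>?M) < \<infinity>"
        using le_less_trans[OF bound ennreal_less_top] by simp
    qed measurable
    define W where "W = (LINT x|?M. \<bar>w x\<bar> powr (2 * p))"
    have Wle: "W \<le> C * (2 * Y) powr p"
      using bound wi C by (subst (asm) nn_integral_eq_integral) (auto simp: W_def ennreal_le_iff)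
    have "W \<noteq> 0"
    proof
      assume "W = 0"
      then have "AE x in ?M. \<bar>w x\<bar> powr (2 * p) = 0"
        using integral_nonneg_eq_0_iff_AE[OF wi] by (simp add: W_def)
      then show False using nz by simp
    qed
    moreover have "0 \<le> W" unfolding W_def by (intro integral_nonneg_AE AE_I2) simp
    ultimately have W0: "0 < W" by simp
    have "W powr (1 / p) \<le> (C * (2 * Y) powr p) powr (1 / p)" using Wle W0 p0 by (intro powr_mono2) auto
    also have "\<dots> = C powr (1 / p) * (2 * Y)" using C Y0 p0 by (simp add: powr_mult powr_powr)
    finally have "c * W powr (1 / p) \<le> Y" using C by (simp add: c_def pos_divide_le_eq mult.commute)
    then have "c \<le> Y / W powr (1 / p)" using W0 by (simp add: pos_le_divide_eq)
    then show ?thesis using p0 by (simp add: Y_def W_def)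
  qed
  obtain x0 where x0: "x0 \<in> \<Omega>" using U(3) by blast
  obtain \<phi> where \<phi>: "\<phi> \<in> test_functions \<Omega>" "\<phi> x0 > 0" "\<And>x. 0 \<le> \<phi> x" using exists_test_function[OF U(1) x0] by metis
  have nz: "\<not> (AE x in ?M. \<phi> x = 0)"
  proof
    assume "AE x in ?M. \<phi> x = 0"
    then have z: "(LINT x|?M. \<phi> x) = 0" by (rule integral_eq_zero_AE)
    note T = test_functionsD[OF \<phi>(1)] and c = Ck_on_1D(3)[OF test_functionsD(1)[OF \<phi>(1)]]
    have "(LINT x|?M. \<phi> x) = (LINT x|lborel. \<phi> x)"
      by (rule lebesgue_on_lborel(1)[OF U(1) borel_measurable_continuous_onI[OF c] T(3)])
    moreover have "0 < (LINT x|lborel. \<phi> x)"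
      by (rule continuous_integral_pos[OF c continuous_bounded_support(1)[OF c T(2)] \<phi>(3,2)])
    ultimately show False using z by simp
  qed
  have "c \<le> Lambda \<Omega> (2 * p)"
    unfolding Lambda_def
  proof (rule cInf_greatest)
    show "{(LINT x|?M. (norm (G x))\<^sup>2) / (LINT x|?M. \<bar>w x\<bar> powr (2 * p)) powr (2 / (2 * p)) | w G.
          w \<in> H10 \<Omega> \<and> \<not> (AE x in ?M. w x = 0) \<and> has_weak_gradient \<Omega> w G} \<noteq> {}"
      using test_in_H10[OF U(1) \<phi>(1)] nz test_has_weak_gradient[OF U(1) \<phi>(1)] by blast
  qed (use lower in blast)
  then show ?thesis using c by simp
qed

section \<open>Solutions with nonpositive \<open>\<alpha>\<close>\<close>

text \<open>The truncated solution is only C^1, so it is no test function itself. Mollification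
  approximates it and its gradient uniformly, with all supports in the bounded set \<Omega>, so
  constants on \<Omega> dominate and both integrals converge.\<close>

lemma Lambda_le_C1:
  fixes w :: "real^'n \<Rightarrow> real"
  assumes U: "open \<Omega>" "bounded \<Omega>" and w: "Ck_on 1 UNIV w" and K: "compact (closure {x. w x \<noteq> 0})" "closure {x. w x \<noteq> 0} \<subseteq> \<Omega>"
    and s: "0 < s"
  shows "Lambda \<Omega> s * (LINT x|lborel. \<bar>w x\<bar> powr s) powr (2 / s) \<le> (LINT x|lborel. (norm (grad w x))\<^sup>2)"
proof -
  have b: "bounded {x. w x \<noteq> 0}" by (rule bounded_subset[OF compact_imp_bounded[OF K(1)] closure_subset])
  have cw: "continuous_on UNIV w" and cg: "continuous_on UNIV (grad w)" using Ck_on_1D[OF w] by auto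
  obtain B where B: "\<And>x. \<bar>w x\<bar> \<le> B" using continuous_bounded_support(2)[OF cw b] by auto
  obtain B' where B': "\<And>x. norm (grad w x) \<le> B'" using continuous_bounded_support(2)[OF cg bounded_grad_support[OF b]] by auto
  define \<epsilon> where "\<epsilon> k = inverse (real (Suc k))" for k
  have \<epsilon>: "0 < \<epsilon> k" "\<epsilon> k \<le> 1" for k by (auto simp: \<epsilon>_def inverse_le_1_iff)
  have \<epsilon>0: "\<epsilon> \<longlonglongrightarrow> 0" unfolding \<epsilon>_def by (rule LIMSEQ_inverse_real_of_nat)
  have "\<exists>\<phi>. \<phi> \<in> test_functions \<Omega> \<and> (\<forall>x. \<bar>\<phi> x - w x\<bar> \<le> \<epsilon> k) \<and> (\<forall>x. norm (grad \<phi> x - grad w x) \<le> \<epsilon> k)" for k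
    using mollification[OF w K U(1) \<epsilon>(1)[of k]] by metis
  then obtain \<phi> where t: "\<And>k. \<phi> k \<in> test_functions \<Omega>" and a: "\<And>k x. \<bar>\<phi> k x - w x\<bar> \<le> \<epsilon> k"
    and a': "\<And>k x. norm (grad (\<phi> k) x - grad w x) \<le> \<epsilon> k" by metis
  note T = test_functionsD[OF t]
  have l: "(\<lambda>k. \<phi> k x) \<longlonglongrightarrow> w x" for x
    by (rule Lim_null[THEN iffD2], rule Lim_null_comparison[OF _ \<epsilon>0]) (use a in auto)
  have l': "(\<lambda>k. grad (\<phi> k) x) \<longlonglongrightarrow> grad w x" for x
    by (rule Lim_null[THEN iffD2], rule Lim_null_comparison[OF _ \<epsilon>0]) (use a' in auto)
  have fin: "integrable lborel (\<lambda>x. c * indicator \<Omega> x :: real)" for c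
    using U by (intro integrable_mult_right integrable_real_indicator emeasure_bounded_finite) auto
  have [measurable]: "w \<in> borel_measurable borel" "grad w \<in> borel_measurable borel"
    "\<phi> k \<in> borel_measurable borel" "grad (\<phi> k) \<in> borel_measurable borel" for k
    using cw cg Ck_on_1D[OF T(1)] by (auto intro: borel_measurable_continuous_onI)
  have L1: "(\<lambda>k. LINT x|lborel. \<bar>\<phi> k x\<bar> powr s) \<longlonglongrightarrow> (LINT x|lborel. \<bar>w x\<bar> powr s)"
  proof (rule integral_dominated_convergence[OF _ _ fin[of "(B + 1) powr s"]])
    show "AE x in lborel. (\<lambda>k. \<bar>\<phi> k x\<bar> powr s) \<longlonglongrightarrow> \<bar>w x\<bar> powr s"
      using s by (intro AE_I2 tendsto_powr' tendsto_rabs l tendsto_const) auto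
    show "AE x in lborel. norm (\<bar>\<phi> k x\<bar> powr s) \<le> (B + 1) powr s * indicator \<Omega> x" for k
    proof (rule AE_I2)
      fix x
      have "\<bar>\<phi> k x\<bar> \<le> B + 1" using a[of k x] B[of x] \<epsilon>(2)[of k] by linarith
      then have "\<bar>\<phi> k x\<bar> powr s \<le> (B + 1) powr s" using s by (intro powr_mono2) auto
      then show "norm (\<bar>\<phi> k x\<bar> powr s) \<le> (B + 1) powr s * indicator \<Omega> x"
        using T(3)[of x k] by (auto simp: indicator_def)
    qed
  qed measurable
  have L2: "(\<lambda>k. LINT x|lborel. (norm (grad (\<phi> k) x))\<^sup>2) \<longlonglongrightarrow> (LINT x|lborel. (norm (grad w x))\<^sup>2)"
  proof (rule integral_dominated_convergence[OF _ _ fin[of "(B' + 1)\<^sup>2"]])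
    show "AE x in lborel. (\<lambda>k. (norm (grad (\<phi> k) x))\<^sup>2) \<longlonglongrightarrow> (norm (grad w x))\<^sup>2"
      by (intro AE_I2 tendsto_power tendsto_norm l')
    show "AE x in lborel. norm ((norm (grad (\<phi> k) x))\<^sup>2) \<le> (B' + 1)\<^sup>2 * indicator \<Omega> x" for k
    proof (rule AE_I2)
      fix x
      have "norm (grad (\<phi> k) x) \<le> B' + 1"
        using a'[of k x] B'[of x] \<epsilon>(2)[of k] norm_triangle_sub[of "grad (\<phi> k) x" "grad w x"] by linarith
      then have "(norm (grad (\<phi> k) x))\<^sup>2 \<le> (B' + 1)\<^sup>2" by (intro power_mono) auto
      then show "norm ((norm (grad (\<phi> k) x))\<^sup>2) \<le> (B' + 1)\<^sup>2 * indicator \<Omega> x"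
        using T(4)[of x k] by (auto simp: indicator_def)
    qed
  qed measurable
  show ?thesis
  proof (rule LIMSEQ_le[OF _ L2])
    show "(\<lambda>k. Lambda \<Omega> s * (LINT x|lborel. \<bar>\<phi> k x\<bar> powr s) powr (2 / s))
      \<longlonglongrightarrow> Lambda \<Omega> s * (LINT x|lborel. \<bar>w x\<bar> powr s) powr (2 / s)"
      using s by (intro tendsto_mult tendsto_const tendsto_powr' L1)
        (auto intro!: always_eventually integral_nonneg_AE AE_I2)
    show "\<exists>N. \<forall>k\<ge>N. Lambda \<Omega> s * (LINT x|lborel. \<bar>\<phi> k x\<bar> powr s) powr (2 / s) \<le> (LINT x|lborel. (norm (grad (\<phi> k) x))\<^sup>2)"
      using Lambda_le_test[OF U(1) t s] by blast
  qed
qed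

text \<open>Being C^1 is local, and \<open>U\<close> together with the complement of
  \<open>K\<close> is an open cover of the space: on the first set the extension is
  \<open>f\<close>, on the second it is 0.\<close>

lemma extend_by_zero:
  fixes f :: "real^'n \<Rightarrow> real"
  assumes U: "open U" and K: "compact K" "K \<subseteq> U" and f: "Ck_on 1 U f" and z: "\<And>x. x \<in> U \<Longrightarrow> x \<notin> K \<Longrightarrow> f x = 0"
  defines "F \<equiv> \<lambda>x. if x \<in> U then f x else 0"
  shows "Ck_on 1 UNIV F" "pd i F x = (if x \<in> U then pd i f x else 0)" "closure {x. F x \<noteq> 0} \<subseteq> K"
proof -
  have oK: "open (- K)" using K(1) compact_imp_closed by blast
  have FK: "F x = 0" if "x \<in> - K" for x using that z by (auto simp: F_def)
  have FU: "F x = f x" if "x \<in> U" for x using that by (simp add: F_def)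
  have p1: "pd i F x = pd i f x" "F differentiable (at x)" if "x \<in> U" for i x
    using pd_cong_open(1)[OF U that FU, where i=i] pd_cong_open(2)[OF U that FU] Ck_on_1D(1)[OF f that] by auto
  have p2: "pd i F x = 0" "F differentiable (at x)" if "x \<in> - K" for i x
    using pd_cong_open(1)[OF oK that FK, where i=i] pd_cong_open(2)[OF oK that FK] by (auto simp: pd_const)
  have cov: "U \<union> - K = UNIV" using K(2) by blast
  have "continuous_on (U \<union> - K) (pd i F)" for i
  proof (rule continuous_on_open_Un[OF U oK])
    show "continuous_on U (pd i F)"
      using Ck_on_1D(2)[OF f, of i] by (subst continuous_on_cong[OF refl p1(1)])
    show "continuous_on (- K) (pd i F)"
      by (subst continuous_on_cong[OF refl p2(1)]) (auto intro: continuous_on_const)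
  qed
  then show "Ck_on 1 UNIV F" unfolding Ck_on_1_iff cov using p1(2) p2(2) K(2) by blast
  show "pd i F x = (if x \<in> U then pd i f x else 0)"
    using p1(1)[of x i] p2(1)[of x i] K(2) by (cases "x \<in> U") auto
  show "closure {x. F x \<noteq> 0} \<subseteq> K"
    by (rule closure_minimal) (use FK compact_imp_closed[OF K(1)] in auto)
qed

text \<open>With s = max 0 (z - e) this is sqrt(e^2 + s^2) - e. The shift makes it vanish up to the
  level e > 0, and the hyperbola branch makes it C^1 with slope between 0 and 1. It differs from the
  positive part by at most 2e.\<close>

definition pospart :: "real \<Rightarrow> real \<Rightarrow> real" where
  "pospart e z = sqrt (e\<^sup>2 + (max 0 (z - e))\<^sup>2) - e"

definition pospart' :: "real \<Rightarrow> real \<Rightarrow> real" where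
  "pospart' e z = max 0 (z - e) / sqrt (e\<^sup>2 + (max 0 (z - e))\<^sup>2)"

lemma DERIV_max_0_sq: "((\<lambda>t::real. (max 0 t)\<^sup>2) has_real_derivative 2 * max 0 t) (at t)"
proof (cases t "0::real" rule: linorder_cases)
  case less
  have "((\<lambda>_. 0) has_real_derivative 0) (at t)" by simp
  then have "((\<lambda>t::real. (max 0 t)\<^sup>2) has_real_derivative 0) (at t)"
    by (rule has_field_derivative_transform_within_open[where S="{..<0}"]) (use less in auto)
  with less show ?thesis by simp
next
  case greater
  have "((\<lambda>t. t\<^sup>2) has_real_derivative 2 * t) (at t)" by (auto intro!: derivative_eq_intros)
  then have "((\<lambda>t::real. (max 0 t)\<^sup>2) has_real_derivative 2 * t) (at t)"
    by (rule has_field_derivative_transform_within_open[where S="{0<..}"]) (use greater in auto)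
  with greater show ?thesis by simp
next
  case equal
  have "((\<lambda>h::real. (max 0 h)\<^sup>2 / h) \<longlongrightarrow> 0) (at 0)"
  proof (rule Lim_null_comparison)
    show "\<forall>\<^sub>F h in at 0. norm ((max 0 h)\<^sup>2 / h) \<le> \<bar>h::real\<bar>"
      by (auto simp: eventually_at_filter max_def power2_eq_square)
    show "((\<lambda>h::real. \<bar>h\<bar>) \<longlongrightarrow> 0) (at 0)" using tendsto_rabs[OF tendsto_ident_at[of "0::real" UNIV]] by simp
  qed
  then show ?thesis using equal by (simp add: DERIV_def)
qed

lemma pospart:
  assumes e: "e > 0"
  shows "(pospart e has_real_derivative pospart' e z) (at z)" "continuous_on UNIV (pospart' e)"
    "0 \<le> pospart' e z" "pospart' e z \<le> 1" "z \<le> e \<Longrightarrow> pospart e z = 0" "0 \<le> pospart e z"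
    "pospart e z \<le> max 0 z" "max 0 z - 2 * e \<le> pospart e z"
proof -
  have pos: "0 < e\<^sup>2 + (max 0 (z - e))\<^sup>2" for z using e by (simp add: add_pos_nonneg)
  have "((\<lambda>z. z - e) has_real_derivative 1) (at z)" by (auto intro!: derivative_eq_intros)
  from DERIV_chain2[OF DERIV_max_0_sq this]
  have m: "((\<lambda>z. (max 0 (z - e))\<^sup>2) has_real_derivative 2 * max 0 (z - e)) (at z)" by simp
  have "((\<lambda>z. e\<^sup>2 + (max 0 (z - e))\<^sup>2) has_real_derivative 2 * max 0 (z - e)) (at z)"
    using DERIV_add[OF DERIV_const m] by simp
  from DERIV_diff[OF DERIV_chain2[OF DERIV_real_sqrt[OF pos] this] DERIV_const]
  show "(pospart e has_real_derivative pospart' e z) (at z)"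
    by (simp add: pospart_def[abs_def] pospart'_def field_simps)
  have nz: "sqrt (e\<^sup>2 + (max 0 (z - e))\<^sup>2) \<noteq> 0" for z
    using pos[of z] by (metis less_irrefl real_sqrt_eq_0_iff)
  show "continuous_on UNIV (pospart' e)"
    unfolding pospart'_def by (intro continuous_intros) (use nz in blast)
  show "0 \<le> pospart' e z" by (simp add: pospart'_def)
  have "max 0 (z - e) = sqrt ((max 0 (z - e))\<^sup>2)" by simp
  also have "\<dots> \<le> sqrt (e\<^sup>2 + (max 0 (z - e))\<^sup>2)" by (intro real_sqrt_le_mono) simp
  finally have ge: "max 0 (z - e) \<le> sqrt (e\<^sup>2 + (max 0 (z - e))\<^sup>2)" .
  then show "pospart' e z \<le> 1" using pos[of z] by (simp add: pospart'_def pos_divide_le_eq)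
  show "z \<le> e \<Longrightarrow> pospart e z = 0" using e by (simp add: pospart_def max_absorb1)
  have "e = sqrt (e\<^sup>2)" using e by simp
  also have "\<dots> \<le> sqrt (e\<^sup>2 + (max 0 (z - e))\<^sup>2)" by (intro real_sqrt_le_mono) simp
  finally show "0 \<le> pospart e z" by (simp add: pospart_def)
  have "sqrt (e\<^sup>2 + (max 0 (z - e))\<^sup>2) \<le> sqrt ((e + max 0 (z - e))\<^sup>2)"
    using e by (intro real_sqrt_le_mono) (simp add: power2_sum)
  also have "\<dots> = e + max 0 (z - e)" using e by simp
  finally show "pospart e z \<le> max 0 z" using e by (simp add: pospart_def)
  show "max 0 z - 2 * e \<le> pospart e z" proof -
    have "max 0 z - e \<le> max 0 (z - e)" using e by auto
    then show ?thesis using ge unfolding pospart_def by linarith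
  qed
qed

lemma Lambda_threshold:
  fixes \<Omega> :: "(real^'n) set" and \<psi> :: "real^'n \<Rightarrow> real"
  assumes U: "open \<Omega>" "bounded \<Omega>" and ell: "elliptic_coeffs \<Omega> A a" and p: "1 < p"
    and adm: "admissible_nonlinearity \<Omega> p g" and sol: "is_solution r \<Omega> a g \<mu> \<alpha> \<psi>"
    and \<mu>: "0 < \<mu>" and \<alpha>: "\<alpha> \<le> 0"
  shows "A * Lambda \<Omega> (2 * p) \<le> \<mu>"
proof -
  let ?M = "lebesgue_on \<Omega>"
  have lm: "\<Omega> \<in> lmeasurable" using lmeasurable_open U by blast
  then interpret M: finite_measure ?M by (rule finite_measure_lebesgue_on)
  have sL: "\<Omega> \<in> sets lebesgue" using U by auto
  have cc: "compact (closure \<Omega>)" using U by simp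
  have A: "A > 0" using ell by (simp add: elliptic_coeffs_def)
  have \<psi>2: "Ck_on 2 \<Omega> \<psi>" and c\<psi>: "continuous_on (closure \<Omega>) \<psi>"
    and eq: "\<And>x. x \<in> \<Omega> \<Longrightarrow> div_op a \<psi> x = g x (\<alpha> + \<mu> * \<psi> x)"
    and mass: "(LINT x|?M. g x (\<alpha> + \<mu> * \<psi> x)) = 1" and bd: "\<And>x. x \<in> frontier \<Omega> \<Longrightarrow> \<psi> x = 0"
    using sol by (auto simp: is_solution_def Ckr_closure_def Ck_closure_def)
  have \<psi>1: "Ck_on 1 \<Omega> \<psi>" by (rule Ck_on_mono[OF \<psi>2]) simp
  have pd\<psi>1: "Ck_on 1 \<Omega> (pd j \<psi>)" for j using Ck_on_pd[of 1 \<Omega> \<psi> j] \<psi>2 by (simp add: numeral_2_eq_2)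
  have a1: "Ck_on 1 \<Omega> (a i j)" for i j
    using ell Ck_on_mono[of 2 \<Omega> "a i j" 1] by (simp add: elliptic_coeffs_def Ck_closure_def)
  define u where "u x = \<alpha> + \<mu> * \<psi> x" for x
  define G where "G x = g x (u x)" for x
  define P where "P x = max 0 (u x)" for x
  have cu: "continuous_on (closure \<Omega>) u" unfolding u_def by (intro continuous_intros c\<psi>)
  have cG: "continuous_on (closure \<Omega>) G"
  proof -
    have "continuous_on (closure \<Omega> \<times> UNIV) (\<lambda>(x, z). g x z)" using adm by (simp add: admissible_nonlinearity_def)
    moreover have "continuous_on (closure \<Omega>) (\<lambda>x. (x, u x))" by (intro continuous_intros cu)
    ultimately have "continuous_on (closure \<Omega>) (\<lambda>x. (\<lambda>(x, z). g x z) (x, u x))"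
      by (rule continuous_on_compose2) auto
    then show ?thesis by (simp add: G_def[abs_def])
  qed
  have u1: "Ck_on 1 \<Omega> u" and pdu: "x \<in> \<Omega> \<Longrightarrow> pd i u x = \<mu> * pd i \<psi> x" for x i
  proof -
    have d: "((\<lambda>t. \<alpha> + \<mu> * t) has_real_derivative \<mu>) (at t)" for t by (auto intro!: derivative_eq_intros)
    show "Ck_on 1 \<Omega> u" unfolding u_def by (rule Ck_on_1_chain[OF \<psi>1 d]) (intro continuous_intros)
    show "x \<in> \<Omega> \<Longrightarrow> pd i u x = \<mu> * pd i \<psi> x" unfolding u_def by (rule pd_chain(1)[OF Ck_on_1D(1)[OF \<psi>1] d])
  qed
  have G0: "0 \<le> G x" "u x \<le> 0 \<Longrightarrow> G x = 0" "G x \<le> P x powr p" if "x \<in> \<Omega>" for x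
  proof -
    have "x \<in> closure \<Omega>" using that closure_subset by blast
    then have g: "\<And>z. g x z \<ge> 0" "\<And>z. z \<le> 0 \<Longrightarrow> g x z = 0" "\<And>z. 0 < z \<Longrightarrow> g x z \<le> z powr p"
      using adm by (auto simp: admissible_nonlinearity_def)
    show "0 \<le> G x" "u x \<le> 0 \<Longrightarrow> G x = 0" using g by (auto simp: G_def)
    show "G x \<le> P x powr p" using g(2)[of "u x"] g(3)[of "u x"] by (cases "u x \<le> 0") (auto simp: G_def P_def)
  qed
  have "compact (u ` closure \<Omega>)" using cu cc by (rule compact_continuous_image)
  then obtain B where B: "\<And>x. x \<in> \<Omega> \<Longrightarrow> \<bar>u x\<bar> \<le> B"
    using closure_subset[of \<Omega>] by (auto dest!: compact_imp_bounded simp: bounded_iff) blast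
  have PB: "0 \<le> P x" "P x \<le> \<bar>B\<bar>" if "x \<in> \<Omega>" for x using B[OF that] by (auto simp: P_def)
  have meas: "f \<in> borel_measurable ?M" if "continuous_on (closure \<Omega>) f" for f :: "real^'n \<Rightarrow> real"
    by (rule continuous_imp_measurable_on_sets_lebesgue[OF continuous_on_subset[OF that closure_subset] sL])
  have cP: "continuous_on (closure \<Omega>) P" unfolding P_def by (intro continuous_intros cu)
  have [measurable]: "u \<in> borel_measurable ?M" "G \<in> borel_measurable ?M" "P \<in> borel_measurable ?M"
    using meas cu cG cP by auto
  have massG: "(LINT x|?M. G x) = 1"
    by (subst mass[symmetric], rule Bochner_Integration.integral_cong) (simp_all add: G_def u_def)
  \<comment> \<open>A nonintegrable function has Bochner integral 0, so the value 1 forces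
    integrability.\<close>
  then have Gi: "integrable ?M G"
    using not_integrable_integral_eq[of ?M G] by fastforce
  have bint: "integrable ?M f" if "f \<in> borel_measurable ?M" "\<And>x. x \<in> \<Omega> \<Longrightarrow> \<bar>f x\<bar> \<le> b" for f :: "real^'n \<Rightarrow> real" and b
    by (rule M.integrable_const_bound[of _ b]) (use that in \<open>auto intro!: AE_I2\<close>)
  define Z where "Z = (LINT x|?M. P x powr (2 * p))"
  have PpB: "P x powr (2 * p) \<le> \<bar>B\<bar> powr (2 * p)" if "x \<in> \<Omega>" for x
    using PB[OF that] p by (intro powr_mono2) auto
  have Ppi: "integrable ?M (\<lambda>x. P x powr (2 * p))"
    by (rule bint[where b="\<bar>B\<bar> powr (2 * p)"]) (use PpB in auto)
  \<comment> \<open>If u_+ vanished almost everywhere, so would g, against the unit mass. Positivity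
    is needed for the final cancellation and for continuity of the power at the limit.\<close>
  have Z0: "0 < Z"
  proof -
    have "Z \<noteq> 0"
    proof
      assume "Z = 0"
      then have "AE x in ?M. P x powr (2 * p) = 0"
        using integral_nonneg_eq_0_iff_AE[OF Ppi] by (simp add: Z_def)
      then have "AE x in ?M. G x = 0"
      proof (rule AE_mp[OF _ AE_I2], intro impI)
        fix x assume "x \<in> space ?M" "P x powr (2 * p) = 0"
        then show "G x = 0" using G0(2)[of x] by (auto simp: P_def max_def split: if_splits)
      qed
      then have "(LINT x|?M. G x) = 0" by (rule integral_eq_zero_AE)
      then show False using massG by simp
    qed
    moreover have "0 \<le> Z" unfolding Z_def by (intro integral_nonneg_AE AE_I2) simp
    ultimately show ?thesis by simp
  qed
  have PGi: "integrable ?M (\<lambda>x. P x * G x)"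
  proof (rule Bochner_Integration.integrable_bound[where f="\<lambda>x. \<bar>B\<bar> * G x"])
    show "AE x in ?M. norm (P x * G x) \<le> norm (\<bar>B\<bar> * G x)"
      using PB G0(1) by (intro AE_I2) (auto simp: abs_mult intro!: mult_right_mono)
  qed (use Gi in auto)
  have hold: "(LINT x|?M. P x * G x) \<le> Z powr (1 / p)"
  proof -
    \<comment> \<open>\<open>Holder_integral\<close> asks for nonnegativity at every point, which
      \<open>G\<close> has only on \<Omega>.\<close>
    define G' where "G' x = \<bar>G x\<bar>" for x
    have p': "0 < 1 / p" "1 / p < 1" using p by auto
    have G'i: "integrable ?M G'" using Gi by (simp add: G'_def[abs_def])
    have "(LINT x|?M. G' x) = (LINT x|?M. G x)"
      by (rule Bochner_Integration.integral_cong[OF refl]) (simp add: G'_def G0(1))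
    then have mG': "(LINT x|?M. G' x) = 1" using massG by simp
    have PP0: "0 \<le> P x powr (2 * p)" and G'0: "0 \<le> G' x" for x by (auto simp: G'_def)
    note H = Holder_integral[OF p' Ppi PP0 G'i G'0]
    have "(LINT x|?M. P x * G x) \<le> (LINT x|?M. (P x powr (2 * p)) powr (1 / p) * G' x powr (1 - 1 / p))"
    proof (rule integral_mono[OF PGi H(1)])
      fix x assume "x \<in> space ?M"
      then have x: "x \<in> \<Omega>" by simp
      have "G x = G x powr (1 / p) * G x powr (1 - 1 / p)" using G0(1)[OF x] by (subst powr_add[symmetric]) simp
      also have "\<dots> \<le> (P x powr p) powr (1 / p) * G x powr (1 - 1 / p)"
        using G0[OF x] p by (intro mult_right_mono powr_mono2) auto
      also have "(P x powr p) powr (1 / p) = P x" using p PB(1)[OF x] by (simp add: powr_powr)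
      finally have "P x * G x \<le> P x * (P x * G x powr (1 - 1 / p))" using PB(1)[OF x] by (intro mult_left_mono)
      also have "\<dots> = (P x powr (2 * p)) powr (1 / p) * G' x powr (1 - 1 / p)"
        using p PB(1)[OF x] G0(1)[OF x] by (simp add: powr_powr G'_def power2_eq_square)
      finally show "P x * G x \<le> (P x powr (2 * p)) powr (1 / p) * G' x powr (1 - 1 / p)" .
    qed
    also have "\<dots> \<le> Z powr (1 / p)" using H(2) mG' by (simp add: Z_def)
    finally show ?thesis .
  qed
  have step: "A * (Lambda \<Omega> (2 * p) * (LINT x|?M. (pospart e (u x)) powr (2 * p)) powr (1 / p)) \<le> \<mu> * Z powr (1 / p)"
    if e: "e > 0" for e
  proof -
    \<comment> \<open>Since \<open>u = \<alpha> \<le> 0\<close> on the boundary, cutting at the level \<open>e > 0\<close> gives compact support in \<open>\<Omega>\<close>.\<close>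
    note h = pospart[OF e]
    define K where "K = {x \<in> closure \<Omega>. e \<le> u x}"
    have "K = closure \<Omega> \<inter> u -` {e..}" by (auto simp: K_def)
    then have "closed K" using continuous_closed_preimage[OF cu closed_closure closed_atLeast] by simp
    moreover have "bounded K" by (rule bounded_subset[OF bounded_closure[OF U(2)]]) (auto simp: K_def)
    ultimately have K: "compact K" by (simp add: compact_eq_bounded_closed)
    have K\<Omega>: "K \<subseteq> \<Omega>"
    proof
      fix x assume x: "x \<in> K"
      show "x \<in> \<Omega>"
      proof (rule ccontr)
        assume "x \<notin> \<Omega>"
        then have "x \<in> frontier \<Omega>" using x U(1) by (simp add: K_def frontier_def interior_open)
        then show False using bd[of x] x \<alpha> e by (simp add: K_def u_def)
      qed
    qed
    have h0: "pospart e (u x) = 0" if "x \<in> \<Omega>" "x \<notin> K" for x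
    proof -
      have "x \<in> closure \<Omega>" using that closure_subset by blast
      then show ?thesis using h(5)[of "u x"] that by (auto simp: K_def)
    qed
    define H where "H x = pospart e (u x)" for x
    define w where "w x = (if x \<in> \<Omega> then H x else 0)" for x
    have H1: "Ck_on 1 \<Omega> H" unfolding H_def by (rule Ck_on_1_chain[OF u1 h(1,2)])
    have pdH: "pd i H x = pospart' e (u x) * (\<mu> * pd i \<psi> x)" if "x \<in> \<Omega>" for i x
      unfolding H_def pdu[OF that, symmetric] by (rule pd_chain(1)[OF Ck_on_1D(1)[OF u1 that] h(1)])
    note W = extend_by_zero[OF U(1) K K\<Omega> H1, folded w_def]
    have Hz: "H x = 0" if "x \<in> \<Omega>" "x \<notin> K" for x using h0[OF that] by (simp add: H_def)
    note W = W[OF Hz]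
    have Kw: "compact (closure {x. w x \<noteq> 0})" "closure {x. w x \<noteq> 0} \<subseteq> \<Omega>"
      using compact_Int_closed[OF K closed_closure[of "{x. w x \<noteq> 0}"]] W(3) K\<Omega> by (auto simp: inf_absorb2)
    \<comment> \<open>The flux a \<nabla>\<psi> multiplied by the truncation, entry by entry.
      Testing the equation with \<open>H\<close> amounts to integrating the divergence
      \<open>S\<close> of this compactly supported field, and that integral is zero.\<close>
    define F where "F i j x = H x * (a i j x * pd j \<psi> x)" for i j x
    define F0 where "F0 i j x = (if x \<in> \<Omega> then F i j x else 0)" for i j x
    have v1: "Ck_on 1 \<Omega> (\<lambda>x. a i j x * pd j \<psi> x)" for i j by (rule Ck_on_1_mult[OF a1 pd\<psi>1])
    have F1: "Ck_on 1 \<Omega> (F i j)" for i j unfolding F_def by (rule Ck_on_1_mult[OF H1 v1])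
    have Fz: "F i j x = 0" if "x \<in> \<Omega>" "x \<notin> K" for i j x using Hz[OF that] by (simp add: F_def)
    note E = extend_by_zero[OF U(1) K K\<Omega> F1 Fz, folded F0_def]
    have E1: "Ck_on 1 UNIV (F0 i j)" for i j by (rule E(1))
    have E2: "pd k (F0 i j) x = (if x \<in> \<Omega> then pd k (F i j) x else 0)" for i j k x by (rule E(2))
    have E3: "bounded {x. F0 i j x \<noteq> 0}" for i j
      by (rule bounded_subset[OF U(2)]) (auto simp: F0_def)
    have pdF: "pd i (F i j) x = pospart' e (u x) * \<mu> * (a i j x * pd i \<psi> x * pd j \<psi> x) + H x * pd i (\<lambda>y. a i j y * pd j \<psi> y) x"
      if x: "x \<in> \<Omega>" for i j x
      unfolding F_def by (subst pd_mult[OF Ck_on_1D(1)[OF H1 x] Ck_on_1D(1)[OF v1 x]]) (simp add: pdH[OF x])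
    define Q where "Q x = (\<Sum>i\<in>UNIV. \<Sum>j\<in>UNIV. a i j x * pd i \<psi> x * pd j \<psi> x)" for x
    define S where "S x = (\<Sum>i\<in>UNIV. \<Sum>j\<in>UNIV. pd i (F0 i j) x)" for x
    have ipd: "integrable lborel (pd i (F0 i j))" for i j
      by (rule continuous_bounded_support(1)[OF Ck_on_1D(2)[OF E1] bounded_pd_support[OF E3]])
    have Si: "integrable lborel S" unfolding S_def[abs_def] by (intro Bochner_Integration.integrable_sum ipd)
    have S0: "(LINT x|lborel. S x) = 0"
      unfolding S_def using ipd by (simp add: integral_pd_eq_0[OF E1 E3])
    have S\<Omega>: "S x = \<mu> * pospart' e (u x) * Q x - H x * G x" if x: "x \<in> \<Omega>" for x
    proof -
      have "S x = (\<Sum>i\<in>UNIV. \<Sum>j\<in>UNIV. pospart' e (u x) * \<mu> * (a i j x * pd i \<psi> x * pd j \<psi> x)) + (\<Sum>i\<in>UNIV. \<Sum>j\<in>UNIV. H x * pd i (\<lambda>y. a i j y * pd j \<psi> y) x)"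
        using x by (simp add: S_def E2 pdF sum.distrib)
      also have "\<dots> = \<mu> * pospart' e (u x) * Q x - H x * div_op a \<psi> x"
        by (simp add: Q_def div_op_def sum_distrib_left mult.commute mult.left_commute)
      finally show ?thesis using eq[OF x] by (simp add: G_def u_def)
    qed
    have Sz: "S x = 0" if "x \<notin> \<Omega>" for x using that by (simp add: S_def E2)
    have Sm: "S \<in> borel_measurable borel" using Si by auto
    have SM: "integrable ?M S" "(LINT x|?M. S x) = 0"
      using lebesgue_on_lborel(1,2)[OF U(1) Sm Sz] Si S0 by auto
    have cgw: "continuous_on UNIV (\<lambda>x. (norm (grad w x))\<^sup>2)" by (intro continuous_intros Ck_on_1D(4)[OF W(1)])
    have gz: "grad w x = 0" if "x \<notin> \<Omega>" for x using that W(2) by (simp add: grad_def vec_eq_iff)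
    have bw: "bounded {x. w x \<noteq> 0}" by (rule bounded_subset[OF U(2)]) (auto simp: w_def)
    have gi: "integrable lborel (\<lambda>x. (norm (grad w x))\<^sup>2)"
      by (rule continuous_bounded_support(1)[OF cgw]) (use bounded_grad_support[OF bw] in simp)
    note gM = lebesgue_on_lborel[OF U(1) borel_measurable_continuous_onI[OF cgw]]
    have gM: "(LINT x|?M. (norm (grad w x))\<^sup>2) = (LINT x|lborel. (norm (grad w x))\<^sup>2)" "integrable ?M (\<lambda>x. (norm (grad w x))\<^sup>2)"
      using gM(1,2) gz gi by auto
    have [measurable]: "H \<in> borel_measurable ?M"
      using continuous_imp_measurable_on_sets_lebesgue[OF Ck_on_1D(3)[OF H1] sL] .
    have HP: "0 \<le> H x" "H x \<le> P x" for x using h(6,7)[of "u x"] by (auto simp: H_def P_def)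
    have HGi: "integrable ?M (\<lambda>x. H x * G x)"
    proof (rule Bochner_Integration.integrable_bound[OF PGi])
      show "AE x in ?M. norm (H x * G x) \<le> norm (P x * G x)"
        using HP G0(1) order_trans[OF HP] by (intro AE_I2) (auto simp: abs_mult intro!: mult_right_mono)
    qed measurable
    have pw: "A * (norm (grad w x))\<^sup>2 \<le> \<mu> * S x + \<mu> * (H x * G x)" if x: "x \<in> \<Omega>" for x
    proof -
      let ?h = "pospart' e (u x)"
      have "grad w x = (?h * \<mu>) *\<^sub>R grad \<psi> x" using x W(2) pdH[OF x] by (simp add: grad_def vec_eq_iff)
      then have "A * (norm (grad w x))\<^sup>2 = (?h * ?h) * (\<mu>\<^sup>2 * (A * (norm (grad \<psi> x))\<^sup>2))"
        by (simp add: power_mult_distrib power2_eq_square ac_simps)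
      \<comment> \<open>The chain rule produces the square of the slope, but the tested equation
        contains only its first power; a slope in the interval from 0 to 1 bridges the gap.\<close>
      also have "\<dots> \<le> ?h * (\<mu>\<^sup>2 * (A * (norm (grad \<psi> x))\<^sup>2))"
        using mult_left_mono[OF h(4)[of "u x"] h(3)[of "u x"]] A by (intro mult_right_mono) auto
      also have "\<dots> \<le> ?h * (\<mu>\<^sup>2 * Q x)"
      proof (intro mult_left_mono h(3))
        have "x \<in> closure \<Omega>" using x closure_subset by blast
        then have "A * (norm (grad \<psi> x))\<^sup>2 \<le> (\<Sum>i\<in>UNIV. \<Sum>j\<in>UNIV. a i j x * grad \<psi> x $ i * grad \<psi> x $ j)"
          using ell by (simp add: elliptic_coeffs_def)
        then show "A * (norm (grad \<psi> x))\<^sup>2 \<le> Q x" by (simp add: Q_def grad_def)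
      qed simp
      also have "\<dots> = \<mu> * S x + \<mu> * (H x * G x)" by (simp add: S\<Omega>[OF x] power2_eq_square algebra_simps)
      finally show ?thesis .
    qed
    have "A * (LINT x|?M. (norm (grad w x))\<^sup>2) = (LINT x|?M. A * (norm (grad w x))\<^sup>2)" by simp
    also have "\<dots> \<le> (LINT x|?M. \<mu> * S x + \<mu> * (H x * G x))"
      by (rule integral_mono) (use gM(2) SM(1) HGi pw in auto)
    also have "\<dots> = \<mu> * (LINT x|?M. H x * G x)" using SM HGi by simp
    also have "\<dots> \<le> \<mu> * (LINT x|?M. P x * G x)"
      using \<mu> HP G0(1) by (intro mult_left_mono integral_mono HGi PGi mult_right_mono) auto
    also have "\<dots> \<le> \<mu> * Z powr (1 / p)" using hold \<mu> by (intro mult_left_mono) auto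
    finally have up: "A * (LINT x|lborel. (norm (grad w x))\<^sup>2) \<le> \<mu> * Z powr (1 / p)" using gM(1) by simp
    have cw: "continuous_on UNIV (\<lambda>x. \<bar>w x\<bar> powr (2 * p))"
      using p by (intro continuous_on_powr' continuous_intros Ck_on_1D(3)[OF W(1)]) auto
    have "(LINT x|lborel. \<bar>w x\<bar> powr (2 * p)) = (LINT x|?M. \<bar>w x\<bar> powr (2 * p))"
      by (rule lebesgue_on_lborel(1)[OF U(1) borel_measurable_continuous_onI[OF cw], symmetric]) (simp add: w_def)
    also have "\<dots> = (LINT x|?M. pospart e (u x) powr (2 * p))"
      by (rule Bochner_Integration.integral_cong[OF refl]) (use HP(1) in \<open>simp add: w_def H_def\<close>)
    finally have "Lambda \<Omega> (2 * p) * (LINT x|?M. pospart e (u x) powr (2 * p)) powr (1 / p) \<le> (LINT x|lborel. (norm (grad w x))\<^sup>2)"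
      using Lambda_le_C1[OF U W(1) Kw, of "2 * p"] p by simp
    then show ?thesis using up A by (meson mult_left_mono less_imp_le order_trans)
  qed
  define \<epsilon> where "\<epsilon> k = inverse (real (Suc k))" for k
  have \<epsilon>: "0 < \<epsilon> k" for k by (simp add: \<epsilon>_def)
  have \<epsilon>0: "\<epsilon> \<longlonglongrightarrow> 0" unfolding \<epsilon>_def by (rule LIMSEQ_inverse_real_of_nat)
  have lim: "(\<lambda>k. LINT x|?M. pospart (\<epsilon> k) (u x) powr (2 * p)) \<longlonglongrightarrow> Z"
    unfolding Z_def
  proof (rule integral_dominated_convergence[OF _ _ Ppi])
    show "AE x in ?M. (\<lambda>k. pospart (\<epsilon> k) (u x) powr (2 * p)) \<longlonglongrightarrow> P x powr (2 * p)"
    proof (rule AE_I2)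
      fix x
      have "(\<lambda>k. 2 * \<epsilon> k) \<longlonglongrightarrow> 0" using tendsto_mult_left[OF \<epsilon>0, of 2] by simp
      then have "(\<lambda>k. pospart (\<epsilon> k) (u x) - P x) \<longlonglongrightarrow> 0"
      proof (rule Lim_null_comparison[rotated], intro always_eventually allI)
        fix k show "norm (pospart (\<epsilon> k) (u x) - P x) \<le> 2 * \<epsilon> k"
          using pospart(7,8)[OF \<epsilon>[of k], of "u x"] by (simp add: P_def)
      qed
      then show "(\<lambda>k. pospart (\<epsilon> k) (u x) powr (2 * p)) \<longlonglongrightarrow> P x powr (2 * p)"
        using p pospart(6)[OF \<epsilon>] by (intro tendsto_powr' tendsto_const) (auto simp: LIM_zero_iff)
    qed
    show "AE x in ?M. norm (pospart (\<epsilon> k) (u x) powr (2 * p)) \<le> P x powr (2 * p)" for k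
      using p pospart(6,7)[OF \<epsilon>[of k]] by (intro AE_I2) (auto intro!: powr_mono2 simp: P_def)
    show "(\<lambda>x. pospart (\<epsilon> k) (u x) powr (2 * p)) \<in> borel_measurable ?M" for k
      unfolding pospart_def by measurable
  qed measurable
  have "A * (Lambda \<Omega> (2 * p) * Z powr (1 / p)) \<le> \<mu> * Z powr (1 / p)"
  proof (rule LIMSEQ_le_const2)
    show "(\<lambda>k. A * (Lambda \<Omega> (2 * p) * (LINT x|?M. pospart (\<epsilon> k) (u x) powr (2 * p)) powr (1 / p)))
      \<longlonglongrightarrow> A * (Lambda \<Omega> (2 * p) * Z powr (1 / p))"
      using Z0 by (intro tendsto_mult tendsto_const tendsto_powr lim) auto
  qed (use step[OF \<epsilon>] in blast)
  then have "(A * Lambda \<Omega> (2 * p)) * Z powr (1 / p) \<le> \<mu> * Z powr (1 / p)" by (simp only: mult.assoc)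
  then show ?thesis using Z0 by (simp add: mult_le_cancel_right)
qed

theorem theorem1p2:
  fixes \<Omega> :: "(real^'n) set"
    and a :: "'n \<Rightarrow> 'n \<Rightarrow> real^'n \<Rightarrow> real"
    and g :: "real^'n \<Rightarrow> real \<Rightarrow> real"
    and A p r :: real
  assumes "CARD('n) \<ge> 2"
    and "smooth_bounded_domain \<Omega>"
    and "measure lebesgue \<Omega> = 1"
    and "0 < r" and "r < 1"
    and "elliptic_coeffs \<Omega> A a"
    and "1 < p" and "ereal p < crit_exponent CARD('n)"
    and "admissible_nonlinearity \<Omega> p g"
  shows "lambda_plus r \<Omega> a g > ereal (A / p * Lambda \<Omega> (2 * p))"
proof -
  have U: "open \<Omega>" "bounded \<Omega>" "\<Omega> \<noteq> {}" using assms(2) by (auto simp: smooth_bounded_domain_def)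
  have A: "A > 0" using assms(6) by (simp add: elliptic_coeffs_def)
  \<comment> \<open>The product form of subcriticality also covers N = 2, where the critical
    exponent is infinite and the left side is 0.\<close>
  have "p * (real CARD('n) - 2) < real CARD('n)"
  proof (cases "CARD('n) = 2")
    case True
    then show ?thesis by simp
  next
    case False
    then have "0 < real CARD('n) - 2" using assms(1) by simp
    moreover have "p < real CARD('n) / (real CARD('n) - 2)" using assms(8) False by (simp add: crit_exponent_def)
    ultimately show ?thesis by (simp add: pos_less_divide_eq)
  qed
  then have L: "Lambda \<Omega> (2 * p) > 0" by (rule Lambda_pos[OF assms(1) U assms(7)])
  \<comment> \<open>The threshold set constrains only \<mu> < l, so the non-strict conclusion A
    \<Lambda> \<le> \<mu> of \<open>Lambda_threshold\<close> already places l = A \<Lambda> in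
    it.\<close>
  have "\<alpha> > 0" if \<mu>: "0 \<le> \<mu>" "\<mu> < A * Lambda \<Omega> (2 * p)" and sol: "is_solution r \<Omega> a g \<mu> \<alpha> \<psi>" for \<mu> \<alpha> \<psi>
  proof (rule ccontr)
    assume "\<not> \<alpha> > 0"
    then have \<alpha>: "\<alpha> \<le> 0" by simp
    show False
    \<comment> \<open>For \<mu> = 0 the argument of g is the constant \<alpha> \<le> 0, so g
      vanishes on \<Omega> and cannot have mass 1.\<close>
    proof (cases "\<mu> = 0")
      case True
      have "g x (\<alpha> + \<mu> * \<psi> x) = 0" if "x \<in> \<Omega>" for x
        using assms(9) that closure_subset[of \<Omega>] \<alpha> True by (auto simp: admissible_nonlinearity_def)
      then have "(LINT x|lebesgue_on \<Omega>. g x (\<alpha> + \<mu> * \<psi> x)) = (LINT x|lebesgue_on \<Omega>. 0)"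
        by (intro Bochner_Integration.integral_cong) auto
      then show False using sol by (simp add: is_solution_def)
    next
      case False
      then show False using Lambda_threshold[OF U(1,2) assms(6,7,9) sol _ \<alpha>] \<mu> by simp
    qed
  qed
  moreover have "0 < A * Lambda \<Omega> (2 * p)" using A L by simp
  ultimately have "ereal (A * Lambda \<Omega> (2 * p)) \<le> lambda_plus r \<Omega> a g"
    unfolding lambda_plus_def by (intro Sup_upper) blast
  moreover have "A / p * Lambda \<Omega> (2 * p) < A * Lambda \<Omega> (2 * p)"
    using assms(7) A L by (simp add: divide_less_eq)
  ultimately show ?thesis using less_le_trans by (metis less_ereal.simps(1))
qed

end
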